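(* Let $\mathfrak a=((\lambda_j,\alpha_j))_{j\in\mathbb Z_+}$, where $(\lambda_j)_{j\in\mathbb Z_+}$ is a strictly increasing sequence of non-negative numbers and the $\alpha_j$ are nonzero matrices in $M_r^+$, and let $\mathfrak b=((\lambda_j,\alpha_j))_{j\in\mathbb N}$. Then $$\mathfrak a\in\mathfrak A\iff \bigl(\mathfrak b\in\mathfrak B\ \text{ and }\ \lambda_0=0,\ \alpha_0>0\bigr).$$
   Context: Fix $r\in\mathbb N$. $M_r$ is the algebra of $r\times r$ complex matrices with unit $I$; $M_r^+=\{A\in M_r: A=A^*\ge0\}$; $\alpha_0>0$ means positive definite. $\mathbb Z_+=\{0,1,2,\dots\}$, $\mathbb N=\{1,2,\dots\}$. $L_2=L_2((0,1),\mathbb C^r)$, $\mathbf L_2=L_2((0,1),M_r)$, $\Re\mathbf L_2=\{u\in\mathbf L_2: u=u^*\}$, $W_2^1=W_2^1((0,1),\mathbb C^r)$, $W_{2,0}^1=\{f\in W_2^1: f(0)=f(1)=0\}$, $\mathbf W_2^{-1}=W_2^{-1}((0,1),M_r)$. Miura map: $b:\mathbf L_2\to\mathbf W_2^{-1}$, $b(u)=u'+u^2$ (distributional derivative); $\Re\mathfrak M=\{b(u):u\in\Re\mathbf L_2\}$. Spectral data. For $\tau\in\Re\mathbf L_2$ the operator $S_\tau$ in $L_2$ is $S_\tau f=-\left(\frac{d}{dx}-\tau\right)\left(\frac{d}{dx}+\tau\right)f$ with domain $\{f\in W_2^1: f'+\tau f\in W_{2,0}^1\}$. It is self-adjoint and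 nonnegative, and its spectrum consists of countably many isolated eigenvalues accumulating at $+\infty$, the smallest being $0$. Let $0=\lambda_0(\tau)<\lambda_1(\tau)<\cdots$ be the square roots of the pairwise distinct eigenvalues of $S_\tau$. For $q=b(\tau)$, the operator $T_qf=-\left(\frac{d}{dx}+\tau\right)\left(\frac{d}{dx}-\tau\right)f=-f''+qf$ with domain $\{f\in W_{2,0}^1: f'-\tau f\in W_2^1\}$ depends only on $q$, is self-adjoint and positive, and has spectrum $\{\lambda_j^2(\tau)\}_{j\ge1}$. For $\tau\in\mathbf L_2$ and $\lambda\in\mathbb C$, let $\varphi(\cdot,\lambda,\tau)$ and $\psi(\cdot,\lambda,\tau)$ be the unique $M_r$-valued solutions on $[0,1]$ of $$-\left(\tfrac{d}{dx}+\tau\right)\left(\tfrac{d}{dx}-\tau\right)\varphi=\lambda^2\varphi,\quad \varphi(0)=0,\quad (\varphi'-\tau\varphi)(0)=\lambda I,$$ $$-\left(\tfrac{d}{dx}-\tau\right)\left(\tfrac{d}{dx}+\tau\right)\psi=\lambda^2\psi,\quad \psi(0)=I,\quad (\psi'+\tau\psi)(0)=0$$ ($\varphi$ and $\varphi'-\tau\varphi$, respectively $\psi$ and $\psi'+\tau\psi$, belonging to $W_2^1((0,1),M_r)$). The Weyl--Titchmarsh function is the meromorphic function $m_\tau(\lambda)=-\varphi(1,\lambda,\tau)^{-1}\psi(1,\lambda,-\tau)$. For $\tau\in\Re\mathbf L_2$ the norming constants are $\alpha_0(\tau)=-\tfrac12\operatorname{res}_{\lambda=0}m_\tau(\lambda)$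 and $\alpha_j(\tau)=-\operatorname{res}_{\lambda=\lambda_j(\tau)}m_\tau(\lambda)$, $j\in\mathbb N$. Set $\mathfrak a_\tau=((\lambda_j(\tau),\alpha_j(\tau)))_{j\in\mathbb Z_+}$ and $\mathfrak A=\{\mathfrak a_\tau:\tau\in\Re\mathbf L_2\}$. The sequence $((\lambda_j(\tau),\alpha_j(\tau)))_{j\in\mathbb N}$ depends only on $q=b(\tau)$ and is denoted $\mathfrak b_q$; set $\mathfrak B=\{\mathfrak b_q:q\in\Re\mathfrak M\}$. *)

theory Defs
  imports "HOL-Complex_Analysis.Complex_Analysis" "HOL-Library.FuncSet"
begin

section \<open>Hermitian and positive matrices\<close>

definition mat_adj :: "complex^'n^'m \<Rightarrow> complex^'m^'n" where
  "mat_adj A = (\<chi> i j. cnj (A $ j $ i))"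

definition cinner :: "complex^'n \<Rightarrow> complex^'n \<Rightarrow> complex" where
  "cinner v w = (\<Sum>i\<in>UNIV. v $ i * cnj (w $ i))"

text \<open>For \<^term>\<open>A = mat_adj A\<close> the number \<^term>\<open>cinner (A *v v) v\<close> is real.\<close>

definition psd :: "(complex^'n^'n) set" where
  "psd = {A. A = mat_adj A \<and> (\<forall>v. 0 \<le> Re (cinner (A *v v) v))}"

definition pos_def :: "complex^'n^'n \<Rightarrow> bool" where
  "pos_def A \<longleftrightarrow> A = mat_adj A \<and> (\<forall>v. v \<noteq> 0 \<longrightarrow> 0 < Re (cinner (A *v v) v))"


section \<open>Function spaces on the unit interval\<close>

text \<open>
  Elements of \<open>L\<^sub>2\<close> are represented by functions on the real line of which only the
  restriction to the open unit interval, up to null sets, is relevant.  The codomain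
  \<^typ>\<open>complex^'n\<close> or \<^typ>\<open>complex^'n^'n\<close> carries its Euclidean norm.
\<close>

abbreviation unit_int :: "real measure" where
  "unit_int \<equiv> lebesgue_on {0<..<1}"

definition ae_eq :: "(real \<Rightarrow> 'a) \<Rightarrow> (real \<Rightarrow> 'a) \<Rightarrow> bool" (infix \<open>\<approx>\<close> 50) where
  "f \<approx> g \<longleftrightarrow> (AE x in unit_int. f x = g x)"

definition L2 :: "(real \<Rightarrow> 'a::euclidean_space) set" where
  "L2 = {f \<in> borel_measurable unit_int. integrable unit_int (\<lambda>x. (norm (f x))\<^sup>2)}"

definition ReL2 :: "(real \<Rightarrow> complex^'n^'n) set" where
  "ReL2 = {u \<in> L2. u \<approx> (\<lambda>x. mat_adj (u x))}"

text \<open>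
  An element of \<open>W\<^sub>2\<^sup>1\<close> is represented by its absolutely continuous representative on the
  closed unit interval, so that boundary values make sense.  Values outside are irrelevant.
\<close>

definition has_L2_deriv ::
    "(real \<Rightarrow> 'a::euclidean_space) \<Rightarrow> (real \<Rightarrow> 'a) \<Rightarrow> bool" where
  "has_L2_deriv f g \<longleftrightarrow>
     g \<in> L2 \<and> (\<forall>x\<in>{0..1}. (g has_integral (f x - f 0)) {0..x})"

definition W21 :: "(real \<Rightarrow> 'a::euclidean_space) set" where
  "W21 = {f. \<exists>g. has_L2_deriv f g}"

definition W21_0 :: "(real \<Rightarrow> 'a::euclidean_space) set" where
  "W21_0 = {f \<in> W21. f 0 = 0 \<and> f 1 = 0}"

text \<open>The derivative of an element of \<^const>\<open>W21\<close>; it is unique as an element of \<^const>\<open>L2\<close>.\<close>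

definition wderiv :: "(real \<Rightarrow> 'a::euclidean_space) \<Rightarrow> real \<Rightarrow> 'a" where
  "wderiv f = (SOME g. has_L2_deriv f g)"


section \<open>The Miura map\<close>

text \<open>
  An element of \<open>W\<^sub>2\<^sup>-\<^sup>1\<close>, the dual space of \<open>W\<^sub>2\<^sub>,\<^sub>0\<^sup>1\<close>, with values in the matrices is
  represented by a matrix-valued functional on scalar test functions.  Thus \<open>u'\<close> is the
  functional sending \<open>f\<close> to the integral of \<open>- f' u\<close>, and the matrix function
  \<open>u\<^sup>2\<close> sends \<open>f\<close> to the integral of \<open>f u\<^sup>2\<close>.
\<close>

definition miura ::
    "(real \<Rightarrow> complex^'n^'n) \<Rightarrow> (real \<Rightarrow> complex) \<Rightarrow> complex^'n^'n" where
  "miura u = (\<lambda>f\<in>W21_0.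
     - (\<integral>x. mat (wderiv f x) ** u x \<partial>unit_int) + (\<integral>x. mat (f x) ** (u x ** u x) \<partial>unit_int))"

definition ReM :: "((real \<Rightarrow> complex) \<Rightarrow> complex^'n^'n) set" where
  "ReM = miura ` ReL2"


section \<open>Spectral data\<close>

text \<open>
  \<^term>\<open>S_op \<tau> f g\<close> says that \<open>f\<close> lies in the domain of \<open>S\<^sub>\<tau>\<close> and \<open>S\<^sub>\<tau> f = g\<close>;
  \<open>h\<close> is the absolutely continuous representative of \<open>f' + \<tau> f\<close>.
\<close>

definition S_op ::
    "(real \<Rightarrow> complex^'n^'n) \<Rightarrow> (real \<Rightarrow> complex^'n) \<Rightarrow> (real \<Rightarrow> complex^'n) \<Rightarrow> bool" where
  "S_op \<tau> f g \<longleftrightarrow> f \<in> W21 \<and>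
     (\<exists>h\<in>W21_0. h \<approx> (\<lambda>x. wderiv f x + \<tau> x *v f x) \<and>
                g \<approx> (\<lambda>x. - (wderiv h x - \<tau> x *v h x)))"

definition S_eigenvalue :: "(real \<Rightarrow> complex^'n^'n) \<Rightarrow> complex \<Rightarrow> bool" where
  "S_eigenvalue \<tau> \<mu> \<longleftrightarrow> (\<exists>f. \<not> f \<approx> (\<lambda>_. 0) \<and> S_op \<tau> f (\<lambda>x. \<mu> *s f x))"

definition sqrt_eigenvalues :: "(real \<Rightarrow> complex^'n^'n) \<Rightarrow> real set" where
  "sqrt_eigenvalues \<tau> = {l. 0 \<le> l \<and> S_eigenvalue \<tau> (complex_of_real (l\<^sup>2))}"

text \<open>
  The increasing enumeration of \<^const>\<open>sqrt_eigenvalues\<close>.  For \<open>\<tau> \<in> ReL2\<close> the spectrum of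
  \<open>S\<^sub>\<tau>\<close> consists of infinitely many isolated eigenvalues accumulating only at infinity,
  so all the minima exist.
\<close>

primrec eig :: "(real \<Rightarrow> complex^'n^'n) \<Rightarrow> nat \<Rightarrow> real" where
  "eig \<tau> 0 = (LEAST l. l \<in> sqrt_eigenvalues \<tau>)"
| "eig \<tau> (Suc j) = (LEAST l. l \<in> sqrt_eigenvalues \<tau> \<and> eig \<tau> j < l)"

text \<open>
  In the next two definitions \<open>h\<close> is the absolutely continuous representative of the
  quasi-derivative \<open>y' - \<tau> y\<close> and \<open>y' + \<tau> y\<close>, respectively.  The solutions are
  unique on the closed unit interval, which is where they are evaluated.
\<close>

definition is_phi ::
    "(real \<Rightarrow> complex^'n^'n) \<Rightarrow> complex \<Rightarrow> (real \<Rightarrow> complex^'n^'n) \<Rightarrow> bool" where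
  "is_phi \<tau> l y \<longleftrightarrow> y \<in> W21 \<and>
     (\<exists>h\<in>W21. h \<approx> (\<lambda>x. wderiv y x - \<tau> x ** y x) \<and>
        (\<lambda>x. - (wderiv h x + \<tau> x ** h x)) \<approx> (\<lambda>x. mat (l\<^sup>2) ** y x) \<and>
        y 0 = 0 \<and> h 0 = mat l)"

definition is_psi ::
    "(real \<Rightarrow> complex^'n^'n) \<Rightarrow> complex \<Rightarrow> (real \<Rightarrow> complex^'n^'n) \<Rightarrow> bool" where
  "is_psi \<tau> l y \<longleftrightarrow> y \<in> W21 \<and>
     (\<exists>h\<in>W21. h \<approx> (\<lambda>x. wderiv y x + \<tau> x ** y x) \<and>
        (\<lambda>x. - (wderiv h x - \<tau> x ** h x)) \<approx> (\<lambda>x. mat (l\<^sup>2) ** y x) \<and>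
        y 0 = mat 1 \<and> h 0 = 0)"

definition phi :: "real \<Rightarrow> complex \<Rightarrow> (real \<Rightarrow> complex^'n^'n) \<Rightarrow> complex^'n^'n" where
  "phi x l \<tau> = (SOME y. is_phi \<tau> l y) x"

definition psi :: "real \<Rightarrow> complex \<Rightarrow> (real \<Rightarrow> complex^'n^'n) \<Rightarrow> complex^'n^'n" where
  "psi x l \<tau> = (SOME y. is_psi \<tau> l y) x"

definition weyl :: "(real \<Rightarrow> complex^'n^'n) \<Rightarrow> complex \<Rightarrow> complex^'n^'n" where
  "weyl \<tau> l = - (matrix_inv (phi 1 l \<tau>) ** psi 1 l (\<lambda>x. - \<tau> x))"

definition mat_residue :: "(complex \<Rightarrow> complex^'n^'n) \<Rightarrow> complex \<Rightarrow> complex^'n^'n" where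
  "mat_residue m z = (\<chi> i j. residue (\<lambda>l. m l $ i $ j) z)"

definition norming :: "(real \<Rightarrow> complex^'n^'n) \<Rightarrow> nat \<Rightarrow> complex^'n^'n" where
  "norming \<tau> j =
     (if j = 0 then - ((1/2) *\<^sub>R mat_residue (weyl \<tau>) 0)
      else - mat_residue (weyl \<tau>) (complex_of_real (eig \<tau> j)))"

definition data_a :: "(real \<Rightarrow> complex^'n^'n) \<Rightarrow> nat \<Rightarrow> real \<times> (complex^'n^'n)" where
  "data_a \<tau> = (\<lambda>j. (eig \<tau> j, norming \<tau> j))"

definition frak_A :: "(nat \<Rightarrow> real \<times> (complex^'n^'n)) set" where
  "frak_A = data_a ` ReL2"

text \<open>
  The sequence indexed by \<open>1, 2, \<dots>\<close> that belongs to \<open>q\<close> is represented with index shifted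
  by one.  It does not depend on the choice of \<open>\<tau>\<close> with \<open>b(\<tau>) = q\<close>.
\<close>

definition data_b ::
    "((real \<Rightarrow> complex) \<Rightarrow> complex^'n^'n) \<Rightarrow> nat \<Rightarrow> real \<times> (complex^'n^'n)" where
  "data_b q = (let \<tau> = (SOME \<tau>. \<tau> \<in> ReL2 \<and> miura \<tau> = q) in (\<lambda>j. data_a \<tau> (Suc j)))"

definition frak_B :: "(nat \<Rightarrow> real \<times> (complex^'n^'n)) set" where
  "frak_B = data_b ` ReM"

end

theory Submission
  imports Defs
begin

text \<open>
  Two Hermitian potentials \<open>\<tau>\<close> and \<open>\<tau>'\<close> with the same Miura image differ by an absolutely
  continuous function \<open>S\<close> with \<open>S' = \<tau>\<^sup>2 - \<tau>'\<^sup>2\<close> (\<open>miura_eq_imp_gauge_rel\<close>); the test functions that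
  prove this are the primitives of functions of mean zero.  If \<open>S\<close> relates \<open>\<tau>\<close> and
  \<open>\<tau>'\<close> in this way, then replacing the quasi-derivative \<open>h = y' - \<tau> y\<close> by \<open>h - S y\<close> turns
  solutions of the Dirichlet equation for \<open>\<tau>\<close> into solutions for \<open>\<tau>'\<close> (\<open>sys_gauge\<close>).
  A nonzero eigenvalue of \<open>S\<^sub>\<tau>\<close> is an eigenvalue of that Dirichlet problem, hence the eigenvalues
  of \<open>S\<^sub>\<tau>\<close> and \<open>S\<^sub>\<tau>\<^sub>'\<close> coincide, 0 being common to all of them.  The solution \<open>\<phi>\<close> is the same for
  both potentials, and \<open>\<psi>\<close> changes by a multiple of \<open>\<phi>\<close>, so that
  \<open>m\<^sub>\<tau>\<^sub>'(\<lambda>) = m\<^sub>\<tau>(\<lambda>) - S(0) / \<lambda>\<close> (\<open>weyl_gauge\<close>).  Consequently the norming constants at nonzero points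
  agree, while \<open>\<alpha>\<^sub>0(\<tau>') = \<alpha>\<^sub>0(\<tau>) + S(0) / 2\<close>.

  At zero energy everything is explicit.  Let \<open>E' = \<tau> E\<close> and \<open>H' = - \<tau> H\<close> with initial value 1, so
  that \<open>H\<^sup>* E = 1\<close>, and let \<open>G(x)\<close> be the integral of \<open>H\<^sup>* H\<close> over \<open>[0, x]\<close>.  Then \<open>\<phi>(1, \<lambda>) / \<lambda>\<close> tends to
  \<open>E(1) G(1)\<close> and \<open>\<psi>(1, \<lambda>)\<close> to \<open>E(1)\<close>, whence \<open>\<alpha>\<^sub>0(\<tau>) = G(1)\<^sup>-\<^sup>1 / 2\<close>, which is positive definite
  (\<open>norming_zero\<close>, \<open>pos_def_inv_gram\<close>).  The residues make sense because the values of solutions at 1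
  are entire functions of the spectral parameter (\<open>sys_solution\<close>).

  For the converse a matrix \<open>\<alpha>\<^sub>0 > 0\<close> is realised by \<open>S(0) = C = 2 (\<alpha>\<^sub>0 - \<alpha>\<^sub>0(\<tau>))\<close>: since
  \<open>G(1)\<^sup>-\<^sup>1 + C > 0\<close> and \<open>G\<close> is increasing, \<open>1 + G(x) C\<close> is invertible on \<open>[0, 1]\<close>
  (\<open>gram_perturbation_invertible\<close>), and \<open>S = H C (1 + G C)\<^sup>-\<^sup>1 H\<^sup>*\<close> is a Hermitian solution of the Riccati
  equation \<open>S' = \<tau>\<^sup>2 - (\<tau> + S)\<^sup>2\<close> (\<open>gauge_rel_exists\<close>).

  No spectral theory of \<open>S\<^sub>\<tau>\<close> is needed: the increasing enumeration of the eigenvalues is determined by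
  their set.
\<close>

section \<open>Products and almost everywhere equality\<close>

(* The notation for equipollent sets clashes with that for almost everywhere equality. *)
no_notation eqpoll (infixl \<open>\<approx>\<close> 50)

lemma bounded_bilinear_matrix_mult:
  "bounded_bilinear ((**) :: complex^'b^'a \<Rightarrow> complex^'c^'b \<Rightarrow> complex^'c^'a)"
  unfolding bilinear_conv_bounded_bilinear[symmetric] bilinear_def linear_iff
  by (auto simp: vec_eq_iff matrix_matrix_mult_def algebra_simps sum.distrib scaleR_sum_right)

lemma bounded_bilinear_matrix_vector_mult:
  "bounded_bilinear ((*v) :: complex^'b^'a \<Rightarrow> complex^'b \<Rightarrow> complex^'a)"
  unfolding bilinear_conv_bounded_bilinear[symmetric] bilinear_def linear_iff
  by (auto simp: vec_eq_iff matrix_vector_mult_def algebra_simps sum.distrib scaleR_sum_right)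

lemma ae_eq_iff_negligible:
  "f \<approx> g \<longleftrightarrow> negligible {x \<in> {0..1}. f x \<noteq> g x}" for f g :: "real \<Rightarrow> 'a"
proof -
  have "f \<approx> g \<longleftrightarrow> (AE x in lebesgue. x \<in> {0<..<1::real} \<longrightarrow> f x = g x)"
    unfolding ae_eq_def by (subst AE_restrict_space_iff) auto
  also have "\<dots> \<longleftrightarrow> (\<exists>N. negligible N \<and> (\<forall>x. x \<notin> N \<longrightarrow> x \<in> {0<..<1} \<longrightarrow> f x = g x))"
    by (auto simp: eventually_ae_filter_negligible)
  also have "\<dots> \<longleftrightarrow> negligible {x \<in> {0<..<1}. f x \<noteq> g x}"
    by (smt (verit, best) mem_Collect_eq negligible_subset subsetI)
  also have "\<dots> \<longleftrightarrow> negligible {x \<in> {0..1}. f x \<noteq> g x}"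
  proof
    assume "negligible {x \<in> {0<..<1}. f x \<noteq> g x}"
    then have "negligible ({0,1} \<union> {x \<in> {0<..<1}. f x \<noteq> g x})"
      using negligible_Un[OF negligible_finite[of "{0,1}"]] by simp
    then show "negligible {x \<in> {0..1}. f x \<noteq> g x}"
      by (rule negligible_subset) (auto simp: less_le)
  qed (rule negligible_subset, auto)
  finally show ?thesis .
qed

lemma ae_eq_refl [simp]: "f \<approx> f"
  by (simp add: ae_eq_def)

lemma ae_eqI: "(\<And>x. x \<in> {0<..<1} \<Longrightarrow> f x = g x) \<Longrightarrow> f \<approx> g"
  by (auto simp: ae_eq_def intro!: AE_I2)

section \<open>Absolutely continuous functions\<close>

text \<open>
  \<open>acder f g\<close>: on \<open>[0, 1]\<close> the function \<open>f\<close> is absolutely continuous with derivative \<open>g\<close>.  In contrast to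
  \<^const>\<open>has_L2_deriv\<close> the derivative is only integrable, as is \<open>\<tau>\<^sup>2\<close> for a square integrable \<open>\<tau>\<close>.
\<close>

definition acder :: "(real \<Rightarrow> 'a::euclidean_space) \<Rightarrow> (real \<Rightarrow> 'a) \<Rightarrow> bool" where
  "acder f g \<longleftrightarrow> g absolutely_integrable_on {0..1} \<and>
     (\<forall>x\<in>{0..1}. (g has_integral (f x - f 0)) {0..x})"

lemma absolutely_integrable_unit_sub:
  fixes g :: "real \<Rightarrow> 'a::euclidean_space"
  assumes "g absolutely_integrable_on {0..1}" "0 \<le> a" "b \<le> 1"
  shows "g absolutely_integrable_on {a..b}" "g integrable_on {a..b}"
proof -
  show "g absolutely_integrable_on {a..b}"
    by (rule absolutely_integrable_on_subinterval[OF assms(1)]) (use assms in auto)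
  then show "g integrable_on {a..b}"
    by (simp add: absolutely_integrable_on_def)
qed

lemma acder_has_integral:
  assumes "acder f g" "0 \<le> a" "a \<le> b" "b \<le> 1"
  shows "(g has_integral (f b - f a)) {a..b}"
proof -
  have "(g has_integral (f b - f 0)) {0..b}" "(g has_integral (f a - f 0)) {0..a}"
    using assms by (auto simp: acder_def)
  moreover have "g integrable_on {a..b}"
    using assms by (simp add: acder_def absolutely_integrable_unit_sub)
  then obtain I where I: "(g has_integral I) {a..b}" by blast
  ultimately have "(g has_integral ((f a - f 0) + I)) {0..b}"
    using assms has_integral_combine by blast
  with \<open>(g has_integral (f b - f 0)) {0..b}\<close> have "f a - f 0 + I = f b - f 0"
    using has_integral_unique by blast
  then have "I = f b - f a" by (simp add: algebra_simps)
  then show ?thesis using I by simp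
qed

lemma acder_integrable:
  assumes "acder f g" "0 \<le> a" "b \<le> 1"
  shows "g absolutely_integrable_on {a..b}" "g integrable_on {a..b}"
  using assms by (simp_all add: acder_def absolutely_integrable_unit_sub)

lemma acder_eq:
  assumes "acder f g" "x \<in> {0..1}"
  shows "f x = f 0 + integral {0..x} g"
  using assms by (auto simp: acder_def dest!: bspec integral_unique)

lemma acder_cong:
  assumes "acder f g" "\<And>x. x \<in> {0..1} \<Longrightarrow> f' x = f x" "g \<approx> g'"
  shows "acder f' g'"
proof -
  have n: "negligible {x \<in> {0..1}. g x \<noteq> g' x}"
    using assms(3) ae_eq_iff_negligible by blast
  show ?thesis
    unfolding acder_def
  proof (intro conjI ballI)
    show "g' absolutely_integrable_on {0..1}"
      by (rule absolutely_integrable_spike[OF _ n, where f = g]) (use assms(1) in \<open>auto simp: acder_def\<close>)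
    show "(g' has_integral f' x - f' 0) {0..x}" if "x \<in> {0..1}" for x
    proof (rule has_integral_spike[OF n])
      show "(g has_integral f' x - f' 0) {0..x}"
        using assms that by (auto simp: acder_def)
    qed (use that in auto)
  qed
qed

lemma acder_continuous:
  assumes "acder f g"
  shows "continuous_on {0..1} f"
proof -
  have "continuous_on {0..1} (\<lambda>x. f 0 + integral {0..x} g)"
    using acder_integrable[OF assms, of 0 1]
    by (intro continuous_intros indefinite_integral_continuous_1) auto
  then show ?thesis
    by (rule continuous_on_eq) (simp add: acder_eq[OF assms, symmetric])
qed

lemma acderI_integral:
  assumes "g absolutely_integrable_on {0..1}"
  shows "acder (\<lambda>x. c + integral {0..x} g) g"
  unfolding acder_def
proof (intro conjI ballI)
  fix x :: real assume "x \<in> {0..1}"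
  then have "g integrable_on {0..x}"
    using assms by (simp add: absolutely_integrable_unit_sub)
  then show "(g has_integral c + integral {0..x} g - (c + integral {0..0} g)) {0..x}"
    by (simp add: has_integral_integral)
qed fact

lemma acder_linear:
  assumes "acder f g" "bounded_linear L"
  shows "acder (\<lambda>x. L (f x)) (\<lambda>x. L (g x))"
  unfolding acder_def
proof (intro conjI ballI)
  interpret bounded_linear L by fact
  show "(\<lambda>x. L (g x)) absolutely_integrable_on {0..1}"
    using absolutely_integrable_linear[OF _ assms(2), of "{0..1}" g] assms(1) by (auto simp: acder_def o_def)
  show "((\<lambda>x. L (g x)) has_integral L (f x) - L (f 0)) {0..x}" if "x \<in> {0..1}" for x
    using has_integral_linear[OF _ assms(2), of g "f x - f 0" "{0..x}"] assms(1) that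
    by (auto simp: acder_def o_def diff)
qed

lemma acder_add:
  assumes "acder f g" "acder f' g'"
  shows "acder (\<lambda>x. f x + f' x) (\<lambda>x. g x + g' x)"
  unfolding acder_def
proof (intro conjI ballI)
  show "(\<lambda>x. g x + g' x) absolutely_integrable_on {0..1}"
    using assms by (auto simp: acder_def)
  show "((\<lambda>x. g x + g' x) has_integral f x + f' x - (f 0 + f' 0)) {0..x}" if "x \<in> {0..1}" for x
    using has_integral_add[of g "f x - f 0" "{0..x}" g' "f' x - f' 0"] assms that
    by (auto simp: acder_def algebra_simps)
qed

lemma acder_minus: "acder f g \<Longrightarrow> acder (\<lambda>x. - f x) (\<lambda>x. - g x)"
  using acder_linear[of f g "\<lambda>x. - x"] by (simp add: bounded_linear_minus bounded_linear_ident)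

lemma acder_diff:
  assumes "acder f g" "acder f' g'"
  shows "acder (\<lambda>x. f x - f' x) (\<lambda>x. g x - g' x)"
  using acder_add[OF assms(1) acder_minus[OF assms(2)]] by simp

lemma acder_const: "acder (\<lambda>x. c) (\<lambda>x. 0)"
  by (simp add: acder_def)

lemma acder_zero_const:
  assumes "acder f g" "g \<approx> (\<lambda>_. 0)" "x \<in> {0..1}"
  shows "f x = f 0"
proof -
  have "acder f (\<lambda>_. 0)"
    by (rule acder_cong[OF assms(1) _ assms(2)]) simp
  from acder_eq[OF this assms(3)] show ?thesis by simp
qed

lemma continuous_measurable_unit:
  "continuous_on {0..1} f \<Longrightarrow> f \<in> borel_measurable (lebesgue_on {0..1::real})"
  by (rule continuous_imp_measurable_on_sets_lebesgue) auto

lemma absolutely_integrable_bilinear_continuous: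
  fixes f :: "real \<Rightarrow> 'a::euclidean_space" and g :: "real \<Rightarrow> 'b::euclidean_space"
    and B :: "'a \<Rightarrow> 'b \<Rightarrow> 'c::euclidean_space"
  assumes B: "bounded_bilinear B" and f: "continuous_on {0..1} f"
    and g: "g absolutely_integrable_on {0..1}"
  shows "(\<lambda>x. B (f x) (g x)) absolutely_integrable_on {0..1}"
proof (rule absolutely_integrable_bounded_measurable_product[where h = B])
  show "bounded (f ` {0..1})"
    using compact_continuous_image[OF f] compact_imp_bounded by blast
qed (use assms in \<open>auto simp: bilinear_conv_bounded_bilinear intro: continuous_measurable_unit\<close>)

lemma absolutely_integrable_bilinear_continuous':
  fixes f :: "real \<Rightarrow> 'a::euclidean_space" and g :: "real \<Rightarrow> 'b::euclidean_space"
    and B :: "'a \<Rightarrow> 'b \<Rightarrow> 'c::euclidean_space"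
  assumes B: "bounded_bilinear B" and f: "f absolutely_integrable_on {0..1}"
    and g: "continuous_on {0..1} g"
  shows "(\<lambda>x. B (f x) (g x)) absolutely_integrable_on {0..1}"
  by (rule absolutely_integrable_bilinear_continuous[OF bounded_bilinear.flip[OF B] g f])

text \<open>
  An additive interval function that is bounded, on short intervals, by an arbitrarily small multiple of
  the increment of a fixed function vanishes.
\<close>

lemma additive_small_zero:
  fixes \<Phi> :: "real \<Rightarrow> real \<Rightarrow> 'a::real_normed_vector"
  assumes add: "\<And>a b c. 0 \<le> a \<Longrightarrow> a \<le> b \<Longrightarrow> b \<le> c \<Longrightarrow> c \<le> 1 \<Longrightarrow> \<Phi> a c = \<Phi> a b + \<Phi> b c"
    and small: "\<And>e. 0 < e \<Longrightarrow> \<exists>d>0. \<forall>a b. 0 \<le> a \<longrightarrow> a \<le> b \<longrightarrow> b \<le> 1 \<longrightarrow> b \<le> a + d \<longrightarrow>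
                    norm (\<Phi> a b) \<le> e * (N b - N a)"
    and x: "0 \<le> x" "x \<le> 1"
  shows "\<Phi> 0 x = 0"
proof -
  have z: "\<Phi> 0 0 = 0" using add[of 0 0 0] by simp
  have bd: "norm (\<Phi> 0 x) \<le> e * (N x - N 0)" if e: "0 < e" for e
  proof -
    from small[OF e] obtain d where d: "0 < d"
      "\<And>a b. 0 \<le> a \<Longrightarrow> a \<le> b \<Longrightarrow> b \<le> 1 \<Longrightarrow> b \<le> a + d \<Longrightarrow> norm (\<Phi> a b) \<le> e * (N b - N a)" by blast
    have "norm (\<Phi> 0 (min x (real n * d))) \<le> e * (N (min x (real n * d)) - N 0)" for n
    proof (induction n)
      case 0
      then show ?case using x z by simp
    next
      case (Suc n)
      let ?a = "min x (real n * d)" and ?b = "min x (real (Suc n) * d)"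
      have ab: "0 \<le> ?a" "?a \<le> ?b" "?b \<le> 1" "?b \<le> ?a + d"
        using x d(1) by (auto simp: algebra_simps min_def)
      have "\<Phi> 0 ?b = \<Phi> 0 ?a + \<Phi> ?a ?b"
        using ab by (intro add) auto
      then have "norm (\<Phi> 0 ?b) \<le> norm (\<Phi> 0 ?a) + norm (\<Phi> ?a ?b)"
        by (simp add: norm_triangle_ineq)
      also have "\<dots> \<le> e * (N ?a - N 0) + e * (N ?b - N ?a)"
        using Suc.IH d(2)[OF ab] by linarith
      finally show ?case by (simp add: algebra_simps)
    qed
    moreover obtain n where "x < real n * d"
      using reals_Archimedean3[OF d(1)] by blast
    ultimately show ?thesis by (metis less_eq_real_def min_absorb1)
  qed
  show ?thesis
  proof (rule ccontr)
    assume "\<Phi> 0 x \<noteq> 0"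
    then have p: "0 < norm (\<Phi> 0 x)" by simp
    define c where "c = \<bar>N x - N 0\<bar> + 1"
    have c: "0 < c" by (simp add: c_def)
    have "norm (\<Phi> 0 x) \<le> (norm (\<Phi> 0 x) / (2 * c)) * (N x - N 0)"
      using bd[of "norm (\<Phi> 0 x) / (2 * c)"] p c by auto
    also have "\<dots> \<le> (norm (\<Phi> 0 x) / (2 * c)) * c"
      using p c by (intro mult_left_mono) (auto simp: c_def)
    finally show False using p c by simp
  qed
qed

text \<open>
  The product rule.  The defect of the product rule over an interval is additive; writing
  \<open>B (f b) (g b) - B (f a) (g a) = B (f b - f a) (g b) + B (f a) (g b - g a)\<close> one sees that it is controlled by
  the oscillation of \<open>f\<close> and \<open>g\<close> times the integral of \<open>|f'| + |g'|\<close>.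
\<close>

lemma acder_bilinear:
  fixes f f' :: "real \<Rightarrow> 'a::euclidean_space" and g g' :: "real \<Rightarrow> 'b::euclidean_space"
    and B :: "'a \<Rightarrow> 'b \<Rightarrow> 'c::euclidean_space"
  assumes B: "bounded_bilinear B" and f: "acder f f'" and g: "acder g g'"
  shows "acder (\<lambda>x. B (f x) (g x)) (\<lambda>x. B (f' x) (g x) + B (f x) (g' x))"
proof -
  interpret bounded_bilinear B by fact
  obtain K where K: "0 < K" "\<And>a b. norm (B a b) \<le> norm a * norm b * K"
    using pos_bounded by blast
  let ?h = "\<lambda>x. B (f' x) (g x) + B (f x) (g' x)"
  have cf: "continuous_on {0..1} f" and cg: "continuous_on {0..1} g"
    using f g by (auto dest: acder_continuous)
  have ah: "?h absolutely_integrable_on {0..1}"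
    using f g by (intro set_integral_add(1) absolutely_integrable_bilinear_continuous[OF B cf]
        absolutely_integrable_bilinear_continuous'[OF B _ cg]) (simp_all add: acder_def)
  have ih: "?h integrable_on {a..b}" if "0 \<le> a" "b \<le> 1" for a b
    using ah that by (rule absolutely_integrable_unit_sub)
  define n where "n = (\<lambda>x. norm (f' x) + norm (g' x))"
  have n_int: "n integrable_on {a..b}" if "0 \<le> a" "b \<le> 1" for a b
    unfolding n_def using acder_integrable(1)[OF f that] acder_integrable(1)[OF g that]
    by (intro integrable_add) (auto simp: absolutely_integrable_on_def)
  define N where "N = (\<lambda>x. integral {0..x} n)"
  define \<Phi> where "\<Phi> = (\<lambda>a b. B (f b) (g b) - B (f a) (g a) - integral {a..b} ?h)"
  have "\<Phi> 0 x = 0" if x: "0 \<le> x" "x \<le> 1" for x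
  proof (rule additive_small_zero[OF _ _ x, where N = N])
    fix a b c :: real assume "0 \<le> a" "a \<le> b" "b \<le> c" "c \<le> 1"
    then show "\<Phi> a c = \<Phi> a b + \<Phi> b c"
      unfolding \<Phi>_def using Henstock_Kurzweil_Integration.integral_combine[of a b c ?h] ih[of a c]
      by (simp add: algebra_simps)
  next
    fix e :: real assume e: "0 < e"
    \<comment> \<open>The bound for \<open>B\<close> contributes the factor \<open>K\<close>.\<close>
    define e' where "e' = e / K"
    have e': "0 < e'" using e K by (simp add: e'_def)
    have "uniformly_continuous_on {0..1} f" "uniformly_continuous_on {0..1} g"
      using cf cg compact_uniformly_continuous by auto
    then obtain d1 d2 where d1: "0 < d1" "\<And>x y. x \<in> {0..1} \<Longrightarrow> y \<in> {0..1} \<Longrightarrow> dist x y < d1 \<Longrightarrow> dist (f x) (f y) < e'"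
      and d2: "0 < d2" "\<And>x y. x \<in> {0..1} \<Longrightarrow> y \<in> {0..1} \<Longrightarrow> dist x y < d2 \<Longrightarrow> dist (g x) (g y) < e'"
      using e' unfolding uniformly_continuous_on_def by (metis dist_commute)
    define d where "d = min d1 d2 / 2"
    have d: "0 < d" "d < d1" "d < d2" using d1(1) d2(1) by (auto simp: d_def)
    have "norm (\<Phi> a b) \<le> e * (N b - N a)" if ab: "0 \<le> a" "a \<le> b" "b \<le> 1" "b \<le> a + d" for a b
    proof -
      have i1: "((\<lambda>x. B (f' x) (g b)) has_integral B (f b - f a) (g b)) {a..b}"
        using has_integral_linear[OF acder_has_integral[OF f ab(1-3)] bounded_linear_left[of "g b"]]
        by (simp add: o_def)
      have i2: "((\<lambda>x. B (f a) (g' x)) has_integral B (f a) (g b - g a)) {a..b}"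
        using has_integral_linear[OF acder_has_integral[OF g ab(1-3)] bounded_linear_right[of "f a"]]
        by (simp add: o_def)
      have i3: "(?h has_integral integral {a..b} ?h) {a..b}"
        using ih ab by (simp add: has_integral_integral)
      have "((\<lambda>x. (B (f' x) (g b) + B (f a) (g' x)) - ?h x) has_integral
          (B (f b - f a) (g b) + B (f a) (g b - g a)) - integral {a..b} ?h) {a..b}"
        by (intro has_integral_diff has_integral_add i1 i2 i3)
      then have i4: "((\<lambda>x. B (f' x) (g b - g x) + B (f a - f x) (g' x)) has_integral \<Phi> a b) {a..b}"
        unfolding \<Phi>_def by (simp add: diff_left diff_right algebra_simps)
      have "norm (\<Phi> a b) \<le> integral {a..b} (\<lambda>x. e * n x)"
        unfolding integral_unique[OF i4, symmetric]
      proof (rule integral_norm_bound_integral)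
        show "(\<lambda>x. B (f' x) (g b - g x) + B (f a - f x) (g' x)) integrable_on {a..b}"
          using i4 by blast
        show "(\<lambda>x. e * n x) integrable_on {a..b}"
          using integrable_cmul[OF n_int[of a b], of e] ab by simp
        fix x assume x: "x \<in> {a..b}"
        have "norm (g b - g x) \<le> e'"
          using d2(2)[of b x] x ab d by (auto simp: dist_norm)
        then have "norm (B (f' x) (g b - g x)) \<le> norm (f' x) * e' * K"
          using K by (smt (verit, best) mult_left_mono mult_right_mono norm_ge_zero)
        moreover have "norm (f a - f x) \<le> e'"
          using d1(2)[of a x] x ab d by (auto simp: dist_norm)
        then have "norm (B (f a - f x) (g' x)) \<le> e' * norm (g' x) * K"
          using K by (smt (verit, best) mult_left_mono mult_right_mono norm_ge_zero)
        ultimately show "norm (B (f' x) (g b - g x) + B (f a - f x) (g' x)) \<le> e * n x"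
          using K(1) unfolding n_def e'_def by (intro norm_triangle_le) (simp add: field_simps)
      qed
      also have "\<dots> = e * integral {a..b} n" by simp
      also have "integral {a..b} n = N b - N a"
        unfolding N_def using Henstock_Kurzweil_Integration.integral_combine[of 0 a b n] n_int[of 0 b] ab
        by simp
      finally show ?thesis .
    qed
    then show "\<exists>d>0. \<forall>a b. 0 \<le> a \<longrightarrow> a \<le> b \<longrightarrow> b \<le> 1 \<longrightarrow> b \<le> a + d \<longrightarrow>
                    norm (\<Phi> a b) \<le> e * (N b - N a)" using d by blast
  qed
  then have "integral {0..x} ?h = B (f x) (g x) - B (f 0) (g 0)" if "x \<in> {0..1}" for x
    using that unfolding \<Phi>_def by simp
  then show ?thesis
    unfolding acder_def using ah ih[of 0] by (auto simp: has_integral_iff)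
qed

lemmas acder_mult = acder_bilinear[OF bounded_bilinear_matrix_mult]

section \<open>Square integrable functions\<close>

lemma absolutely_integrable_unit_iff:
  fixes f :: "real \<Rightarrow> 'a::euclidean_space"
  shows "f absolutely_integrable_on {0..1} \<longleftrightarrow> integrable unit_int f"
  by (subst absolutely_integrable_on_Icc_iff_Ioo) (simp add: set_integrable_def integrable_restrict_space)

lemma integral_unit_eq:
  fixes f :: "real \<Rightarrow> 'a::euclidean_space"
  assumes "f absolutely_integrable_on {0..1}"
  shows "(\<integral>x. f x \<partial>unit_int) = integral {0..1} f"
proof -
  have "(f has_integral (\<integral>x. f x \<partial>unit_int)) {0<..<1}"
    using assms by (intro has_integral_integral_lebesgue_on) (simp_all add: absolutely_integrable_unit_iff)
  then have "(f has_integral (\<integral>x. f x \<partial>unit_int)) {0..1}"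
    using has_integral_Icc_iff_Ioo by blast
  then show ?thesis by (simp add: integral_unique)
qed

lemma absolutely_integrable_measurable_unit:
  fixes f :: "real \<Rightarrow> 'a::euclidean_space"
  shows "f absolutely_integrable_on {0..1} \<Longrightarrow> f \<in> borel_measurable unit_int"
  by (auto simp: absolutely_integrable_unit_iff)

lemma continuous_measurable_unit_int:
  fixes f :: "real \<Rightarrow> 'a::euclidean_space"
  shows "continuous_on {0..1} f \<Longrightarrow> f \<in> borel_measurable unit_int"
  by (simp add: absolutely_integrable_continuous_real absolutely_integrable_measurable_unit)

lemma borel_measurable_bounded_bilinear:
  fixes f :: "'m \<Rightarrow> 'a::euclidean_space" and g :: "'m \<Rightarrow> 'b::euclidean_space"
    and B :: "'a \<Rightarrow> 'b \<Rightarrow> 'c::euclidean_space"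
  assumes "bounded_bilinear B" "f \<in> borel_measurable M" "g \<in> borel_measurable M"
  shows "(\<lambda>x. B (f x) (g x)) \<in> borel_measurable M"
  by (rule borel_measurable_continuous_Pair[OF assms(2,3)])
    (intro bounded_bilinear.continuous_on[OF assms(1)] continuous_intros)

lemma L2D: "f \<in> L2 \<Longrightarrow> f \<in> borel_measurable unit_int" "f \<in> L2 \<Longrightarrow> integrable unit_int (\<lambda>x. (norm (f x))\<^sup>2)"
  by (auto simp: L2_def)

lemma L2_bound:
  assumes "f \<in> borel_measurable unit_int" "integrable unit_int b"
    and "\<And>x. x \<in> {0<..<1} \<Longrightarrow> (norm (f x))\<^sup>2 \<le> b x"
  shows "f \<in> L2"
  unfolding L2_def
proof (intro CollectI conjI assms(1))
  show "integrable unit_int (\<lambda>x. (norm (f x))\<^sup>2)"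
  proof (rule Bochner_Integration.integrable_bound[OF assms(2)])
    show "(\<lambda>x. (norm (f x))\<^sup>2) \<in> borel_measurable unit_int"
      using assms(1) by measurable
    show "AE x in unit_int. norm ((norm (f x))\<^sup>2) \<le> norm (b x)"
      using assms(3) by (intro AE_I2) (force simp: abs_if)
  qed
qed

lemma integrable_unit_const [simp]: "integrable unit_int (\<lambda>x. c :: 'a::euclidean_space)"
  by (simp add: absolutely_integrable_unit_iff[symmetric])

lemma L2_absolutely_integrable:
  assumes "f \<in> L2" shows "f absolutely_integrable_on {0..1}"
  unfolding absolutely_integrable_unit_iff
proof (rule Bochner_Integration.integrable_bound)
  show "integrable unit_int (\<lambda>x. 1 + (norm (f x))\<^sup>2)"
    using L2D(2)[OF assms] by simp
  have "norm (f x) \<le> 1 + (norm (f x))\<^sup>2" for x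
  proof -
    have "2 * norm (f x) \<le> 1 + (norm (f x))\<^sup>2"
      using sum_squares_bound[of 1 "norm (f x)"] by simp
    then show ?thesis using zero_le_power2[of "norm (f x)"] by linarith
  qed
  then show "AE x in unit_int. norm (f x) \<le> norm (1 + (norm (f x))\<^sup>2)"
    by (intro AE_I2) (simp add: abs_of_nonneg)
qed (use L2D[OF assms] in auto)

lemma L2_mult_integrable:
  fixes f :: "real \<Rightarrow> 'a::euclidean_space" and g :: "real \<Rightarrow> 'b::euclidean_space"
    and B :: "'a \<Rightarrow> 'b \<Rightarrow> 'c::euclidean_space"
  assumes B: "bounded_bilinear B" and f: "f \<in> L2" and g: "g \<in> L2"
  shows "(\<lambda>x. B (f x) (g x)) absolutely_integrable_on {0..1}"
  unfolding absolutely_integrable_unit_iff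
proof -
  obtain K where K: "0 < K" "\<And>a b. norm (B a b) \<le> norm a * norm b * K"
    using bounded_bilinear.pos_bounded[OF B] by blast
  show "integrable unit_int (\<lambda>x. B (f x) (g x))"
  proof (rule Bochner_Integration.integrable_bound)
    show "integrable unit_int (\<lambda>x. ((norm (f x))\<^sup>2 + (norm (g x))\<^sup>2) * K)"
      using L2D(2)[OF f] L2D(2)[OF g] by simp
    have "norm (B (f x) (g x)) \<le> ((norm (f x))\<^sup>2 + (norm (g x))\<^sup>2) * K" for x
    proof -
      have "norm (f x) * norm (g x) \<le> (norm (f x))\<^sup>2 + (norm (g x))\<^sup>2"
        using sum_squares_bound[of "norm (f x)" "norm (g x)"]
          mult_nonneg_nonneg[OF norm_ge_zero[of "f x"] norm_ge_zero[of "g x"]] by linarith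
      then show ?thesis using K by (meson less_imp_le mult_right_mono order_trans)
    qed
    then show "AE x in unit_int. norm (B (f x) (g x)) \<le> norm (((norm (f x))\<^sup>2 + (norm (g x))\<^sup>2) * K)"
      using K by (intro AE_I2) (simp add: abs_of_nonneg)
  qed (use L2D[OF f] L2D[OF g] B in \<open>auto intro: borel_measurable_bounded_bilinear\<close>)
qed

lemma L2_add:
  assumes "f \<in> L2" "g \<in> L2" shows "(\<lambda>x. f x + g x) \<in> L2"
proof (rule L2_bound)
  show "integrable unit_int (\<lambda>x. 2 * (norm (f x))\<^sup>2 + 2 * (norm (g x))\<^sup>2)"
    using assms by (auto simp: L2_def)
  fix x
  have "(norm (f x + g x))\<^sup>2 \<le> (norm (f x) + norm (g x))\<^sup>2"
    by (simp add: norm_triangle_ineq power_mono)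
  also have "\<dots> \<le> 2 * (norm (f x))\<^sup>2 + 2 * (norm (g x))\<^sup>2"
    using sum_squares_bound[of "norm (f x)" "norm (g x)"] by (simp add: power2_sum)
  finally show "(norm (f x + g x))\<^sup>2 \<le> 2 * (norm (f x))\<^sup>2 + 2 * (norm (g x))\<^sup>2" .
  show "(\<lambda>x. f x + g x) \<in> borel_measurable unit_int"
    by (intro borel_measurable_add L2D assms)
qed

lemma L2_minus: "f \<in> L2 \<Longrightarrow> (\<lambda>x. - f x) \<in> L2"
  by (auto simp: L2_def)

lemma L2_diff: "f \<in> L2 \<Longrightarrow> g \<in> L2 \<Longrightarrow> (\<lambda>x. f x - g x) \<in> L2"
  using L2_add[OF _ L2_minus] by fastforce

lemma L2_linear:
  fixes f :: "real \<Rightarrow> 'a::euclidean_space" and L :: "'a \<Rightarrow> 'b::euclidean_space"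
  assumes "f \<in> L2" and L: "bounded_linear L"
  shows "(\<lambda>x. L (f x)) \<in> L2"
proof -
  obtain K where K: "0 < K" "\<And>a. norm (L a) \<le> norm a * K"
    using bounded_linear.pos_bounded[OF L] by blast
  show ?thesis
  proof (rule L2_bound)
    show "integrable unit_int (\<lambda>x. (norm (f x))\<^sup>2 * K\<^sup>2)"
      using assms(1) by (auto dest: L2D)
    show "(norm (L (f x)))\<^sup>2 \<le> (norm (f x))\<^sup>2 * K\<^sup>2" for x
      using K(2)[of "f x"] by (metis norm_ge_zero power_mono power_mult_distrib)
    show "(\<lambda>x. L (f x)) \<in> borel_measurable unit_int"
      using L2D(1)[OF assms(1)] by (rule borel_measurable_continuous_on[OF linear_continuous_on[OF L]])
  qed
qed

lemma L2_bilinear_continuous: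
  fixes f :: "real \<Rightarrow> 'a::euclidean_space" and g :: "real \<Rightarrow> 'b::euclidean_space"
    and B :: "'a \<Rightarrow> 'b \<Rightarrow> 'c::euclidean_space"
  assumes B: "bounded_bilinear B" and f: "f \<in> L2" and g: "continuous_on {0..1} g"
  shows "(\<lambda>x. B (f x) (g x)) \<in> L2"
proof -
  obtain K where K: "0 < K" "\<And>a b. norm (B a b) \<le> norm a * norm b * K"
    using bounded_bilinear.pos_bounded[OF B] by blast
  obtain C where C: "\<And>x. x \<in> {0..1} \<Longrightarrow> norm (g x) \<le> C"
    using compact_imp_bounded[OF compact_continuous_image[OF g compact_Icc]] unfolding bounded_iff by blast
  show ?thesis
  proof (rule L2_bound)
    show "integrable unit_int (\<lambda>x. (norm (f x))\<^sup>2 * (C * K)\<^sup>2)"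
      using f by (auto dest: L2D)
    show "(norm (B (f x) (g x)))\<^sup>2 \<le> (norm (f x))\<^sup>2 * (C * K)\<^sup>2" if "x \<in> {0<..<1}" for x
    proof -
      have "norm (B (f x) (g x)) \<le> norm (f x) * (norm (g x) * K)"
        using K(2)[of "f x" "g x"] by (simp add: mult.assoc)
      also have "\<dots> \<le> norm (f x) * (C * K)"
        using C[of x] that K(1) by (intro mult_left_mono mult_right_mono) auto
      finally show ?thesis by (metis norm_ge_zero power_mono power_mult_distrib)
    qed
    show "(\<lambda>x. B (f x) (g x)) \<in> borel_measurable unit_int"
      using L2D(1)[OF f] continuous_measurable_unit_int[OF g] by (rule borel_measurable_bounded_bilinear[OF B])
  qed
qed

lemma L2_continuous:
  fixes f :: "real \<Rightarrow> 'a::euclidean_space"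
  assumes "continuous_on {0..1} f" shows "f \<in> L2"
proof -
  have "(\<lambda>x. 1::real) \<in> L2" by (simp add: L2_def)
  from L2_bilinear_continuous[OF bounded_bilinear_scaleR this assms] show ?thesis by simp
qed

section \<open>Uniqueness of the derivative\<close>

text \<open>
  The sets over which \<open>g\<close> integrates to 0 form a Dynkin system containing all half-lines, hence all Borel
  sets, in particular the set where (a Borel version of) \<open>g\<close> is positive.
\<close>

lemma indefinite_integral_zero_le:
  fixes g :: "real \<Rightarrow> real"
  assumes g: "g absolutely_integrable_on {0..1}"
    and z: "\<And>x. x \<in> {0..1} \<Longrightarrow> integral {0..x} g = 0"
  shows "AE x in lebesgue. indicator {0..1} x * g x \<le> 0"
proof -
  define G where "G = (\<lambda>x. indicat_real {0..1} x * g x)"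
  have G: "integrable lebesgue G"
    using g by (simp add: set_integrable_def G_def)
  have sG: "set_integrable lebesgue A G" if "A \<in> sets borel" for A
    using G that unfolding set_integrable_def by (intro integrable_mult_indicator) auto
  have at: "(LINT x:{..a}|lebesgue. G x) = 0" for a
  proof -
    have "(LINT x:{..a}|lebesgue. G x) = (LINT x:{0..min a 1}|lebesgue. g x)"
      unfolding set_lebesgue_integral_def G_def
      by (intro Bochner_Integration.integral_cong) (auto simp: indicator_def)
    also have "\<dots> = integral {0..min a 1} g"
      using absolutely_integrable_unit_sub[OF g, of 0 "min a 1"]
      by (intro set_lebesgue_integral_eq_integral) auto
    also have "\<dots> = 0"
      using z[of "min a 1"] by (cases "0 \<le> a") auto
    finally show ?thesis .
  qed
  have tot: "(LINT x|lebesgue. G x) = 0"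
  proof -
    have "(LINT x|lebesgue. G x) = (LINT x:{..1}|lebesgue. G x)"
      unfolding set_lebesgue_integral_def G_def
      by (intro Bochner_Integration.integral_cong) (auto simp: indicator_def)
    then show ?thesis using at by simp
  qed
  have all: "(LINT x:A|lebesgue. G x) = 0" if "A \<in> sets borel" for A
  proof -
    have "Int_stable (range (\<lambda>a::real. {..a}))"
      by (auto simp: Int_stable_def)
    moreover have "range (\<lambda>a::real. {..a}) \<subseteq> Pow UNIV" by simp
    moreover have "A \<in> sigma_sets UNIV (range (\<lambda>a::real. {..a}))"
      using that by (simp add: borel_eq_atMost)
    ultimately show ?thesis
    proof (induction A rule: sigma_sets_induct_disjoint[where \<Omega> = UNIV])
      case (compl A)
      have A: "A \<in> sets borel" using compl(1) by (simp add: borel_eq_atMost)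
      have "(LINT x:UNIV - A|lebesgue. G x) = (LINT x|lebesgue. G x - indicator A x *\<^sub>R G x)"
        unfolding set_lebesgue_integral_def
        by (intro Bochner_Integration.integral_cong) (auto simp: indicator_def)
      also have "\<dots> = 0"
        using sG[OF A] G tot compl(2)
        by (subst Bochner_Integration.integral_diff) (auto simp: set_integrable_def set_lebesgue_integral_def)
      finally show ?case .
    next
      case (union A)
      have A: "A i \<in> sets borel" for i using union(2) by (auto simp: borel_eq_atMost)
      have "(LINT x:(\<Union>i. A i)|lebesgue. G x) = (\<Sum>i. (LINT x:A i|lebesgue. G x))"
        using union(1) A by (intro lebesgue_integral_countable_add sG)
          (auto simp: disjoint_family_on_def)
      then show ?case using union by simp
    qed (use at in \<open>auto simp: set_lebesgue_integral_def\<close>)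
  qed
  obtain G' where G': "G' \<in> borel_measurable lborel" "AE x in lborel. G x = G' x"
    using completion_ex_borel_measurable_real[of G lborel] G by auto
  then have ae: "AE x in lebesgue. G x = G' x" by (simp add: AE_completion)
  define A where "A = {x. 0 < G' x}"
  have A: "A \<in> sets borel"
    using G'(1) unfolding A_def by measurable
  have "(LINT x|lebesgue. indicator A x * G x) = 0"
    using all[OF A] by (simp add: set_lebesgue_integral_def)
  moreover have "AE x in lebesgue. 0 \<le> indicator A x * G x"
    using ae by (elim AE_mp) (auto simp: A_def indicator_def)
  moreover have "integrable lebesgue (\<lambda>x. indicator A x * G x)"
    using sG[OF A] by (simp add: set_integrable_def)
  ultimately have "AE x in lebesgue. indicator A x * G x = 0"
    using integral_nonneg_eq_0_iff_AE by blast
  with ae have "AE x in lebesgue. G x \<le> 0"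
    by eventually_elim (auto simp: A_def indicator_def split: if_splits)
  then show ?thesis by (simp add: G_def)
qed

lemma acder_deriv_zero:
  fixes g :: "real \<Rightarrow> 'a::euclidean_space"
  assumes "acder f g" "\<And>x. x \<in> {0..1} \<Longrightarrow> f x = f 0"
  shows "g \<approx> (\<lambda>_. 0)"
proof -
  have *: "AE x in lebesgue. indicator {0..1} x * (g x \<bullet> b) = 0" for b
  proof -
    have ac: "acder (\<lambda>x. f x \<bullet> b) (\<lambda>x. g x \<bullet> b)"
      by (rule acder_linear[OF assms(1) bounded_linear_inner_left])
    have ac': "acder (\<lambda>x. - (f x \<bullet> b)) (\<lambda>x. - (g x \<bullet> b))"
      by (rule acder_minus[OF ac])
    have 1: "AE x in lebesgue. indicator {0..1} x * (g x \<bullet> b) \<le> 0"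
    proof (rule indefinite_integral_zero_le)
      show "integral {0..x} (\<lambda>x. g x \<bullet> b) = 0" if "x \<in> {0..1}" for x
        using acder_eq[OF ac that] assms(2)[OF that] by simp
    qed (use ac in \<open>simp add: acder_def\<close>)
    have 2: "AE x in lebesgue. indicator {0..1} x * (- (g x \<bullet> b)) \<le> 0"
    proof (rule indefinite_integral_zero_le)
      show "integral {0..x} (\<lambda>x. - (g x \<bullet> b)) = 0" if "x \<in> {0..1}" for x
        using acder_eq[OF ac' that] assms(2)[OF that] by simp
    qed (use ac' in \<open>simp add: acder_def\<close>)
    from 1 2 show ?thesis by eventually_elim auto
  qed
  have "AE x in lebesgue. \<forall>b\<in>Basis. indicator {0..1} x * (g x \<bullet> b) = 0"
    using * by (intro AE_finite_allI) auto
  then have "AE x in lebesgue. x \<in> {0<..<1} \<longrightarrow> g x = 0"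
    by eventually_elim (auto simp: euclidean_all_zero_iff)
  then show ?thesis
    unfolding ae_eq_def by (subst AE_restrict_space_iff) auto
qed

lemma acder_unique:
  assumes "acder f g" "acder f' g'" "\<And>x. x \<in> {0..1} \<Longrightarrow> f x = f' x"
  shows "g \<approx> g'"
proof -
  have "(\<lambda>x. g x - g' x) \<approx> (\<lambda>_. 0)"
    by (rule acder_deriv_zero[OF acder_diff[OF assms(1,2)]]) (simp add: assms(3))
  then show ?thesis by (simp add: ae_eq_def)
qed

lemma has_L2_deriv_iff: "has_L2_deriv f g \<longleftrightarrow> g \<in> L2 \<and> acder f g"
  by (auto simp: has_L2_deriv_def acder_def L2_absolutely_integrable)

lemma W21D:
  assumes "f \<in> W21"
  shows "wderiv f \<in> L2" "acder f (wderiv f)"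
proof -
  have "has_L2_deriv f (wderiv f)"
    using assms someI_ex[of "has_L2_deriv f"] unfolding W21_def wderiv_def by simp
  then show "wderiv f \<in> L2" "acder f (wderiv f)"
    by (auto simp: has_L2_deriv_iff)
qed

lemma W21I:
  assumes "acder f g" "g \<in> L2"
  shows "f \<in> W21" "wderiv f \<approx> g"
proof -
  show f: "f \<in> W21" using assms by (auto simp: W21_def has_L2_deriv_iff)
  show "wderiv f \<approx> g" using acder_unique[OF W21D(2)[OF f] assms(1)] by simp
qed

section \<open>Scalar matrices and signs in matrix products\<close>

lemma matrix_mult_minus_left: "(- A) ** B = - (A ** B)" for A :: "complex^'b^'a" and B :: "complex^'c^'b"
  by (rule bounded_bilinear.minus_left[OF bounded_bilinear_matrix_mult])

lemma matrix_mult_minus_right: "A ** (- B) = - (A ** B)" for A :: "complex^'b^'a" and B :: "complex^'c^'b"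
  by (rule bounded_bilinear.minus_right[OF bounded_bilinear_matrix_mult])

lemma matrix_mult_diff_left: "(A - A') ** B = A ** B - A' ** B" for A :: "complex^'b^'a" and B :: "complex^'c^'b"
  by (rule bounded_bilinear.diff_left[OF bounded_bilinear_matrix_mult])

lemma matrix_mult_diff_right: "A ** (B - B') = A ** B - A ** B'" for A :: "complex^'b^'a" and B :: "complex^'c^'b"
  by (rule bounded_bilinear.diff_right[OF bounded_bilinear_matrix_mult])

lemma mat_mult_nth [simp]: "(mat c ** A) $ i $ j = c * A $ i $ j" for A :: "complex^'b^'a"
proof -
  have "(mat c ** A) $ i $ j = (\<Sum>k\<in>UNIV. (if i = k then c else 0) * A $ k $ j)"
    by (simp add: matrix_matrix_mult_def mat_def)
  also have "\<dots> = (\<Sum>k\<in>UNIV. if i = k then c * A $ k $ j else 0)"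
    by (intro sum.cong) auto
  finally show ?thesis by simp
qed

lemma mult_mat_nth [simp]: "(A ** mat c) $ i $ j = A $ i $ j * c" for A :: "complex^'b^'a"
proof -
  have "(A ** mat c) $ i $ j = (\<Sum>k\<in>UNIV. A $ i $ k * (if k = j then c else 0))"
    by (simp add: matrix_matrix_mult_def mat_def)
  also have "\<dots> = (\<Sum>k\<in>UNIV. if k = j then A $ i $ k * c else 0)"
    by (intro sum.cong) auto
  finally show ?thesis by simp
qed

lemma mat_mult_commute: "A ** mat c = mat c ** A" for A :: "complex^'b^'a"
  by (simp add: vec_eq_iff mult.commute)

lemma mat_mult_mat: "mat c ** mat d = (mat (c * d) :: complex^'a^'a)"
  by (simp add: vec_eq_iff) (simp add: mat_def)

lemma mat_mult_left_commute: "A ** (mat c ** B) = mat c ** (A ** B)" for A :: "complex^'b^'a" and B :: "complex^'c^'b"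
  by (metis mat_mult_commute matrix_mul_assoc)

lemma bounded_linear_mat: "bounded_linear (mat :: complex \<Rightarrow> complex^'a^'a)"
proof (intro linear_conv_bounded_linear[THEN iffD1] linearI)
qed (simp_all add: vec_eq_iff mat_def)

section \<open>Estimates for Volterra iterations\<close>

lemma square_integral_le:
  fixes a u :: "real \<Rightarrow> real"
  assumes a: "a \<in> L2" and u: "continuous_on {0..1} u" and x: "x \<in> {0..1}"
  shows "(integral {0..x} (\<lambda>s. a s * u s))\<^sup>2
    \<le> integral {0..1} (\<lambda>s. (a s)\<^sup>2) * integral {0..x} (\<lambda>s. (u s)\<^sup>2)"
proof -
  have ia: "(\<lambda>s. (a s)\<^sup>2) absolutely_integrable_on {0..1}"
    using L2_mult_integrable[OF bounded_bilinear_mult a a] by (simp add: power2_eq_square)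
  have iau: "(\<lambda>s. a s * u s) absolutely_integrable_on {0..1}"
    by (rule L2_mult_integrable[OF bounded_bilinear_mult a L2_continuous[OF u]])
  have iu: "(\<lambda>s. (u s)\<^sup>2) absolutely_integrable_on {0..1}"
    using u by (intro absolutely_integrable_continuous_real continuous_intros)
  have x01: "0 \<le> x" "x \<le> 1" using x by auto
  note i = absolutely_integrable_unit_sub(2)[OF ia order_refl x01(2)]
    absolutely_integrable_unit_sub(2)[OF iau order_refl x01(2)]
    absolutely_integrable_unit_sub(2)[OF iu order_refl x01(2)]
  define A P U where "A = integral {0..x} (\<lambda>s. (a s)\<^sup>2)" and "P = integral {0..x} (\<lambda>s. a s * u s)"
    and "U = integral {0..x} (\<lambda>s. (u s)\<^sup>2)"
  have U0: "0 \<le> U" and A0: "0 \<le> A"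
    unfolding U_def A_def by (auto intro!: integral_nonneg i)
  have q: "0 \<le> t\<^sup>2 * A - 2 * t * P + U" for t
  proof -
    have "((\<lambda>s. t\<^sup>2 * (a s)\<^sup>2 - 2 * t * (a s * u s) + (u s)\<^sup>2) has_integral
        t\<^sup>2 * A - 2 * t * P + U) {0..x}"
      unfolding A_def P_def U_def
      by (intro has_integral_add has_integral_diff has_integral_mult_right i integrable_integral)
    moreover have "0 \<le> t\<^sup>2 * (a s)\<^sup>2 - 2 * t * (a s * u s) + (u s)\<^sup>2" for s
      using zero_le_power2[of "t * a s - u s"] by (simp add: power2_diff power_mult_distrib algebra_simps)
    ultimately show ?thesis by (meson has_integral_nonneg)
  qed
  have "P\<^sup>2 \<le> A * U"
  proof (cases "A = 0")
    case True
    have "P = 0"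
    proof (rule ccontr)
      assume "P \<noteq> 0"
      then show False using q[of "(U + 1) / (2 * P)"] True by (simp add: field_simps)
    qed
    then show ?thesis using True by simp
  next
    case False
    then show ?thesis using q[of "P / A"] A0 by (simp add: power2_eq_square field_simps)
  qed
  also have "A \<le> integral {0..1} (\<lambda>s. (a s)\<^sup>2)"
    unfolding A_def using x ia absolutely_integrable_unit_sub(2)[OF ia]
    by (intro integral_subset_le i) auto
  finally show ?thesis unfolding P_def U_def[symmetric] using U0 by (meson mult_right_mono order_trans)
qed

text \<open>
  By the Cauchy-Schwarz inequality the Picard iterates of a Volterra equation with a square integrable
  kernel satisfy \<open>|D\<^sub>n\<^sub>+\<^sub>1(x)|\<^sup>2 \<le> K\<close> times the integral of \<open>|D\<^sub>n|\<^sup>2\<close> over \<open>[0, x]\<close>, so \<open>|D\<^sub>n(x)|\<^sup>2 \<le> M\<^sup>2 K\<^sup>n x\<^sup>n / n!\<close>.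
\<close>

lemma picard_bound:
  fixes D :: "nat \<Rightarrow> real \<Rightarrow> 'a::euclidean_space" and a :: "real \<Rightarrow> real"
  assumes a: "a \<in> L2" and cont: "\<And>n. continuous_on {0..1} (D n)"
    and D0: "\<And>x. x \<in> {0..1} \<Longrightarrow> norm (D 0 x) \<le> M"
    and step: "\<And>n x. x \<in> {0..1} \<Longrightarrow> norm (D (Suc n) x) \<le> integral {0..x} (\<lambda>s. a s * norm (D n s))"
    and K: "integral {0..1} (\<lambda>s. (a s)\<^sup>2) \<le> K" and x: "x \<in> {0..1}"
  shows "norm (D n x) \<le> M * sqrt (K ^ n / fact n)"
proof -
  have M: "0 \<le> M" using D0[OF x] norm_ge_zero order_trans by blast
  have ia: "(\<lambda>s. (a s)\<^sup>2) absolutely_integrable_on {0..1}"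
    using L2_mult_integrable[OF bounded_bilinear_mult a a] by (simp add: power2_eq_square)
  have K0: "0 \<le> K"
    using K integral_nonneg[of "\<lambda>s. (a s)\<^sup>2" "{0..1}"] ia
    by (auto simp: absolutely_integrable_on_def)
  have "(norm (D n x))\<^sup>2 \<le> M\<^sup>2 * K ^ n * x ^ n / fact n" if "x \<in> {0..1}" for x
    using that
  proof (induction n arbitrary: x)
    case 0
    then show ?case using D0[of x] M by (simp add: power_mono)
  next
    case (Suc n)
    have c: "continuous_on {0..1} (\<lambda>s. norm (D n s))"
      using cont by (intro continuous_intros)
    have x0: "0 \<le> x" "x \<le> 1" using Suc.prems by auto
    have "(norm (D (Suc n) x))\<^sup>2 \<le> (integral {0..x} (\<lambda>s. a s * norm (D n s)))\<^sup>2"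
      using step[OF Suc.prems] by (simp add: power_mono)
    also have "\<dots> \<le> integral {0..1} (\<lambda>s. (a s)\<^sup>2) * integral {0..x} (\<lambda>s. (norm (D n s))\<^sup>2)"
      by (rule square_integral_le[OF a c Suc.prems])
    also have "\<dots> \<le> K * integral {0..x} (\<lambda>s. (norm (D n s))\<^sup>2)"
      by (intro mult_right_mono K integral_nonneg integrable_continuous_real continuous_intros
          continuous_on_subset[OF cont]) (use x0 in auto)
    also have "\<dots> \<le> K * integral {0..x} (\<lambda>s. M\<^sup>2 * K ^ n * s ^ n / fact n)"
      using Suc.IH x0
      by (intro mult_left_mono K0 integral_le integrable_continuous_real continuous_intros
          continuous_on_subset[OF cont]) auto
    also have "\<dots> = K * (M\<^sup>2 * K ^ n * x ^ Suc n / fact (Suc n) - M\<^sup>2 * K ^ n * 0 ^ Suc n / fact (Suc n))"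
    proof (intro arg_cong[of _ _ "(*) K"] integral_unique fundamental_theorem_of_calculus x0)
      show "((\<lambda>s. M\<^sup>2 * K ^ n * s ^ Suc n / fact (Suc n)) has_vector_derivative M\<^sup>2 * K ^ n * s ^ n / fact n)
          (at s within {0..x})" for s
        by (auto intro!: derivative_eq_intros simp: has_real_derivative_iff_has_vector_derivative[symmetric]
          divide_simps simp del: power_Suc of_nat_Suc)
    qed
    finally show ?case by (simp add: mult_ac)
  qed
  from this[OF x] have "(norm (D n x))\<^sup>2 \<le> M\<^sup>2 * K ^ n * x ^ n / fact n" .
  also have "\<dots> \<le> M\<^sup>2 * K ^ n * 1 / fact n"
    using x K0 by (intro divide_right_mono mult_left_mono power_le_one) auto
  finally have "(norm (D n x))\<^sup>2 \<le> M\<^sup>2 * (K ^ n / fact n)" by simp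
  then have "sqrt ((norm (D n x))\<^sup>2) \<le> sqrt (M\<^sup>2 * (K ^ n / fact n))"
    by (rule real_sqrt_le_mono)
  then show ?thesis using M by (metis abs_of_nonneg norm_ge_zero real_sqrt_abs real_sqrt_mult)
qed

lemma summable_sqrt_power_fact:
  assumes "0 \<le> (K::real)" shows "summable (\<lambda>n. sqrt (K ^ n / fact n))"
proof (rule summable_ratio_test)
  show "(1/2::real) < 1" by simp
  fix n assume n: "nat \<lceil>4 * K\<rceil> \<le> n"
  then have "4 * K \<le> real (Suc n)" by linarith
  then have le: "K / real (Suc n) \<le> 1 / 4" by (simp add: field_simps)
  have "sqrt (K ^ Suc n / fact (Suc n)) = sqrt (K / real (Suc n)) * sqrt (K ^ n / fact n)"
    by (simp add: real_sqrt_mult[symmetric] field_simps del: of_nat_Suc)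
  also have "\<dots> \<le> sqrt (1 / 4) * sqrt (K ^ n / fact n)"
    using le assms by (intro mult_right_mono real_sqrt_le_mono) auto
  also have "sqrt (1 / 4) = (1 / 2 :: real)" by (simp add: real_sqrt_divide)
  finally show "norm (sqrt (K ^ Suc n / fact (Suc n))) \<le> 1 / 2 * norm (sqrt (K ^ n / fact n))"
    using assms by simp
qed

lemma volterra_zero:
  fixes u :: "real \<Rightarrow> 'a::euclidean_space" and a :: "real \<Rightarrow> real"
  assumes a: "a \<in> L2" and cont: "continuous_on {0..1} u"
    and step: "\<And>x. x \<in> {0..1} \<Longrightarrow> norm (u x) \<le> integral {0..x} (\<lambda>s. a s * norm (u s))"
    and x: "x \<in> {0..1}"
  shows "u x = 0"
proof -
  obtain M where M: "\<And>x. x \<in> {0..1} \<Longrightarrow> norm (u x) \<le> M"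
    using compact_imp_bounded[OF compact_continuous_image[OF cont compact_Icc]] unfolding bounded_iff by blast
  define K where "K = \<bar>integral {0..1} (\<lambda>s. (a s)\<^sup>2)\<bar>"
  have "norm (u x) \<le> M * sqrt (K ^ n / fact n)" for n
    by (rule picard_bound[OF a, of "\<lambda>_. u"]) (use M cont step x in \<open>auto simp: K_def\<close>)
  moreover have "(\<lambda>n. M * sqrt (K ^ n / fact n)) \<longlonglongrightarrow> M * 0"
    by (intro tendsto_mult tendsto_const summable_LIMSEQ_zero summable_sqrt_power_fact) (simp add: K_def)
  ultimately have "norm (u x) \<le> 0"
    by (intro LIMSEQ_le_const[of _ 0]) auto
  then show ?thesis by simp
qed

lemma absolutely_integrable_Pair:
  fixes f :: "real \<Rightarrow> 'a::euclidean_space" and g :: "real \<Rightarrow> 'b::euclidean_space"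
  assumes "f absolutely_integrable_on S" "g absolutely_integrable_on S"
  shows "(\<lambda>x. (f x, g x)) absolutely_integrable_on S"
proof -
  have 1: "bounded_linear (\<lambda>a::'a. (a, 0::'b))" and 2: "bounded_linear (\<lambda>b::'b. (0::'a, b))"
    by (auto intro!: bounded_linear_Pair bounded_linear_ident bounded_linear_zero)
  have "(\<lambda>x. (f x, 0) + (0, g x)) absolutely_integrable_on S"
    using absolutely_integrable_linear[OF assms(1) 1] absolutely_integrable_linear[OF assms(2) 2]
    by (intro set_integral_add(1)) (simp_all add: o_def)
  then show ?thesis by simp
qed

lemma acder_Pair:
  assumes "acder f f'" "acder g g'"
  shows "acder (\<lambda>x. (f x, g x)) (\<lambda>x. (f' x, g' x))"
proof -
  have 1: "bounded_linear (\<lambda>a. (a, 0))" and 2: "bounded_linear (\<lambda>b. (0, b))"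
    by (auto intro!: bounded_linear_Pair bounded_linear_ident bounded_linear_zero)
  show ?thesis
    using acder_add[OF acder_linear[OF assms(1) 1] acder_linear[OF assms(2) 2]] by simp
qed

section \<open>The first order system\<close>

text \<open>
  The equation \<open>- (d/dx + \<tau>) (d/dx - \<tau>) y = \<mu> y\<close> as a system for \<open>y\<close> and its quasi-derivative
  \<open>h = y' - \<tau> y\<close>.  The action \<open>act\<close> of matrices on the values is matrix multiplication, or the
  multiplication of vectors by matrices.
\<close>

definition sys ::
    "(complex^'n^'n \<Rightarrow> 'v \<Rightarrow> 'v) \<Rightarrow> (real \<Rightarrow> complex^'n^'n) \<Rightarrow> complex \<Rightarrow>
      (real \<Rightarrow> 'v::euclidean_space) \<Rightarrow> (real \<Rightarrow> 'v) \<Rightarrow> bool" where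
  "sys act \<tau> \<mu> y h \<longleftrightarrow>
     acder y (\<lambda>x. act (\<tau> x) (y x) + h x) \<and>
     acder h (\<lambda>x. - act (\<tau> x) (h x) - act (mat \<mu>) (y x))"

text \<open>
  The right hand side of the matrix-valued system as a function of the pair \<open>z = (y, h)\<close>, and the
  corresponding Volterra operator.
\<close>

definition coef ::
    "(real \<Rightarrow> complex^'n^'n) \<Rightarrow> complex \<Rightarrow> real \<Rightarrow> (complex^'n^'n) \<times> (complex^'n^'n) \<Rightarrow>
      (complex^'n^'n) \<times> (complex^'n^'n)" where
  "coef \<tau> \<mu> s z = (\<tau> s ** fst z + snd z, - (\<tau> s ** snd z) - mat \<mu> ** fst z)"

definition volt ::
    "(real \<Rightarrow> complex^'n^'n) \<Rightarrow> complex \<Rightarrow> (real \<Rightarrow> (complex^'n^'n) \<times> (complex^'n^'n)) \<Rightarrow>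
      real \<Rightarrow> (complex^'n^'n) \<times> (complex^'n^'n)" where
  "volt \<tau> \<mu> u x = integral {0..x} (\<lambda>s. coef \<tau> \<mu> s (u s))"

lemma coef_bound:
  obtains C where "0 < C"
    "\<And>(\<tau> :: real \<Rightarrow> complex^'n^'n) \<mu> s z. norm (coef \<tau> \<mu> s z) \<le> C * (norm (\<tau> s) + norm \<mu> + 1) * norm z"
proof -
  obtain K where K: "0 < K" "\<And>(A :: complex^'n^'n) (B :: complex^'n^'n). norm (A ** B) \<le> norm A * norm B * K"
    using bounded_bilinear.pos_bounded[OF bounded_bilinear_matrix_mult] by blast
  obtain L where L: "0 < L" "\<And>\<mu>. norm (mat \<mu> :: complex^'n^'n) \<le> norm \<mu> * L"
    using bounded_linear.pos_bounded[OF bounded_linear_mat] by blast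
  define C where "C = 2 * K + L * K + 1"
  have "norm (coef \<tau> \<mu> s z) \<le> C * (norm (\<tau> s) + norm \<mu> + 1) * norm z"
    for \<tau> :: "real \<Rightarrow> complex^'n^'n" and \<mu> s z
  proof -
    have f: "norm (fst z) \<le> norm z" and g: "norm (snd z) \<le> norm z"
      by (metis norm_fst_le prod.collapse) (metis norm_snd_le prod.collapse)
    have 1: "norm (\<tau> s ** fst z) \<le> norm (\<tau> s) * norm z * K"
      by (intro order_trans[OF K(2)] mult_right_mono mult_left_mono) (use K(1) f in auto)
    have 2: "norm (\<tau> s ** snd z) \<le> norm (\<tau> s) * norm z * K"
      by (intro order_trans[OF K(2)] mult_right_mono mult_left_mono) (use K(1) g in auto)
    have "norm ((mat \<mu> :: complex^'n^'n) ** fst z) \<le> norm (mat \<mu> :: complex^'n^'n) * norm (fst z) * K"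
      by (rule K)
    also have "\<dots> \<le> (norm \<mu> * L) * norm z * K"
      using L K f by (intro mult_right_mono mult_mono) auto
    finally have 3: "norm ((mat \<mu> :: complex^'n^'n) ** fst z) \<le> (norm \<mu> * L) * norm z * K" .
    have "norm (coef \<tau> \<mu> s z) \<le> norm (\<tau> s ** fst z + snd z) + norm (- (\<tau> s ** snd z) - (mat \<mu> :: complex^'n^'n) ** fst z)"
      unfolding coef_def by (rule norm_Pair_le)
    also have "\<dots> \<le> (norm (\<tau> s ** fst z) + norm (snd z)) + (norm (\<tau> s ** snd z) + norm ((mat \<mu> :: complex^'n^'n) ** fst z))"
      by (intro add_mono norm_triangle_ineq order_trans[OF norm_triangle_ineq4]) simp_all
    also have "\<dots> \<le> (norm (\<tau> s) * (2 * K) + norm \<mu> * (L * K) + 1 * 1) * norm z"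
      using 1 2 3 g by (simp add: algebra_simps)
    also have "\<dots> \<le> (norm (\<tau> s) * C + norm \<mu> * C + 1 * C) * norm z"
      using K L by (intro mult_right_mono add_mono mult_left_mono) (auto simp: C_def)
    finally show ?thesis by (simp add: algebra_simps)
  qed
  moreover have "0 < C" using K L by (simp add: C_def add_pos_pos)
  ultimately show ?thesis using that by blast
qed

lemma coef_integrable:
  assumes "\<tau> \<in> L2" "continuous_on {0..1} u"
  shows "(\<lambda>s. coef \<tau> \<mu> s (u s)) absolutely_integrable_on {0..1}"
proof -
  have c: "continuous_on {0..1} (\<lambda>s. fst (u s))" "continuous_on {0..1} (\<lambda>s. snd (u s))"
    using assms(2) by (auto intro: continuous_intros)
  have m: "continuous_on {0..1} (\<lambda>s. mat \<mu> ** fst (u s))"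
    by (intro bounded_bilinear.continuous_on[OF bounded_bilinear_matrix_mult] continuous_intros c)
  note L2 = L2_bilinear_continuous[OF bounded_bilinear_matrix_mult assms(1)]
  show ?thesis
    unfolding coef_def
    by (intro absolutely_integrable_Pair L2_absolutely_integrable L2_add L2_diff L2_minus
        L2[OF c(1)] L2[OF c(2)] L2_continuous[OF c(2)] L2_continuous[OF m])
qed

lemma coef_add: "coef \<tau> \<mu> s (z + w) = coef \<tau> \<mu> s z + coef \<tau> \<mu> s w"
  by (simp add: coef_def matrix_add_ldistrib)

lemma volt_continuous:
  assumes "\<tau> \<in> L2" "continuous_on {0..1} u" shows "continuous_on {0..1} (volt \<tau> \<mu> u)"
proof -
  have "(\<lambda>s. coef \<tau> \<mu> s (u s)) integrable_on {0..1}"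
    using coef_integrable[OF assms] by (simp add: absolutely_integrable_on_def)
  then show ?thesis
    unfolding volt_def[abs_def] by (rule indefinite_integral_continuous_1)
qed

lemma coef_integrable_on:
  assumes "\<tau> \<in> L2" "continuous_on {0..1} u" "x \<in> {0..1}"
  shows "(\<lambda>s. coef \<tau> \<mu> s (u s)) integrable_on {0..x}"
  using absolutely_integrable_unit_sub(2)[OF coef_integrable[OF assms(1,2)]] assms(3) by auto

lemma volt_add:
  assumes "\<tau> \<in> L2" "continuous_on {0..1} u" "continuous_on {0..1} v" "x \<in> {0..1}"
  shows "volt \<tau> \<mu> (\<lambda>s. u s + v s) x = volt \<tau> \<mu> u x + volt \<tau> \<mu> v x"
  unfolding volt_def coef_add using assms by (intro integral_add coef_integrable_on)

lemma volt_zero: "volt \<tau> \<mu> (\<lambda>s. 0) x = 0"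
  by (simp add: volt_def coef_def zero_prod_def[symmetric])

lemma volt_sum:
  assumes "\<tau> \<in> L2" "\<And>k. continuous_on {0..1} (u k)" "x \<in> {0..1}"
  shows "volt \<tau> \<mu> (\<lambda>s. \<Sum>k<n. u k s) x = (\<Sum>k<n::nat. volt \<tau> \<mu> (u k) x)"
proof (induction n)
  case (Suc n)
  have "continuous_on {0..1} (\<lambda>s. \<Sum>k<n. u k s)"
    by (intro continuous_on_sum assms)
  from volt_add[OF assms(1) this assms(2) assms(3), of \<mu> n] Suc show ?case by simp
qed (simp add: volt_zero)

lemma L2_norm: "f \<in> L2 \<Longrightarrow> (\<lambda>x. norm (f x)) \<in> L2"
  by (auto simp: L2_def)

lemma volt_bound:
  fixes \<tau> :: "real \<Rightarrow> complex^'n^'n" and R :: real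
  assumes \<tau>: "\<tau> \<in> L2"
  obtains a where "a \<in> L2" "\<And>s. 0 \<le> a s"
    "\<And>\<mu> u x. continuous_on {0..1} u \<Longrightarrow> norm \<mu> \<le> R \<Longrightarrow> x \<in> {0..1} \<Longrightarrow>
        norm (volt \<tau> \<mu> u x) \<le> integral {0..x} (\<lambda>s. a s * norm (u s))"
proof -
  obtain C where C: "0 < C"
    "\<And>(\<tau> :: real \<Rightarrow> complex^'n^'n) \<mu> s z. norm (coef \<tau> \<mu> s z) \<le> C * (norm (\<tau> s) + norm \<mu> + 1) * norm z"
    using coef_bound by blast
  define a where "a = (\<lambda>s. C * (norm (\<tau> s) + \<bar>R\<bar> + 1))"
  have L: "a \<in> L2"
    unfolding a_def
    by (intro L2_linear[OF _ bounded_linear_mult_right] L2_add L2_norm[OF \<tau>]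
        L2_continuous[OF continuous_on_const])
  show ?thesis
  proof (rule that[OF L])
    show "0 \<le> a s" for s using C(1) by (simp add: a_def)
    fix \<mu> :: complex and u :: "real \<Rightarrow> (complex^'n^'n) \<times> (complex^'n^'n)" and x :: real
    assume u: "continuous_on {0..1} u" and R: "norm \<mu> \<le> R" and x: "x \<in> {0..1}"
    have "(\<lambda>s. a s * norm (u s)) absolutely_integrable_on {0..1}"
      by (intro L2_mult_integrable[OF bounded_bilinear_mult L] L2_continuous continuous_on_norm u)
    then have i: "(\<lambda>s. a s * norm (u s)) integrable_on {0..x}"
      using x by (intro absolutely_integrable_unit_sub(2)) auto
    show "norm (volt \<tau> \<mu> u x) \<le> integral {0..x} (\<lambda>s. a s * norm (u s))"
      unfolding volt_def
    proof (rule integral_norm_bound_integral[OF coef_integrable_on[OF \<tau> u x] i])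
      fix s
      have "norm (coef \<tau> \<mu> s (u s)) \<le> C * (norm (\<tau> s) + norm \<mu> + 1) * norm (u s)" by (rule C)
      also have "\<dots> \<le> a s * norm (u s)"
        unfolding a_def using C(1) R by (intro mult_right_mono mult_left_mono) auto
      finally show "norm (coef \<tau> \<mu> s (u s)) \<le> a s * norm (u s)" .
    qed
  qed
qed

lemma sys_unique:
  fixes y y' h h' :: "real \<Rightarrow> complex^'n^'n"
  assumes \<tau>: "\<tau> \<in> L2" and s: "sys (**) \<tau> \<mu> y h" and s': "sys (**) \<tau> \<mu> y' h'"
    and 0: "y 0 = y' 0" "h 0 = h' 0" and x: "x \<in> {0..1}"
  shows "y x = y' x" "h x = h' x"
proof -
  obtain a where a: "a \<in> L2" "\<And>s. 0 \<le> a s"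
    "\<And>\<mu>' u x. continuous_on {0..1} u \<Longrightarrow> norm \<mu>' \<le> norm \<mu> \<Longrightarrow> x \<in> {0..1} \<Longrightarrow>
        norm (volt \<tau> \<mu>' u x) \<le> integral {0..x} (\<lambda>s. a s * norm (u s))"
    by (rule volt_bound[OF \<tau>, of "norm \<mu>"]) blast
  define d where "d = (\<lambda>x. (y x - y' x, h x - h' x))"
  have "acder d (\<lambda>x. ((\<tau> x ** y x + h x) - (\<tau> x ** y' x + h' x),
      (- (\<tau> x ** h x) - mat \<mu> ** y x) - (- (\<tau> x ** h' x) - mat \<mu> ** y' x)))"
    using s s' unfolding d_def sys_def by (intro acder_Pair acder_diff) auto
  also have "(\<lambda>x. ((\<tau> x ** y x + h x) - (\<tau> x ** y' x + h' x),
      (- (\<tau> x ** h x) - mat \<mu> ** y x) - (- (\<tau> x ** h' x) - mat \<mu> ** y' x))) = (\<lambda>x. coef \<tau> \<mu> x (d x))"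
    by (simp add: coef_def d_def fun_eq_iff matrix_mult_diff_right)
  finally have d: "acder d (\<lambda>x. coef \<tau> \<mu> x (d x))" .
  have d0: "d 0 = 0" using 0 by (simp add: d_def zero_prod_def)
  have "d x = 0"
  proof (rule volterra_zero[OF a(1) _ _ x])
    show "continuous_on {0..1} d" by (rule acder_continuous[OF d])
    then show "norm (d x) \<le> integral {0..x} (\<lambda>s. a s * norm (d s))"
      if "x \<in> {0..1}" for x
      using a(3)[of d \<mu> x] acder_eq[OF d that] d0 that by (simp add: volt_def)
  qed
  then show "y x = y' x" "h x = h' x" by (auto simp: d_def prod_eq_iff)
qed

text \<open>
  The increments of the Picard iteration; the solution with initial value \<open>z0\<close> is their sum.
\<close>

primrec picard ::
    "(real \<Rightarrow> complex^'n^'n) \<Rightarrow> (complex^'n^'n) \<times> (complex^'n^'n) \<Rightarrow> nat \<Rightarrow> complex \<Rightarrow>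
      real \<Rightarrow> (complex^'n^'n) \<times> (complex^'n^'n)" where
  "picard \<tau> z0 0 = (\<lambda>\<mu> x. z0)"
| "picard \<tau> z0 (Suc n) = (\<lambda>\<mu>. volt \<tau> \<mu> (picard \<tau> z0 n \<mu>))"

lemma picard_continuous: "\<tau> \<in> L2 \<Longrightarrow> continuous_on {0..1} (picard \<tau> z0 n \<mu>)"
  by (induction n) (auto intro: volt_continuous)

definition picard_sum ::
    "(real \<Rightarrow> complex^'n^'n) \<Rightarrow> (complex^'n^'n) \<times> (complex^'n^'n) \<Rightarrow> complex \<Rightarrow>
      real \<Rightarrow> (complex^'n^'n) \<times> (complex^'n^'n)" where
  "picard_sum \<tau> z0 \<mu> x = (\<Sum>n. picard \<tau> z0 n \<mu> x)"

lemma picard_uniform_limit: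
  assumes \<tau>: "\<tau> \<in> L2"
  shows "uniform_limit ({0..1} \<times> cball 0 R) (\<lambda>n p. \<Sum>k<n. picard \<tau> z0 k (snd p) (fst p))
    (\<lambda>p. picard_sum \<tau> z0 (snd p) (fst p)) sequentially"
proof -
  obtain a where a: "a \<in> L2"
    "\<And>\<mu> u x. continuous_on {0..1} u \<Longrightarrow> norm \<mu> \<le> R \<Longrightarrow> x \<in> {0..1} \<Longrightarrow>
        norm (volt \<tau> \<mu> u x) \<le> integral {0..x} (\<lambda>s. a s * norm (u s))"
    by (rule volt_bound[OF \<tau>, of R]) blast
  define K where "K = \<bar>integral {0..1} (\<lambda>s. (a s)\<^sup>2)\<bar>"
  show ?thesis
    unfolding picard_sum_def
  proof (rule Weierstrass_m_test)
    show "summable (\<lambda>n. norm z0 * sqrt (K ^ n / fact n))"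
      by (intro summable_mult summable_sqrt_power_fact) (simp add: K_def)
    fix n and p :: "real \<times> complex" assume "p \<in> {0..1} \<times> cball (0::complex) R"
    then have p: "fst p \<in> {0..1}" "norm (snd p) \<le> R" by auto
    show "norm (picard \<tau> z0 n (snd p) (fst p)) \<le> norm z0 * sqrt (K ^ n / fact n)"
    proof (rule picard_bound[OF a(1), where D = "\<lambda>n. picard \<tau> z0 n (snd p)"])
      show "norm (picard \<tau> z0 (Suc n) (snd p) x)
          \<le> integral {0..x} (\<lambda>s. a s * norm (picard \<tau> z0 n (snd p) s))"
        if "x \<in> {0..1}" for n x
        using a(2)[OF picard_continuous[OF \<tau>] p(2) that] by simp
    qed (use p \<tau> in \<open>auto simp: K_def intro: picard_continuous\<close>)
  qed
qed

lemma picard_sum_solves: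
  fixes \<tau> :: "real \<Rightarrow> complex^'n^'n"
  assumes \<tau>: "\<tau> \<in> L2"
  shows "continuous_on {0..1} (picard_sum \<tau> z0 \<mu>)"
    and "x \<in> {0..1} \<Longrightarrow> picard_sum \<tau> z0 \<mu> x = z0 + volt \<tau> \<mu> (picard_sum \<tau> z0 \<mu>) x"
proof -
  let ?S = "\<lambda>n x. \<Sum>k<n. picard \<tau> z0 k \<mu> x" and ?Z = "picard_sum \<tau> z0 \<mu>"
  have "uniform_limit ((\<lambda>x. (x, \<mu>)) ` {0..1}) (\<lambda>n p. \<Sum>k<n. picard \<tau> z0 k (snd p) (fst p))
    (\<lambda>p. picard_sum \<tau> z0 (snd p) (fst p)) sequentially"
    by (rule uniform_limit_on_subset[OF picard_uniform_limit[OF \<tau>, where R = "norm \<mu>"]]) auto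
  then have u: "uniform_limit {0..1} ?S ?Z sequentially"
    unfolding uniform_limit_iff by simp
  have cS: "continuous_on {0..1} (?S n)" for n
    using picard_continuous[OF \<tau>] by (intro continuous_intros)
  show cZ: "continuous_on {0..1} ?Z"
    by (rule uniform_limit_theorem[OF _ u]) (use cS in auto)
  obtain a where a: "a \<in> L2" "\<And>s. 0 \<le> a s"
    "\<And>\<mu>' u x. continuous_on {0..1} u \<Longrightarrow> norm \<mu>' \<le> norm \<mu> \<Longrightarrow> x \<in> {0..1} \<Longrightarrow>
        norm (volt \<tau> \<mu>' u x) \<le> integral {0..x} (\<lambda>s. a s * norm (u s))"
    by (rule volt_bound[OF \<tau>, of "norm \<mu>"]) blast
  assume x: "x \<in> {0..1}"
  have ia: "a integrable_on {0..x}"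
    using absolutely_integrable_unit_sub(2)[OF L2_absolutely_integrable[OF a(1)]] x by auto
  have "(\<lambda>n. ?S (Suc n) x) \<longlonglongrightarrow> ?Z x"
    using LIMSEQ_Suc[OF tendsto_uniform_limitI[OF u x]] .
  moreover have "?S (Suc n) x = z0 + volt \<tau> \<mu> (?S n) x" for n
    using volt_sum[OF \<tau> picard_continuous[OF \<tau>] x]
    by (subst sum.lessThan_Suc_shift) simp
  moreover have "(\<lambda>n. volt \<tau> \<mu> (?S n) x) \<longlonglongrightarrow> volt \<tau> \<mu> ?Z x"
  proof (rule LIMSEQ_I)
    fix r :: real assume r: "0 < r"
    define I where "I = integral {0..x} a"
    have I: "0 \<le> I" unfolding I_def using a(2) by (intro integral_nonneg ia) auto
    define e where "e = r / (I + 1)"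
    have e: "0 < e" using r I by (simp add: e_def)
    from u e obtain N where N: "\<And>n x. N \<le> n \<Longrightarrow> x \<in> {0..1} \<Longrightarrow> dist (?S n x) (?Z x) < e"
      unfolding uniform_limit_iff eventually_sequentially by blast
    have "norm (volt \<tau> \<mu> (?S n) x - volt \<tau> \<mu> ?Z x) < r" if n: "N \<le> n" for n
    proof -
      have cd: "continuous_on {0..1} (\<lambda>s. ?S n s - ?Z s)"
        using cS cZ by (intro continuous_on_diff)
      have "volt \<tau> \<mu> (?S n) x - volt \<tau> \<mu> ?Z x = volt \<tau> \<mu> (\<lambda>s. ?S n s - ?Z s) x"
        using volt_add[OF \<tau> cd cZ x, of \<mu>] by simp
      then have "norm (volt \<tau> \<mu> (?S n) x - volt \<tau> \<mu> ?Z x) \<le> integral {0..x} (\<lambda>s. a s * norm (?S n s - ?Z s))"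
        using a(3)[OF cd order_refl x] by simp
      also have "\<dots> \<le> integral {0..x} (\<lambda>s. a s * e)"
      proof (rule integral_le)
        have "(\<lambda>s. a s * norm (?S n s - ?Z s)) absolutely_integrable_on {0..1}"
          by (intro L2_mult_integrable[OF bounded_bilinear_mult a(1)] L2_continuous continuous_on_norm cd)
        then show "(\<lambda>s. a s * norm (?S n s - ?Z s)) integrable_on {0..x}"
          using x by (intro absolutely_integrable_unit_sub(2)) auto
        show "(\<lambda>s. a s * e) integrable_on {0..x}"
          using integrable_on_mult_left[OF ia] by simp
        show "a s * norm (?S n s - ?Z s) \<le> a s * e" if "s \<in> {0..x}" for s
          using N[OF n, of s] that x a(2) by (intro mult_left_mono) (auto simp: dist_norm)
      qed
      also have "\<dots> = I * e" by (simp add: I_def)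
      also have "\<dots> < r" using I r by (simp add: e_def field_simps)
      finally show ?thesis .
    qed
    then show "\<exists>N. \<forall>n\<ge>N. norm (volt \<tau> \<mu> (?S n) x - volt \<tau> \<mu> ?Z x) < r" by blast
  qed
  then have "(\<lambda>n. z0 + volt \<tau> \<mu> (?S n) x) \<longlonglongrightarrow> z0 + volt \<tau> \<mu> ?Z x"
    by (rule tendsto_add[OF tendsto_const])
  ultimately show "?Z x = z0 + volt \<tau> \<mu> ?Z x"
    by (simp add: LIMSEQ_unique)
qed

section \<open>Analytic dependence on the spectral parameter\<close>

text \<open>
  Multiplication of a pair of matrices by a complex scalar.
\<close>

definition sc :: "complex \<Rightarrow> (complex^'n^'n) \<times> (complex^'n^'n) \<Rightarrow> (complex^'n^'n) \<times> (complex^'n^'n)" where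
  "sc \<mu> z = (mat \<mu> ** fst z, mat \<mu> ** snd z)"

lemma bounded_linear_sc: "bounded_linear (sc \<mu>)"
  unfolding sc_def[abs_def]
  by (intro bounded_linear_Pair bounded_linear_compose[OF
        bounded_bilinear.bounded_linear_right[OF bounded_bilinear_matrix_mult]]
      bounded_linear_fst bounded_linear_snd)

text \<open>
  Families of functions on \<open>[0, 1]\<close> that are polynomials in the parameter \<open>\<mu>\<close> with continuous coefficients.
  All equations are required on \<open>[0, 1]\<close> only.
\<close>

inductive polyfam :: "(complex \<Rightarrow> real \<Rightarrow> (complex^'n^'n) \<times> (complex^'n^'n)) \<Rightarrow> bool" where
  const: "continuous_on {0..1} u \<Longrightarrow> (\<And>\<mu> x. x \<in> {0..1} \<Longrightarrow> F \<mu> x = u x) \<Longrightarrow> polyfam F"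
| mult: "polyfam F \<Longrightarrow> (\<And>\<mu> x. x \<in> {0..1} \<Longrightarrow> G \<mu> x = sc \<mu> (F \<mu> x)) \<Longrightarrow> polyfam G"
| add: "polyfam F \<Longrightarrow> polyfam G \<Longrightarrow> (\<And>\<mu> x. x \<in> {0..1} \<Longrightarrow> H \<mu> x = F \<mu> x + G \<mu> x) \<Longrightarrow> polyfam H"

lemma polyfam_continuous: "polyfam F \<Longrightarrow> continuous_on {0..1} (F \<mu>)"
proof (induction rule: polyfam.induct)
  case (const u F)
  then show ?case by (metis continuous_on_cong)
next
  case (mult F G)
  have "continuous_on {0..1} (\<lambda>x. sc \<mu> (F \<mu> x))"
    by (rule bounded_linear.continuous_on[OF bounded_linear_sc mult.IH])
  then show ?case using mult.hyps(2) by (metis (no_types, lifting) continuous_on_cong)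
next
  case (add F G H)
  have "continuous_on {0..1} (\<lambda>x. F \<mu> x + G \<mu> x)"
    by (rule continuous_on_add[OF add.IH])
  then show ?case using add.hyps(3) by (metis (no_types, lifting) continuous_on_cong)
qed

lemma polyfam_holomorphic:
  fixes F :: "complex \<Rightarrow> real \<Rightarrow> (complex^'n^'n) \<times> (complex^'n^'n)"
  assumes "polyfam F" "x \<in> {0..1}" shows "(\<lambda>\<mu>. fst (F \<mu> x) $ i $ j) holomorphic_on UNIV"
  using assms
  by (induction rule: polyfam.induct) (simp_all add: sc_def holomorphic_on_mult holomorphic_on_add)

lemma polyfam_integral:
  assumes F: "polyfam F"
    and add: "\<And>s z w. L s (z + w) = L s z + L s w"
    and sc: "\<And>s \<mu> z. L s (sc \<mu> z) = sc \<mu> (L s z)"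
    and int: "\<And>u. continuous_on {0..1} u \<Longrightarrow> (\<lambda>s. L s (u s)) absolutely_integrable_on {0..1}"
  shows "polyfam (\<lambda>\<mu> x. integral {0..x} (\<lambda>s. L s (F \<mu> s)))"
  using F
proof (induction rule: polyfam.induct)
  case (const u F)
  show ?case
  proof (rule polyfam.const)
    show "continuous_on {0..1} (\<lambda>x. integral {0..x} (\<lambda>s. L s (u s)))"
      using int[OF const(1)] by (intro indefinite_integral_continuous_1) (simp add: absolutely_integrable_on_def)
  qed (use const(2) in \<open>auto intro!: integral_cong\<close>)
next
  case (mult F G)
  show ?case
  proof (rule polyfam.mult[OF mult.IH])
    fix \<mu> and x :: real assume x: "x \<in> {0..1}"
    have "integral {0..x} (\<lambda>s. L s (G \<mu> s)) = integral {0..x} (sc \<mu> \<circ> (\<lambda>s. L s (F \<mu> s)))"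
      using x mult.hyps(2) by (intro integral_cong) (auto simp: sc)
    also have "\<dots> = sc \<mu> (integral {0..x} (\<lambda>s. L s (F \<mu> s)))"
      using x by (intro integral_linear bounded_linear_sc
          absolutely_integrable_unit_sub(2)[OF int[OF polyfam_continuous[OF mult.hyps(1)]]]) auto
    finally show "integral {0..x} (\<lambda>s. L s (G \<mu> s)) = sc \<mu> (integral {0..x} (\<lambda>s. L s (F \<mu> s)))" .
  qed
next
  case (add F G H)
  show ?case
  proof (rule polyfam.add[OF add.IH])
    fix \<mu> and x :: real assume x: "x \<in> {0..1}"
    have "integral {0..x} (\<lambda>s. L s (H \<mu> s)) = integral {0..x} (\<lambda>s. L s (F \<mu> s) + L s (G \<mu> s))"
      using x add.hyps(3) by (intro integral_cong) (auto simp: assms(2))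
    also have "\<dots> = integral {0..x} (\<lambda>s. L s (F \<mu> s)) + integral {0..x} (\<lambda>s. L s (G \<mu> s))"
      using x by (intro integral_add absolutely_integrable_unit_sub(2)[OF int] polyfam_continuous add.hyps) auto
    finally show "integral {0..x} (\<lambda>s. L s (H \<mu> s)) =
      integral {0..x} (\<lambda>s. L s (F \<mu> s)) + integral {0..x} (\<lambda>s. L s (G \<mu> s))" .
  qed
qed

lemma polyfam_picard:
  fixes \<tau> :: "real \<Rightarrow> complex^'n^'n"
  assumes \<tau>: "\<tau> \<in> L2" shows "polyfam (picard \<tau> z0 n)"
proof (induction n)
  case 0
  show ?case by (rule polyfam.const[of "\<lambda>_. z0"]) auto
next
  case (Suc n)
  let ?F = "picard \<tau> z0 n" 
    and ?N = "\<lambda>(s::real) (z :: (complex^'n^'n) \<times> (complex^'n^'n)). (0 :: complex^'n^'n, - fst z)"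
  have intN: "(\<lambda>s. ?N s (u s)) absolutely_integrable_on {0..1}" if "continuous_on {0..1} u" for u
    by (intro absolutely_integrable_continuous_real continuous_intros that)
  have 1: "polyfam (\<lambda>\<mu> x. integral {0..x} (\<lambda>s. coef \<tau> 0 s (?F \<mu> s)))"
    by (rule polyfam_integral[OF Suc coef_add _ coef_integrable[OF \<tau>]])
      (simp add: coef_def sc_def matrix_add_ldistrib matrix_mult_diff_right matrix_mult_minus_right mat_mult_left_commute)
  have 2: "polyfam (\<lambda>\<mu> x. integral {0..x} (\<lambda>s. ?N s (?F \<mu> s)))"
    by (rule polyfam_integral[OF Suc _ _ intN]) (simp_all add: sc_def matrix_mult_minus_right)
  have 3: "polyfam (\<lambda>\<mu> x. sc \<mu> (integral {0..x} (\<lambda>s. ?N s (?F \<mu> s))))"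
    by (rule polyfam.mult[OF 2]) simp
  show ?case
  proof (rule polyfam.add[OF 1 3])
    fix \<mu> and x :: real assume x: "x \<in> {0..1}"
    have i: "(\<lambda>s. ?N s (?F \<mu> s)) integrable_on {0..x}"
      using absolutely_integrable_unit_sub(2)[OF intN[OF picard_continuous[OF \<tau>]]] x by auto
    have "coef \<tau> \<mu> s z = coef \<tau> 0 s z + sc \<mu> (?N s z)" for s z
      by (simp add: coef_def sc_def matrix_mult_minus_right)
    then have "picard \<tau> z0 (Suc n) \<mu> x = integral {0..x} (\<lambda>s. coef \<tau> 0 s (?F \<mu> s) + (sc \<mu> \<circ> (\<lambda>s. ?N s (?F \<mu> s))) s)"
      by (simp add: volt_def)
    also have "\<dots> = integral {0..x} (\<lambda>s. coef \<tau> 0 s (?F \<mu> s)) + integral {0..x} (sc \<mu> \<circ> (\<lambda>s. ?N s (?F \<mu> s)))"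
      by (intro integral_add coef_integrable_on[OF \<tau> picard_continuous[OF \<tau>] x]
          integrable_linear[OF i bounded_linear_sc])
    also have "integral {0..x} (sc \<mu> \<circ> (\<lambda>s. ?N s (?F \<mu> s))) = sc \<mu> (integral {0..x} (\<lambda>s. ?N s (?F \<mu> s)))"
      by (rule integral_linear[OF i bounded_linear_sc])
    finally show "picard \<tau> z0 (Suc n) \<mu> x = integral {0..x} (\<lambda>s. coef \<tau> 0 s (?F \<mu> s)) +
      sc \<mu> (integral {0..x} (\<lambda>s. ?N s (?F \<mu> s)))" .
  qed
qed

text \<open>
  The initial value problem is solvable, and the solution is an entire function of the spectral parameter,
  being a locally uniform limit of polynomials.
\<close>

lemma sys_solution:
  fixes \<tau> :: "real \<Rightarrow> complex^'n^'n"
  assumes \<tau>: "\<tau> \<in> L2"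
  obtains Y H :: "complex \<Rightarrow> real \<Rightarrow> complex^'n^'n"
    where "\<And>\<mu>. sys (**) \<tau> \<mu> (Y \<mu>) (H \<mu>)" "\<And>\<mu>. Y \<mu> 0 = a" "\<And>\<mu>. H \<mu> 0 = b"
    "\<And>x i j. x \<in> {0..1} \<Longrightarrow> (\<lambda>\<mu>. Y \<mu> x $ i $ j) holomorphic_on UNIV"
proof -
  define Z where "Z = picard_sum \<tau> (a, b)"
  define Y H where "Y = (\<lambda>\<mu> x. fst (Z \<mu> x))" and "H = (\<lambda>\<mu> x. snd (Z \<mu> x))"
  have c: "continuous_on {0..1} (Z \<mu>)" for \<mu>
    unfolding Z_def by (rule picard_sum_solves[OF \<tau>])
  have eq: "Z \<mu> x = (a, b) + integral {0..x} (\<lambda>s. coef \<tau> \<mu> s (Z \<mu> s))" if "x \<in> {0..1}" for \<mu> x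
    using picard_sum_solves(2)[OF \<tau> that] by (simp add: Z_def volt_def)
  have Z: "acder (Z \<mu>) (\<lambda>s. coef \<tau> \<mu> s (Z \<mu> s))" for \<mu>
    by (rule acder_cong[OF acderI_integral[OF coef_integrable[OF \<tau> c]]]) (use eq in auto)
  show ?thesis
  proof (rule that)
    show "sys (**) \<tau> \<mu> (Y \<mu>) (H \<mu>)" for \<mu>
      using acder_linear[OF Z[of \<mu>] bounded_linear_fst] acder_linear[OF Z[of \<mu>] bounded_linear_snd]
      by (simp add: sys_def Y_def H_def coef_def)
    show "Y \<mu> 0 = a" "H \<mu> 0 = b" for \<mu>
      using eq[of 0 \<mu>] by (simp_all add: Y_def H_def)
    fix x :: real and i j assume x: "x \<in> {0..1}"
    show "(\<lambda>\<mu>. Y \<mu> x $ i $ j) holomorphic_on UNIV"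
    proof (rule holomorphic_uniform_sequence[where f = "\<lambda>n \<mu>. \<Sum>k<n. fst (picard \<tau> (a, b) k \<mu> x) $ i $ j"])
      show "(\<lambda>\<mu>. \<Sum>k<n. fst (picard \<tau> (a, b) k \<mu> x) $ i $ j) holomorphic_on UNIV" for n
        by (intro holomorphic_on_sum polyfam_holomorphic[OF polyfam_picard[OF \<tau>] x])
      fix \<mu>0 :: complex
      have "uniform_limit ((\<lambda>\<mu>. (x, \<mu>)) ` cball \<mu>0 1) (\<lambda>n p. \<Sum>k<n. picard \<tau> (a, b) k (snd p) (fst p))
        (\<lambda>p. Z (snd p) (fst p)) sequentially"
        unfolding Z_def
      proof (rule uniform_limit_on_subset[OF picard_uniform_limit[OF \<tau>, where R = "norm \<mu>0 + 1"]])
        show "(\<lambda>\<mu>. (x, \<mu>)) ` cball \<mu>0 1 \<subseteq> {0..1} \<times> cball 0 (norm \<mu>0 + 1)"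
        proof -
          have "norm \<mu> \<le> norm \<mu>0 + 1" if "dist \<mu>0 \<mu> \<le> 1" for \<mu>
            using that norm_triangle_sub[of \<mu> \<mu>0] by (simp add: dist_norm norm_minus_commute)
          then show ?thesis using x by auto
        qed
      qed
      then have "uniform_limit (cball \<mu>0 1) (\<lambda>n \<mu>. \<Sum>k<n. picard \<tau> (a, b) k \<mu> x) (\<lambda>\<mu>. Z \<mu> x) sequentially"
        unfolding uniform_limit_iff by simp
      from bounded_linear.uniform_limit[OF bounded_linear_compose[OF bounded_linear_vec_nth
            bounded_linear_compose[OF bounded_linear_vec_nth bounded_linear_fst]] this, of i j]
      have "uniform_limit (cball \<mu>0 1) (\<lambda>n \<mu>. \<Sum>k<n. fst (picard \<tau> (a, b) k \<mu> x) $ i $ j)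
          (\<lambda>\<mu>. Y \<mu> x $ i $ j) sequentially"
        by (simp add: Y_def fst_sum)
      then show "\<exists>d>0. cball \<mu>0 d \<subseteq> UNIV \<and> uniform_limit (cball \<mu>0 d)
          (\<lambda>n \<mu>. \<Sum>k<n. fst (picard \<tau> (a, b) k \<mu> x) $ i $ j) (\<lambda>\<mu>. Y \<mu> x $ i $ j) sequentially"
        by (intro exI[of _ 1]) auto
    qed simp
  qed
qed

section \<open>Adjoints and inverses of matrices\<close>

lemma mat_adj_nth [simp]: "mat_adj A $ i $ j = cnj (A $ j $ i)"
  by (simp add: mat_adj_def)

lemma mat_adj_mat_adj [simp]: "mat_adj (mat_adj A) = A"
  by (simp add: vec_eq_iff)

lemma mat_adj_mult: "mat_adj (A ** B) = mat_adj B ** mat_adj A"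
  by (simp add: vec_eq_iff matrix_matrix_mult_def mult.commute)

lemma mat_adj_add: "mat_adj (A + B) = mat_adj A + mat_adj B"
  by (simp add: vec_eq_iff)

lemma mat_adj_diff: "mat_adj (A - B) = mat_adj A - mat_adj B"
  by (simp add: vec_eq_iff)

lemma mat_adj_minus: "mat_adj (- A) = - mat_adj A"
  by (simp add: vec_eq_iff)

lemma mat_adj_scaleR: "mat_adj (r *\<^sub>R A) = r *\<^sub>R mat_adj A"
  by (simp add: vec_eq_iff)

lemma mat_adj_one [simp]: "mat_adj (mat 1) = mat 1"
  by (simp add: vec_eq_iff) (simp add: mat_def)

lemma bounded_linear_mat_adj: "bounded_linear (mat_adj :: complex^'n^'m \<Rightarrow> complex^'m^'n)"
proof (intro linear_conv_bounded_linear[THEN iffD1] linearI)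
qed (simp_all add: mat_adj_add mat_adj_scaleR)

lemma cinner_mat_adj: "cinner (A *v v) w = cinner v (mat_adj A *v w)"
proof -
  have "cinner (A *v v) w = (\<Sum>i\<in>UNIV. \<Sum>j\<in>UNIV. A $ i $ j * v $ j * cnj (w $ i))"
    by (simp add: cinner_def matrix_vector_mult_def sum_distrib_right)
  also have "\<dots> = (\<Sum>j\<in>UNIV. \<Sum>i\<in>UNIV. A $ i $ j * v $ j * cnj (w $ i))"
    by (rule sum.swap)
  also have "\<dots> = cinner v (mat_adj A *v w)"
    by (simp add: cinner_def matrix_vector_mult_def sum_distrib_left mult_ac)
  finally show ?thesis .
qed

lemma cinner_diff_left: "cinner (u - v) w = cinner u w - cinner v w"
  by (simp add: cinner_def sum_subtractf algebra_simps)

lemma cinner_minus_right: "cinner v (- w) = - cinner v w"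
  by (simp add: cinner_def sum_negf)

lemma cinner_diff_right: "cinner u (v - w) = cinner u v - cinner u w"
  by (simp add: cinner_def sum_subtractf algebra_simps)

lemma cinner_commute: "cinner v w = cnj (cinner w v)"
  by (simp add: cinner_def mult.commute)

lemma cinner_self: "cinner v v = of_real (\<Sum>i\<in>UNIV. (cmod (v $ i))\<^sup>2)"
  by (simp add: cinner_def complex_norm_square[symmetric])

lemma cinner_self_nonneg: "0 \<le> Re (cinner v v)"
  by (simp add: cinner_self sum_nonneg)

lemma cinner_self_pos: "v \<noteq> 0 \<Longrightarrow> 0 < Re (cinner v v)"
proof -
  assume "v \<noteq> 0"
  then obtain i where "v $ i \<noteq> 0" by (auto simp: vec_eq_iff)
  then have "0 < (\<Sum>i\<in>UNIV. (cmod (v $ i))\<^sup>2)"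
    by (intro sum_pos2[of _ i]) auto
  then show ?thesis by (simp add: cinner_self)
qed

lemma matrix_mult_inv:
  fixes A B :: "complex^'n^'n" assumes "A ** B = mat 1"
  shows "matrix_inv A = B" "matrix_inv B = A" "invertible A" "invertible B" "B ** A = mat 1"
proof -
  show BA: "B ** A = mat 1" using assms by (simp add: matrix_left_right_inverse)
  have u: "matrix_inv A = B" if "A ** B = mat 1" "B ** A = mat 1" for A B :: "complex^'n^'n"
  proof -
    have "A ** matrix_inv A = mat 1 \<and> matrix_inv A ** A = mat 1"
      unfolding matrix_inv_def by (rule someI[of _ B]) (use that in auto)
    then show ?thesis by (metis matrix_mul_assoc matrix_mul_lid matrix_mul_rid that(1))
  qed
  show "matrix_inv A = B" "matrix_inv B = A" using u assms BA by auto
  show "invertible A" "invertible B" using assms BA by (auto simp: invertible_def)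
qed

lemma matrix_inv_mult_self:
  fixes A :: "complex^'n^'n" assumes "invertible A"
  shows "A ** matrix_inv A = mat 1" "matrix_inv A ** A = mat 1"
  using assms matrix_mult_inv unfolding invertible_def by metis+

lemma invertibleI_kernel:
  fixes A :: "complex^'n^'n" assumes "\<And>v. A *v v = 0 \<Longrightarrow> v = 0"
  shows "invertible A"
  using assms matrix_left_invertible_ker[of A] invertible_left_inverse by blast

lemma det_holomorphic:
  fixes A :: "complex \<Rightarrow> complex^'n^'n"
  assumes "\<And>i j. (\<lambda>z. A z $ i $ j) holomorphic_on S"
  shows "(\<lambda>z. det (A z)) holomorphic_on S"
  unfolding det_def using assms
  by (intro holomorphic_on_sum holomorphic_on_mult holomorphic_on_prod holomorphic_on_const) auto

lemma matrix_inv_entry: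
  fixes A :: "complex^'n^'n" assumes "det A \<noteq> 0"
  shows "matrix_inv A $ i $ j = det (\<chi> a c. if c = i then axis j 1 $ a else A $ a $ c) / det A"
proof -
  have "A ** matrix_inv A = mat 1"
    using assms by (intro matrix_inv_mult_self) (simp add: invertible_det_nz)
  then have "A *v (matrix_inv A *v axis j 1) = axis j 1"
    by (simp add: matrix_vector_mul_assoc)
  then have "matrix_inv A *v axis j 1 =
      (\<chi> k. det (\<chi> a c. if c = k then axis j 1 $ a else A $ a $ c) / det A)"
    using cramer[OF assms] by simp
  moreover have "(matrix_inv A *v axis j 1) $ i = matrix_inv A $ i $ j"
    by (simp add: matrix_vector_mult_def axis_def if_distrib sum.delta cong: if_cong)
  ultimately show ?thesis by simp
qed

lemma matrix_inv_holomorphic: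
  fixes A :: "complex \<Rightarrow> complex^'n^'n"
  assumes A: "\<And>i j. (\<lambda>z. A z $ i $ j) holomorphic_on S" and nz: "\<And>z. z \<in> S \<Longrightarrow> det (A z) \<noteq> 0"
  shows "(\<lambda>z. matrix_inv (A z) $ i $ j) holomorphic_on S"
proof -
  have "(\<lambda>z. det (\<chi> a c. if c = i then axis j 1 $ a else A z $ a $ c) / det (A z)) holomorphic_on S"
  proof (intro holomorphic_on_divide det_holomorphic A nz)
    show "(\<lambda>z. (\<chi> a c. if c = i then axis j 1 $ a else A z $ a $ c) $ a $ c) holomorphic_on S" for a c
      by (cases "c = i") (simp_all add: A)
  qed
  then show ?thesis
    by (rule holomorphic_transform) (simp add: matrix_inv_entry nz)
qed

lemma matrix_mult_holomorphic:
  fixes A B :: "complex \<Rightarrow> complex^'n^'n"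
  assumes "\<And>i j. (\<lambda>z. A z $ i $ j) holomorphic_on S" "\<And>i j. (\<lambda>z. B z $ i $ j) holomorphic_on S"
  shows "(\<lambda>z. (A z ** B z) $ i $ j) holomorphic_on S"
  using assms unfolding matrix_matrix_mult_def by (auto intro!: holomorphic_intros)

section \<open>The solutions in the definition of the Weyl function\<close>

lemma acder_continuous_rhs:
  fixes act :: "complex^'n^'n \<Rightarrow> 'v::euclidean_space \<Rightarrow> 'v"
  assumes "bounded_bilinear act" "\<tau> \<in> L2" "continuous_on {0..1} y" "continuous_on {0..1} h"
  shows "(\<lambda>x. act (\<tau> x) (y x) + h x) \<in> L2"
  by (intro L2_add L2_bilinear_continuous[OF assms(1-3)] L2_continuous assms)

lemma sys_iff_W21:
  fixes act :: "complex^'n^'n \<Rightarrow> 'v::euclidean_space \<Rightarrow> 'v"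
  assumes act: "bounded_bilinear act" and \<tau>: "\<tau> \<in> L2"
  shows "sys act \<tau> \<mu> y h \<longleftrightarrow> y \<in> W21 \<and> h \<in> W21 \<and>
     (h \<approx> (\<lambda>x. wderiv y x - act (\<tau> x) (y x))) \<and>
     ((\<lambda>x. - (wderiv h x + act (\<tau> x) (h x))) \<approx> (\<lambda>x. act (mat \<mu>) (y x)))"
    (is "_ \<longleftrightarrow> ?R")
proof
  assume s: "sys act \<tau> \<mu> y h"
  then have y: "acder y (\<lambda>x. act (\<tau> x) (y x) + h x)"
    and h: "acder h (\<lambda>x. - act (\<tau> x) (h x) - act (mat \<mu>) (y x))"
    by (auto simp: sys_def)
  have cy: "continuous_on {0..1} y" and ch: "continuous_on {0..1} h"
    using y h acder_continuous by auto
  have cm: "continuous_on {0..1} (\<lambda>x. act (mat \<mu>) (y x))"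
    by (intro bounded_bilinear.continuous_on[OF act] continuous_on_const cy)
  have 1: "(\<lambda>x. act (\<tau> x) (y x) + h x) \<in> L2"
    by (intro acder_continuous_rhs assms cy ch)
  have 2: "(\<lambda>x. - act (\<tau> x) (h x) - act (mat \<mu>) (y x)) \<in> L2"
    by (rule L2_diff[OF L2_minus[OF L2_bilinear_continuous[OF act \<tau> ch]] L2_continuous[OF cm]])
  show ?R
  proof (intro conjI)
    show "y \<in> W21" "h \<in> W21"
      using W21I(1)[OF y 1] W21I(1)[OF h 2] by auto
    show "h \<approx> (\<lambda>x. wderiv y x - act (\<tau> x) (y x))"
      using W21I(2)[OF y 1] unfolding ae_eq_def by (rule AE_mp) (auto intro!: AE_I2)
    show "(\<lambda>x. - (wderiv h x + act (\<tau> x) (h x))) \<approx> (\<lambda>x. act (mat \<mu>) (y x))"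
      using W21I(2)[OF h 2] unfolding ae_eq_def by (rule AE_mp) (auto intro!: AE_I2)
  qed
next
  assume R: ?R
  then have "AE x in unit_int. h x = wderiv y x - act (\<tau> x) (y x)"
    by (simp add: ae_eq_def)
  then have "wderiv y \<approx> (\<lambda>x. act (\<tau> x) (y x) + h x)"
    unfolding ae_eq_def by (rule AE_mp) (auto intro!: AE_I2)
  moreover from R have "AE x in unit_int. - (wderiv h x + act (\<tau> x) (h x)) = act (mat \<mu>) (y x)"
    by (simp add: ae_eq_def)
  then have "wderiv h \<approx> (\<lambda>x. - act (\<tau> x) (h x) - act (mat \<mu>) (y x))"
    unfolding ae_eq_def
  proof (rule AE_mp, intro AE_I2 impI)
    fix x assume "- (wderiv h x + act (\<tau> x) (h x)) = act (mat \<mu>) (y x)"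
    then show "wderiv h x = - act (\<tau> x) (h x) - act (mat \<mu>) (y x)"
      by (simp flip: \<open>- (wderiv h x + act (\<tau> x) (h x)) = act (mat \<mu>) (y x)\<close>)
  qed
  ultimately show "sys act \<tau> \<mu> y h"
    unfolding sys_def using R
    by (intro conjI acder_cong[OF W21D(2)[of y]] acder_cong[OF W21D(2)[of h]]) auto
qed

lemma is_phi_iff:
  assumes "\<tau> \<in> L2"
  shows "is_phi \<tau> l y \<longleftrightarrow> (\<exists>h. sys (**) \<tau> (l\<^sup>2) y h \<and> y 0 = 0 \<and> h 0 = mat l)"
  unfolding is_phi_def sys_iff_W21[OF bounded_bilinear_matrix_mult assms] by blast

lemma is_psi_minus_iff:
  assumes "\<tau> \<in> L2"
  shows "is_psi (\<lambda>x. - \<tau> x) l y \<longleftrightarrow> (\<exists>h. sys (**) \<tau> (l\<^sup>2) y h \<and> y 0 = mat 1 \<and> h 0 = 0)"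
  unfolding is_psi_def sys_iff_W21[OF bounded_bilinear_matrix_mult assms]
  by (simp add: matrix_mult_minus_left) blast

lemma phi_eq:
  assumes \<tau>: "\<tau> \<in> L2" and s: "sys (**) \<tau> (l\<^sup>2) y h" and i: "y 0 = 0" "h 0 = mat l" and x: "x \<in> {0..1}"
  shows "phi x l \<tau> = y x"
proof -
  let ?y = "SOME y. is_phi \<tau> l y"
  have "is_phi \<tau> l y"
    unfolding is_phi_iff[OF \<tau>] using s i by blast
  then have "is_phi \<tau> l ?y" by (rule someI[of "is_phi \<tau> l"])
  then obtain h' where h': "sys (**) \<tau> (l\<^sup>2) ?y h'" "?y 0 = 0" "h' 0 = mat l"
    unfolding is_phi_iff[OF \<tau>] by blast
  have "?y x = y x"
    by (rule sys_unique(1)[OF \<tau> h'(1) s _ _ x]) (simp_all only: h' i)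
  then show ?thesis by (simp only: phi_def)
qed

lemma psi_minus_eq:
  assumes \<tau>: "\<tau> \<in> L2" and s: "sys (**) \<tau> (l\<^sup>2) y h" and i: "y 0 = mat 1" "h 0 = 0" and x: "x \<in> {0..1}"
  shows "psi x l (\<lambda>x. - \<tau> x) = y x"
proof -
  let ?y = "SOME y. is_psi (\<lambda>x. - \<tau> x) l y"
  have "is_psi (\<lambda>x. - \<tau> x) l y"
    unfolding is_psi_minus_iff[OF \<tau>] using s i by blast
  then have "is_psi (\<lambda>x. - \<tau> x) l ?y" by (rule someI[of "is_psi (\<lambda>x. - \<tau> x) l"])
  then obtain h' where h': "sys (**) \<tau> (l\<^sup>2) ?y h'" "?y 0 = mat 1" "h' 0 = 0"
    unfolding is_psi_minus_iff[OF \<tau>] by blast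
  have "?y x = y x"
    by (rule sys_unique(1)[OF \<tau> h'(1) s _ _ x]) (simp_all only: h' i)
  then show ?thesis by (simp only: psi_def)
qed

lemma sys_add:
  assumes "bounded_bilinear act" "sys act \<tau> \<mu> y h" "sys act \<tau> \<mu> y' h'"
  shows "sys act \<tau> \<mu> (\<lambda>x. y x + y' x) (\<lambda>x. h x + h' x)"
proof -
  note a = assms(2,3)[unfolded sys_def]
  note [simp] = bounded_bilinear.add_right[OF assms(1)]
  show ?thesis
    unfolding sys_def
    by (intro conjI acder_cong[OF acder_add[OF conjunct1[OF a(1)] conjunct1[OF a(2)]]]
        acder_cong[OF acder_add[OF conjunct2[OF a(1)] conjunct2[OF a(2)]]] ae_eqI)
      (simp_all add: algebra_simps)
qed

lemma sys_mult_right: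
  assumes "sys (**) \<tau> \<mu> y h"
  shows "sys (**) \<tau> \<mu> (\<lambda>x. y x ** C) (\<lambda>x. h x ** C)"
proof -
  note a = assms[unfolded sys_def]
  note b = bounded_bilinear.bounded_linear_left[OF bounded_bilinear_matrix_mult, of C]
  show ?thesis
    unfolding sys_def
    by (intro conjI acder_cong[OF acder_linear[OF conjunct1[OF a] b]]
        acder_cong[OF acder_linear[OF conjunct2[OF a] b]] ae_eqI)
      (simp_all add: bounded_bilinear.add_left[OF bounded_bilinear_matrix_mult] matrix_mult_diff_left matrix_mult_minus_left matrix_mul_assoc)
qed

lemma continuous_ae_zero:
  fixes f :: "real \<Rightarrow> 'a::euclidean_space"
  assumes "continuous_on {0..1} f" "f \<approx> (\<lambda>_. 0)" "x \<in> {0..1}"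
  shows "f x = 0"
proof -
  have n: "negligible {x \<in> {0..1}. f x \<noteq> 0}"
    using assms(2) by (simp add: ae_eq_iff_negligible)
  have "integral {0..1} (\<lambda>x. norm (f x)) = integral {0..1} (\<lambda>x::real. 0 :: real)"
    by (rule integral_spike[OF n]) auto
  then have "\<forall>x\<in>{0..1}. norm (f x) = 0"
    using integral_eq_0_iff[of 0 1 "\<lambda>x. norm (f x)"] assms(1) by (simp add: continuous_on_norm)
  then show ?thesis using assms(3) by simp
qed

section \<open>Potentials related by a Riccati equation\<close>

text \<open>
  \<open>gauge_rel \<tau> \<tau>' S\<close>: the difference \<open>\<tau>' - \<tau>\<close> has the absolutely continuous representative \<open>S\<close>, with
  \<open>S' = \<tau>\<^sup>2 - \<tau>'\<^sup>2\<close>; this is the equality of the Miura images \<open>b(\<tau>)\<close> and \<open>b(\<tau>')\<close> with the distributional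
  derivatives moved to one side.
\<close>

definition gauge_rel ::
    "(real \<Rightarrow> complex^'n^'n) \<Rightarrow> (real \<Rightarrow> complex^'n^'n) \<Rightarrow> (real \<Rightarrow> complex^'n^'n) \<Rightarrow> bool" where
  "gauge_rel \<tau> \<tau>' S \<longleftrightarrow> \<tau> \<in> L2 \<and> \<tau>' \<in> L2 \<and> (S \<approx> (\<lambda>x. \<tau>' x - \<tau> x)) \<and>
     acder S (\<lambda>x. \<tau> x ** \<tau> x - \<tau>' x ** \<tau>' x)"

lemma gauge_sym:
  assumes "gauge_rel \<tau> \<tau>' S" shows "gauge_rel \<tau>' \<tau> (\<lambda>x. - S x)"
proof -
  have "acder (\<lambda>x. - S x) (\<lambda>x. - (\<tau> x ** \<tau> x - \<tau>' x ** \<tau>' x))"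
    using assms unfolding gauge_rel_def by (intro acder_minus) simp
  moreover have "(\<lambda>x. - S x) \<approx> (\<lambda>x. \<tau> x - \<tau>' x)"
    using assms unfolding gauge_rel_def ae_eq_def
    by (elim conjE) (erule AE_mp, auto intro!: AE_I2)
  ultimately show ?thesis using assms by (simp add: gauge_rel_def)
qed

text \<open>
  A solution \<open>y\<close> for \<open>\<tau>\<close> is a solution for \<open>\<tau>'\<close>, with quasi-derivative \<open>y' - \<tau>' y = h - S y\<close>.
\<close>

lemma sys_gauge:
  fixes act :: "complex^'n^'n \<Rightarrow> 'v::euclidean_space \<Rightarrow> 'v"
  assumes act: "bounded_bilinear act" and assoc: "\<And>A B v. act (A ** B) v = act A (act B v)"
    and g: "gauge_rel \<tau> \<tau>' S" and s: "sys act \<tau> \<mu> y h"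
  shows "sys act \<tau>' \<mu> y (\<lambda>x. h x - act (S x) (y x))"
proof -
  interpret act: bounded_bilinear act by fact
  have S: "acder S (\<lambda>x. \<tau> x ** \<tau> x - \<tau>' x ** \<tau>' x)"
    and ae: "AE x in unit_int. S x = \<tau>' x - \<tau> x"
    using g by (auto simp: gauge_rel_def ae_eq_def)
  have y: "acder y (\<lambda>x. act (\<tau> x) (y x) + h x)"
    and h: "acder h (\<lambda>x. - act (\<tau> x) (h x) - act (mat \<mu>) (y x))"
    using s by (auto simp: sys_def)
  show ?thesis
    unfolding sys_def
  proof (intro conjI)
    show "acder y (\<lambda>x. act (\<tau>' x) (y x) + (h x - act (S x) (y x)))"
    proof (rule acder_cong[OF y refl])
      show "(\<lambda>x. act (\<tau> x) (y x) + h x) \<approx> (\<lambda>x. act (\<tau>' x) (y x) + (h x - act (S x) (y x)))"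
        unfolding ae_eq_def using ae by (rule AE_mp) (auto intro!: AE_I2 simp: act.diff_left)
    qed
    note hs = acder_diff[OF h acder_bilinear[OF act S y]]
    show "acder (\<lambda>x. h x - act (S x) (y x))
        (\<lambda>x. - act (\<tau>' x) (h x - act (S x) (y x)) - act (mat \<mu>) (y x))"
      by (rule acder_cong[OF hs refl], unfold ae_eq_def, rule AE_mp[OF ae])
        (auto intro!: AE_I2 simp: act.diff_left act.diff_right act.add_right assoc)
  qed
qed

lemma weyl_eq:
  assumes \<tau>: "\<tau> \<in> L2" and p: "sys (**) \<tau> (l\<^sup>2) p hp" "p 0 = 0" "hp 0 = mat 1"
    and q: "sys (**) \<tau> (l\<^sup>2) q hq" "q 0 = mat 1" "hq 0 = 0"
    and l: "l \<noteq> 0" and inv: "invertible (p 1)"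
  shows "weyl \<tau> l = - (mat (1 / l) ** (matrix_inv (p 1) ** q 1))"
proof -
  have "phi 1 l \<tau> = p 1 ** mat l"
    by (rule phi_eq[OF \<tau> sys_mult_right[OF p(1)]]) (use p in simp_all)
  moreover have "psi 1 l (\<lambda>x. - \<tau> x) = q 1"
    by (rule psi_minus_eq[OF \<tau> q]) simp
  moreover have "(p 1 ** mat l) ** (mat (1 / l) ** matrix_inv (p 1)) = mat 1"
  proof -
    have "(p 1 ** mat l) ** (mat (1 / l) ** matrix_inv (p 1)) = p 1 ** ((mat l ** mat (1 / l)) ** matrix_inv (p 1))"
      by (simp add: matrix_mul_assoc)
    also have "\<dots> = mat 1"
      using l by (simp add: mat_mult_mat matrix_inv_mult_self[OF inv])
    finally show ?thesis .
  qed
  then have "matrix_inv (p 1 ** mat l) = mat (1 / l) ** matrix_inv (p 1)"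
    by (rule matrix_mult_inv)
  ultimately show ?thesis by (simp add: weyl_def matrix_mul_assoc)
qed

text \<open>
  Since \<open>p\<close> vanishes at 0, it has the same initial data for both potentials, whereas \<open>q\<close> acquires the
  quasi-derivative \<open>- S(0)\<close> at 0, which is compensated by adding \<open>p S(0)\<close>.
\<close>

lemma weyl_gauge:
  assumes g: "gauge_rel \<tau> \<tau>' S" and p: "sys (**) \<tau> (l\<^sup>2) p hp" "p 0 = 0" "hp 0 = mat 1"
    and l: "l \<noteq> 0" and inv: "invertible (p 1)"
  shows "weyl \<tau>' l = weyl \<tau> l - mat (1 / l) ** S 0"
proof -
  have \<tau>: "\<tau> \<in> L2" "\<tau>' \<in> L2" using g by (auto simp: gauge_rel_def)
  obtain Q HQ where Q: "\<And>\<mu>. sys (**) \<tau> \<mu> (Q \<mu>) (HQ \<mu>)" "\<And>\<mu>. Q \<mu> 0 = mat 1" "\<And>\<mu>. HQ \<mu> 0 = 0"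
    by (rule sys_solution[OF \<tau>(1), of "mat 1" 0]) blast
  define q hq where "q = Q (l\<^sup>2)" and "hq = HQ (l\<^sup>2)"
  have q: "sys (**) \<tau> (l\<^sup>2) q hq" "q 0 = mat 1" "hq 0 = 0"
    using Q by (auto simp: q_def hq_def)
  note sg = sys_gauge[OF bounded_bilinear_matrix_mult matrix_mul_assoc[symmetric] g]
  note q' = sys_add[OF bounded_bilinear_matrix_mult sg[OF q(1)] sys_mult_right[OF sg[OF p(1)], of "S 0"]]
  have "weyl \<tau>' l = - (mat (1 / l) ** (matrix_inv (p 1) ** (q 1 + p 1 ** S 0)))"
    by (rule weyl_eq[OF \<tau>(2) sg[OF p(1)] _ _ q' _ _ l inv]) (simp_all add: p q)
  also have "matrix_inv (p 1) ** (q 1 + p 1 ** S 0) = matrix_inv (p 1) ** q 1 + S 0"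
    by (simp add: matrix_add_ldistrib matrix_mul_assoc matrix_inv_mult_self[OF inv])
  also have "- (mat (1 / l) ** (matrix_inv (p 1) ** q 1 + S 0)) = weyl \<tau> l - mat (1 / l) ** S 0"
    by (simp add: weyl_eq[OF \<tau>(1) p q l inv] matrix_add_ldistrib)
  finally show ?thesis .
qed

section \<open>Zero energy\<close>

text \<open>
  The adjoint of \<open>H\<close> is the inverse of \<open>E\<close> because \<open>(H\<^sup>* E)' = 0\<close>.  Both \<open>E\<close> and \<open>H\<close> are second
  components of solutions of the system for \<open>\<mu> = 0\<close>, where the equation for \<open>h\<close> decouples.
\<close>

lemma zero_energy:
  assumes \<tau>: "\<tau> \<in> ReL2"
  obtains E H where "acder E (\<lambda>x. \<tau> x ** E x)" "E 0 = mat 1"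
    "acder H (\<lambda>x. - (\<tau> x ** H x))" "H 0 = mat 1"
    "\<And>x. x \<in> {0..1} \<Longrightarrow> mat_adj (H x) ** E x = mat 1"
proof -
  have L: "\<tau> \<in> L2" and adj: "AE x in unit_int. \<tau> x = mat_adj (\<tau> x)"
    using \<tau> by (auto simp: ReL2_def ae_eq_def)
  have m0: "mat 0 ** A = 0" for A :: "complex^'a^'a"
    by (simp add: vec_eq_iff)
  \<comment> \<open>The quasi-derivative for the potential \<open>- \<tau>\<close> at \<open>\<mu> = 0\<close> satisfies \<open>K' = \<tau> K\<close>.\<close>
  obtain Y K where Y: "\<And>\<mu>. sys (**) (\<lambda>x. - \<tau> x) \<mu> (Y \<mu>) (K \<mu>)" "\<And>\<mu>. K \<mu> 0 = mat 1"
    by (rule sys_solution[OF L2_minus[OF L], of 0 "mat 1"]) blast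
  obtain Z H where Z: "\<And>\<mu>. sys (**) \<tau> \<mu> (Z \<mu>) (H \<mu>)" "\<And>\<mu>. H \<mu> 0 = mat 1"
    by (rule sys_solution[OF L, of 0 "mat 1"]) blast
  have E: "acder (K 0) (\<lambda>x. \<tau> x ** K 0 x)"
    using Y(1)[of 0] by (simp add: sys_def m0 matrix_mult_minus_left)
  have H: "acder (H 0) (\<lambda>x. - (\<tau> x ** H 0 x))"
    using Z(1)[of 0] by (simp add: sys_def m0)
  note HE = acder_mult[OF acder_linear[OF H bounded_linear_mat_adj] E]
  have "mat_adj (H 0 x) ** K 0 x = mat 1" if x: "x \<in> {0..1}" for x
  proof -
    have "mat_adj (H 0 x) ** K 0 x = mat_adj (H 0 0) ** K 0 0"
      by (rule acder_zero_const[OF HE _ x], unfold ae_eq_def, rule AE_mp[OF adj], intro AE_I2 impI)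
        (simp add: mat_adj_minus mat_adj_mult matrix_mult_minus_left matrix_mul_assoc)
    then show ?thesis by (simp add: Y Z)
  qed
  with that[OF E _ H] Y(2) Z(2) show ?thesis by blast
qed

text \<open>
  The Gram matrix of the columns of \<open>H\<close> on \<open>[0, x]\<close>.
\<close>

definition gram :: "(real \<Rightarrow> complex^'n^'n) \<Rightarrow> real \<Rightarrow> complex^'n^'n" where
  "gram H x = integral {0..x} (\<lambda>s. mat_adj (H s) ** H s)"

text \<open>
  The (real part of the) quadratic form of a matrix.
\<close>

definition qform :: "complex^'n \<Rightarrow> complex^'n^'n \<Rightarrow> real" where
  "qform v A = Re (cinner (A *v v) v)"

lemma bounded_linear_qform: "bounded_linear (qform v)"
proof (intro linear_conv_bounded_linear[THEN iffD1] linearI)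
qed (simp_all add: qform_def cinner_def matrix_vector_mult_def sum.distrib algebra_simps
    sum_distrib_left scaleR_sum_right)

lemma qform_gram_integrand: "qform v (mat_adj A ** A) = Re (cinner (A *v v) (A *v v))"
  by (simp add: qform_def matrix_vector_mul_assoc[symmetric] cinner_mat_adj)

lemma
  fixes H :: "real \<Rightarrow> complex^'n^'n"
  assumes H: "continuous_on {0..1} H"
  shows gram_continuous: "continuous_on {0..1} (\<lambda>s. mat_adj (H s) ** H s)"
    and gram_acder: "acder (gram H) (\<lambda>s. mat_adj (H s) ** H s)"
    and gram_0: "gram H 0 = 0"
    and gram_adj: "x \<in> {0..1} \<Longrightarrow> mat_adj (gram H x) = gram H x"
    and gram_qform: "x \<in> {0..1} \<Longrightarrow>
      ((\<lambda>s. Re (cinner (H s *v v) (H s *v v))) has_integral qform v (gram H x)) {0..x}"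
proof -
  show c: "continuous_on {0..1} (\<lambda>s. mat_adj (H s) ** H s)"
    by (intro bounded_bilinear.continuous_on[OF bounded_bilinear_matrix_mult] H
        bounded_linear.continuous_on[OF bounded_linear_mat_adj])
  show a: "acder (gram H) (\<lambda>s. mat_adj (H s) ** H s)"
    using acderI_integral[OF absolutely_integrable_continuous_real[OF c], of 0]
    unfolding gram_def[abs_def] by simp
  show 0: "gram H 0 = 0" by (simp add: gram_def)
  assume x: "x \<in> {0..1}"
  have i: "((\<lambda>s. mat_adj (H s) ** H s) has_integral gram H x) {0..x}"
    using a x 0 by (auto simp: acder_def)
  show "mat_adj (gram H x) = gram H x"
    using has_integral_linear[OF i bounded_linear_mat_adj] i
    by (intro has_integral_unique) (auto simp: o_def mat_adj_mult)
  show "((\<lambda>s. Re (cinner (H s *v v) (H s *v v))) has_integral qform v (gram H x)) {0..x}"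
    using has_integral_linear[OF i bounded_linear_qform[of v]] by (simp add: o_def qform_gram_integrand)
qed

lemma gram_mono:
  fixes H :: "real \<Rightarrow> complex^'n^'n"
  assumes H: "continuous_on {0..1} H" and "0 \<le> x" "x \<le> y" "y \<le> 1"
  shows "qform v (gram H x) \<le> qform v (gram H y)"
  using gram_qform[OF H, of x v] gram_qform[OF H, of y v] assms(2-)
  by (intro has_integral_subset_le[of "{0..x}" "{0..y}"]) (auto simp: cinner_self_nonneg)

lemma gram_pos:
  fixes H :: "real \<Rightarrow> complex^'n^'n"
  assumes H: "continuous_on {0..1} H" "H 0 = mat 1" and x: "0 < x" "x \<le> 1" and v: "v \<noteq> 0"
  shows "0 < qform v (gram H x)"
proof -
  let ?f = "\<lambda>s. Re (cinner (H s *v v) (H s *v v))"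
  have i: "(?f has_integral qform v (gram H x)) {0..x}"
    using gram_qform[OF H(1)] x by simp
  have "continuous_on {0..1} (\<lambda>s. qform v (mat_adj (H s) ** H s))"
    by (rule bounded_linear.continuous_on[OF bounded_linear_qform gram_continuous[OF H(1)]])
  then have c: "continuous_on {0..x} ?f"
    unfolding qform_gram_integrand by (rule continuous_on_subset) (use x in auto)
  have "integral {0..x} ?f \<noteq> 0"
  proof
    assume "integral {0..x} ?f = 0"
    then have "\<forall>s\<in>{0..x}. ?f s = 0"
      using integral_eq_0_iff[OF c x(1) cinner_self_nonneg] by blast
    then have "?f 0 = 0" using x(1) by simp
    then show False using cinner_self_pos[OF v] by (simp add: H(2))
  qed
  moreover have "0 \<le> integral {0..x} ?f"
    by (rule integral_nonneg[OF has_integral_integrable[OF i]]) (rule cinner_self_nonneg)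
  ultimately show ?thesis using i by (simp add: integral_unique)
qed

lemma gram_invertible:
  fixes H :: "real \<Rightarrow> complex^'n^'n"
  assumes "continuous_on {0..1} H" "H 0 = mat 1"
  shows "invertible (gram H 1)"
proof (rule invertibleI_kernel, rule ccontr)
  fix v assume "gram H 1 *v v = 0" "v \<noteq> 0"
  then show False using gram_pos[OF assms, of 1 v] by (simp add: qform_def cinner_def)
qed

lemma pos_def_inv_gram:
  fixes H :: "real \<Rightarrow> complex^'n^'n"
  assumes H: "continuous_on {0..1} H" "H 0 = mat 1"
  shows "pos_def ((1/2) *\<^sub>R matrix_inv (gram H 1))"
proof -
  let ?G = "gram H 1" and ?J = "matrix_inv (gram H 1)"
  note inv = matrix_inv_mult_self[OF gram_invertible[OF H]]
  have adjG: "mat_adj ?G = ?G" using gram_adj[OF H(1)] by simp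
  have "?G ** mat_adj ?J = mat 1"
    by (metis adjG inv(2) mat_adj_mult mat_adj_one)
  then have adjJ: "mat_adj ?J = ?J" using matrix_mult_inv(1) by metis
  have "0 < Re (cinner (?J *v v) v)" if v: "v \<noteq> 0" for v
  proof -
    define w where "w = ?J *v v"
    have vw: "v = ?G *v w"
      by (simp add: w_def matrix_vector_mul_assoc inv)
    then have "w \<noteq> 0" using v by auto
    then have "0 < qform w ?G" using gram_pos[OF H, of 1 w] by simp
    also have "qform w ?G = Re (cinner w v)"
      unfolding qform_def cinner_mat_adj adjG vw ..
    finally show ?thesis by (simp add: w_def)
  qed
  moreover have "Re (cinner (((1/2) *\<^sub>R ?J) *v v) v) = (1/2) * Re (cinner (?J *v v) v)" for v
    using linear_scale[OF bounded_linear.linear[OF bounded_linear_qform[of v]], of "1/2" ?J]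
    by (simp add: qform_def)
  ultimately have "0 < Re (cinner (((1/2) *\<^sub>R ?J) *v v) v)" if "v \<noteq> 0" for v
    using that by (metis half_gt_zero mult.commute mult_numeral_1_right times_divide_eq_right mult_1)
  then show ?thesis by (simp add: pos_def_def mat_adj_scaleR adjJ)
qed

lemma mat_zero_mult [simp]: "mat 0 ** A = 0" for A :: "complex^'b^'a"
  by (simp add: vec_eq_iff)

lemma holomorphic_on_square_arg:
  assumes "f holomorphic_on UNIV" shows "(\<lambda>l::complex. f (l\<^sup>2)) holomorphic_on UNIV"
  using holomorphic_on_compose_gen[of "\<lambda>l. l\<^sup>2" UNIV f UNIV] assms
  by (simp add: o_def holomorphic_on_power)

text \<open>
  At zero energy the solution with initial data \<open>(0, 1)\<close> is \<open>E G\<close>, where \<open>G\<close> is the Gram matrix of \<open>H\<close>.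
\<close>

lemma sys_zero_energy:
  fixes \<tau> E H :: "real \<Rightarrow> complex^'n^'n"
  assumes E: "acder E (\<lambda>x. \<tau> x ** E x)" "E 0 = mat 1"
    and H: "acder H (\<lambda>x. - (\<tau> x ** H x))" "H 0 = mat 1"
    and HE: "\<And>x. x \<in> {0..1} \<Longrightarrow> mat_adj (H x) ** E x = mat 1"
  shows "sys (**) \<tau> 0 (\<lambda>x. E x ** gram H x) H" and "sys (**) \<tau> 0 E (\<lambda>x. 0)"
proof -
  have cH: "continuous_on {0..1} H" by (rule acder_continuous[OF H(1)])
  have "acder (\<lambda>x. E x ** gram H x) (\<lambda>x. \<tau> x ** (E x ** gram H x) + H x)"
  proof (rule acder_cong[OF acder_mult[OF E(1) gram_acder[OF cH]] refl], rule ae_eqI)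
    fix x :: real assume "x \<in> {0<..<1}"
    then have "E x ** mat_adj (H x) = mat 1"
      using HE[of x] by (simp add: matrix_left_right_inverse)
    then show "\<tau> x ** E x ** gram H x + E x ** (mat_adj (H x) ** H x) = \<tau> x ** (E x ** gram H x) + H x"
      by (simp add: matrix_mul_assoc)
  qed
  then show "sys (**) \<tau> 0 (\<lambda>x. E x ** gram H x) H"
    using H(1) by (simp add: sys_def)
  show "sys (**) \<tau> 0 E (\<lambda>x. 0)"
    using E(1) acder_const[of 0] by (simp add: sys_def)
qed

section \<open>Residues of the Weyl function\<close>

text \<open>
  The determinant of the Dirichlet solution at 1 is an entire function that does not vanish at 0, so its
  zeros are isolated.
\<close>

lemma dirichlet_invertible_eventually:
  fixes P HP :: "complex \<Rightarrow> real \<Rightarrow> complex^'n^'n"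
  assumes \<tau>: "\<tau> \<in> ReL2" and P: "\<And>\<mu>. sys (**) \<tau> \<mu> (P \<mu>) (HP \<mu>)" "\<And>\<mu>. P \<mu> 0 = 0" "\<And>\<mu>. HP \<mu> 0 = mat 1"
    and hol: "\<And>i j. (\<lambda>\<mu>. P \<mu> 1 $ i $ j) holomorphic_on UNIV"
  shows "invertible (P 0 1)" "\<forall>\<^sub>F l in at z. invertible (P (l\<^sup>2) 1)"
    "(\<lambda>l. P (l\<^sup>2) 1 $ i $ j) holomorphic_on UNIV"
proof -
  have L: "\<tau> \<in> L2" using \<tau> by (simp add: ReL2_def)
  obtain E H where EH: "acder E (\<lambda>x. \<tau> x ** E x)" "E 0 = mat 1"
    "acder H (\<lambda>x. - (\<tau> x ** H x))" "H 0 = mat 1"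
    "\<And>x. x \<in> {0..1} \<Longrightarrow> mat_adj (H x) ** E x = mat 1"
    by (rule zero_energy[OF \<tau>]) blast
  note cH = acder_continuous[OF EH(3)]
  have P0: "P 0 1 = E 1 ** gram H 1"
    by (rule sys_unique(1)[OF L P(1) sys_zero_energy(1)[OF EH]]) (simp_all add: P EH gram_0[OF cH])
  have "invertible (E 1)" using matrix_mult_inv(4)[OF EH(5)[of 1]] by simp
  then show inv: "invertible (P 0 1)"
    using gram_invertible[OF cH EH(4)] unfolding P0 by (rule invertible_mult)
  have h2: "(\<lambda>l. P (l\<^sup>2) 1 $ i $ j) holomorphic_on UNIV" for i j
    by (rule holomorphic_on_square_arg[OF hol])
  then show "(\<lambda>l. P (l\<^sup>2) 1 $ i $ j) holomorphic_on UNIV" .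
  have "\<forall>\<^sub>F l in at z. det (P (l\<^sup>2) 1) \<noteq> 0 \<and> l \<in> UNIV"
    by (rule non_zero_neighbour_alt[OF det_holomorphic[OF h2], of _ 0])
      (use inv in \<open>auto simp: invertible_det_nz\<close>)
  then show "\<forall>\<^sub>F l in at z. invertible (P (l\<^sup>2) 1)"
    by (simp add: invertible_det_nz)
qed

lemma norming_zero:
  fixes \<tau> E H :: "real \<Rightarrow> complex^'n^'n"
  assumes \<tau>: "\<tau> \<in> ReL2" and EH: "acder E (\<lambda>x. \<tau> x ** E x)" "E 0 = mat 1"
    "acder H (\<lambda>x. - (\<tau> x ** H x))" "H 0 = mat 1"
    "\<And>x. x \<in> {0..1} \<Longrightarrow> mat_adj (H x) ** E x = mat 1"
  shows "norming \<tau> 0 = (1/2) *\<^sub>R matrix_inv (gram H 1)"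
proof -
  have L: "\<tau> \<in> L2" using \<tau> by (simp add: ReL2_def)
  note cH = acder_continuous[OF EH(3)]
  obtain P HP :: "complex \<Rightarrow> real \<Rightarrow> complex^'n^'n" where P: "\<And>\<mu>. sys (**) \<tau> \<mu> (P \<mu>) (HP \<mu>)" "\<And>\<mu>. P \<mu> 0 = 0" "\<And>\<mu>. HP \<mu> 0 = mat 1"
    "\<And>i j. (\<lambda>\<mu>. P \<mu> 1 $ i $ j) holomorphic_on UNIV"
    by (rule sys_solution[OF L, of 0 "mat 1"]) (metis atLeastAtMost_iff order_refl zero_le_one)
  obtain Q HQ :: "complex \<Rightarrow> real \<Rightarrow> complex^'n^'n" where Q: "\<And>\<mu>. sys (**) \<tau> \<mu> (Q \<mu>) (HQ \<mu>)" "\<And>\<mu>. Q \<mu> 0 = mat 1" "\<And>\<mu>. HQ \<mu> 0 = 0"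
    "\<And>i j. (\<lambda>\<mu>. Q \<mu> 1 $ i $ j) holomorphic_on UNIV"
    by (rule sys_solution[OF L, of "mat 1" 0]) (metis atLeastAtMost_iff order_refl zero_le_one)
  note di = dirichlet_invertible_eventually[OF \<tau> P]
  have P0: "P 0 1 = E 1 ** gram H 1"
    by (rule sys_unique(1)[OF L P(1) sys_zero_energy(1)[OF EH]]) (simp_all add: P EH gram_0[OF cH])
  have Q0: "Q 0 1 = E 1"
    by (rule sys_unique(1)[OF L Q(1) sys_zero_energy(2)[OF EH]]) (simp_all add: Q EH)
  define M where "M = (\<lambda>l. matrix_inv (P (l\<^sup>2) 1) ** Q (l\<^sup>2) 1)"
  have M0: "M 0 = matrix_inv (gram H 1)"
  proof -
    note G = matrix_inv_mult_self[OF gram_invertible[OF cH EH(4)]]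
    have HE: "mat_adj (H 1) ** E 1 = mat 1" "E 1 ** mat_adj (H 1) = mat 1"
      using EH(5)[of 1] by (simp_all add: matrix_left_right_inverse)
    have "(E 1 ** gram H 1) ** (matrix_inv (gram H 1) ** mat_adj (H 1)) = mat 1"
      by (metis G(1) HE(2) matrix_mul_assoc matrix_mul_rid)
    then have "matrix_inv (P 0 1) = matrix_inv (gram H 1) ** mat_adj (H 1)"
      unfolding P0 by (rule matrix_mult_inv)
    then show ?thesis
      by (simp add: M_def Q0 matrix_mul_assoc[symmetric] HE)
  qed
  define S where "S = {l. det (P (l\<^sup>2) 1) \<noteq> 0}"
  have "continuous_on UNIV (\<lambda>l. det (P (l\<^sup>2) 1))"
    by (intro holomorphic_on_imp_continuous_on det_holomorphic di(3))
  then have S: "open S" unfolding S_def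
    by (intro open_Collect_neq continuous_on_const)
  have S0: "0 \<in> S" using di(1) by (simp add: S_def invertible_det_nz)
  have Q2: "(\<lambda>l. Q (l\<^sup>2) 1 $ i $ j) holomorphic_on UNIV" for i j
    by (rule holomorphic_on_square_arg[OF Q(4)])
  have M: "(\<lambda>l. M l $ i $ j) holomorphic_on S" for i j
    unfolding M_def
    by (intro matrix_mult_holomorphic matrix_inv_holomorphic holomorphic_on_subset[OF Q2]
        holomorphic_on_subset[OF di(3)]) (simp_all add: S_def)
  have "residue (\<lambda>l. weyl \<tau> l $ i $ j) 0 = - M 0 $ i $ j" for i j
  proof -
    have "residue (\<lambda>l. weyl \<tau> l $ i $ j) 0 = residue (\<lambda>l. (- M l $ i $ j) / (l - 0)) 0"
    proof (rule residue_cong)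
      show "\<forall>\<^sub>F l in at 0. weyl \<tau> l $ i $ j = (- M l $ i $ j) / (l - 0)"
        using di(2)[of 0] eventually_neq_at_within[of 0 0 UNIV]
      proof eventually_elim
        case (elim l)
        from weyl_eq[OF L P(1-3) Q(1-3) elim(2) elim(1)] show ?case
          by (simp add: M_def)
      qed
    qed simp
    also have "\<dots> = - M 0 $ i $ j"
      by (rule residue_simple[OF S S0]) (intro holomorphic_on_minus M)
    finally show ?thesis .
  qed
  then have "mat_residue (weyl \<tau>) 0 = - M 0"
    by (simp add: mat_residue_def vec_eq_iff)
  then show ?thesis by (simp add: norming_def M0)
qed

lemma mat_residue_weyl_gauge:
  fixes \<tau> \<tau>' S :: "real \<Rightarrow> complex^'n^'n"
  assumes \<tau>: "\<tau> \<in> ReL2" and g: "gauge_rel \<tau> \<tau>' S"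
  shows "mat_residue (weyl \<tau>') z = mat_residue (weyl \<tau>) z - (if z = 0 then S 0 else 0)"
proof -
  have L: "\<tau> \<in> L2" using \<tau> by (simp add: ReL2_def)
  obtain P HP :: "complex \<Rightarrow> real \<Rightarrow> complex^'n^'n" where P: "\<And>\<mu>. sys (**) \<tau> \<mu> (P \<mu>) (HP \<mu>)" "\<And>\<mu>. P \<mu> 0 = 0" "\<And>\<mu>. HP \<mu> 0 = mat 1"
    "\<And>i j. (\<lambda>\<mu>. P \<mu> 1 $ i $ j) holomorphic_on UNIV"
    by (rule sys_solution[OF L, of 0 "mat 1"]) (metis atLeastAtMost_iff order_refl zero_le_one)
  obtain Q HQ :: "complex \<Rightarrow> real \<Rightarrow> complex^'n^'n" where Q: "\<And>\<mu>. sys (**) \<tau> \<mu> (Q \<mu>) (HQ \<mu>)" "\<And>\<mu>. Q \<mu> 0 = mat 1" "\<And>\<mu>. HQ \<mu> 0 = 0"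
    "\<And>i j. (\<lambda>\<mu>. Q \<mu> 1 $ i $ j) holomorphic_on UNIV"
    by (rule sys_solution[OF L, of "mat 1" 0]) (metis atLeastAtMost_iff order_refl zero_le_one)
  note di = dirichlet_invertible_eventually[OF \<tau> P]
  have "\<forall>\<^sub>F l in at z. invertible (P (l\<^sup>2) 1) \<and> l \<noteq> 0"
    using di(2)[of z] eventually_neq_at_within[of 0 z UNIV] by eventually_elim auto
  then obtain r where r: "0 < r" "\<And>l. l \<noteq> z \<Longrightarrow> dist l z < r \<Longrightarrow> invertible (P (l\<^sup>2) 1) \<and> l \<noteq> 0"
    unfolding eventually_at by blast
  let ?B = "ball z r"
  have B: "l \<in> ?B - {z} \<Longrightarrow> invertible (P (l\<^sup>2) 1) \<and> l \<noteq> 0" for l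
    using r(2)[of l] by (auto simp: dist_commute)
  have Q2: "(\<lambda>l. Q (l\<^sup>2) 1 $ i $ j) holomorphic_on UNIV" for i j
    by (rule holomorphic_on_square_arg[OF Q(4)])
  have W: "(\<lambda>l. weyl \<tau> l $ i $ j) holomorphic_on ?B - {z}" for i j
  proof -
    have "(\<lambda>l. (matrix_inv (P (l\<^sup>2) 1) ** Q (l\<^sup>2) 1) $ i $ j) holomorphic_on ?B - {z}"
      by (intro matrix_mult_holomorphic matrix_inv_holomorphic holomorphic_on_subset[OF Q2]
          holomorphic_on_subset[OF di(3)]) (use B in \<open>simp_all add: invertible_det_nz\<close>)
    then have "(\<lambda>l. - (1 / l * (matrix_inv (P (l\<^sup>2) 1) ** Q (l\<^sup>2) 1) $ i $ j)) holomorphic_on ?B - {z}"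
      using B by (intro holomorphic_intros) auto
    then show ?thesis
      by (rule holomorphic_transform) (use B weyl_eq[OF L P(1-3) Q(1-3)] in simp)
  qed
  have C: "(\<lambda>l. S 0 $ i $ j / l) holomorphic_on ?B - {z}" for i j
    using B by (intro holomorphic_intros) auto
  have rC: "residue (\<lambda>l. S 0 $ i $ j / l) z = (if z = 0 then S 0 $ i $ j else 0)" for i j
  proof (cases "z = 0")
    case True
    then show ?thesis
      using residue_simple[of UNIV 0 "\<lambda>_. S 0 $ i $ j"] by simp
  next
    case False
    have "residue (\<lambda>l. S 0 $ i $ j / l) z = 0"
      by (rule residue_holo[of "- {0}"]) (use False in \<open>auto intro!: holomorphic_intros\<close>)
    then show ?thesis using False by simp
  qed
  have "residue (\<lambda>l. weyl \<tau>' l $ i $ j) z = residue (\<lambda>l. weyl \<tau> l $ i $ j) z - (if z = 0 then S 0 $ i $ j else 0)" for i j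
  proof -
    have "residue (\<lambda>l. weyl \<tau>' l $ i $ j) z = residue (\<lambda>l. weyl \<tau> l $ i $ j - S 0 $ i $ j / l) z"
    proof (rule residue_cong)
      show "\<forall>\<^sub>F l in at z. weyl \<tau>' l $ i $ j = weyl \<tau> l $ i $ j - S 0 $ i $ j / l"
        using di(2)[of z] eventually_neq_at_within[of 0 z UNIV]
        by eventually_elim (simp add: weyl_gauge[OF g P(1-3)])
    qed simp
    also have "\<dots> = residue (\<lambda>l. weyl \<tau> l $ i $ j) z - residue (\<lambda>l. S 0 $ i $ j / l) z"
      using r(1) by (intro residue_diff[of ?B] W C) auto
    finally show ?thesis by (simp only: rC)
  qed
  then show ?thesis by (simp add: mat_residue_def vec_eq_iff)
qed

section \<open>Eigenvalues\<close>

text \<open>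
  If \<open>f\<close> is an eigenfunction of \<open>S\<^sub>\<tau>\<close> for \<open>\<mu> \<noteq> 0\<close>, then \<open>y = f' + \<tau> f\<close> solves the Dirichlet problem with
  quasi-derivative \<open>g = - \<mu> f\<close>; conversely \<open>f = - g / \<mu>\<close>.
\<close>

lemma S_eigenvalue_iff:
  fixes \<tau> :: "real \<Rightarrow> complex^'n^'n"
  assumes \<tau>: "\<tau> \<in> L2" and \<mu>: "\<mu> \<noteq> 0"
  shows "S_eigenvalue \<tau> \<mu> \<longleftrightarrow>
    (\<exists>y g. sys (*v) \<tau> \<mu> y g \<and> y 0 = 0 \<and> y 1 = 0 \<and> (\<exists>x\<in>{0..1}. y x \<noteq> 0))"
proof -
  note bb = bounded_bilinear_matrix_vector_mult
  have matv: "mat c *v v = c *s v" for c and v :: "complex^'n"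
  proof -
    have "(mat c *v v) $ i = (\<Sum>k\<in>UNIV. if i = k then c * v $ k else 0)" for i
    proof -
      have "(mat c *v v) $ i = (\<Sum>k\<in>UNIV. (if i = k then c else 0) * v $ k)"
        by (simp add: matrix_vector_mult_def mat_def)
      also have "\<dots> = (\<Sum>k\<in>UNIV. if i = k then c * v $ k else 0)"
        by (intro sum.cong) auto
      finally show ?thesis .
    qed
    then show ?thesis by (simp add: vec_eq_iff)
  qed
  have lin: "bounded_linear ((*s) c :: complex^'n \<Rightarrow> complex^'n)" for c
  proof -
    have "(*s) c = (*v) (mat c :: complex^'n^'n)" by (simp add: fun_eq_iff matv)
    then show ?thesis using bounded_bilinear.bounded_linear_right[OF bb] by simp
  qed
  have mv: "A *v (c *s v) = c *s (A *v v)" for A :: "complex^'n^'n" and c v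
    by (simp add: vec_eq_iff matrix_vector_mult_def sum_distrib_left mult_ac)
  show ?thesis
  proof
    assume "S_eigenvalue \<tau> \<mu>"
    then obtain f h where f: "\<not> f \<approx> (\<lambda>_. 0)" "f \<in> W21" and h: "h \<in> W21" "h 0 = 0" "h 1 = 0"
      "h \<approx> (\<lambda>x. wderiv f x + \<tau> x *v f x)" "(\<lambda>x. \<mu> *s f x) \<approx> (\<lambda>x. - (wderiv h x - \<tau> x *v h x))"
      by (auto simp: S_eigenvalue_def S_op_def W21_0_def)
    have 1: "wderiv h \<approx> (\<lambda>x. \<tau> x *v h x + - (\<mu> *s f x))"
      using h(5) unfolding ae_eq_def by (rule AE_mp) (auto intro!: AE_I2)
    have 2: "(\<lambda>x. (- \<mu>) *s wderiv f x) \<approx> (\<lambda>x. - (\<tau> x *v (- (\<mu> *s f x))) - mat \<mu> *v h x)"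
      using h(4) unfolding ae_eq_def
      by (rule AE_mp) (auto intro!: AE_I2 simp: matv mv bounded_bilinear.minus_right[OF bb] vec_eq_iff algebra_simps)
    have s: "sys (*v) \<tau> \<mu> h (\<lambda>x. - (\<mu> *s f x))"
      unfolding sys_def
      by (intro conjI acder_cong[OF W21D(2)[OF h(1)] refl 1]
          acder_cong[OF acder_linear[OF W21D(2)[OF f(2)] lin[of "- \<mu>"]] _ 2]) (simp add: vec_eq_iff)
    have "\<exists>x\<in>{0..1}. h x \<noteq> 0"
    proof (rule ccontr)
      assume "\<not> (\<exists>x\<in>{0..1}. h x \<noteq> 0)"
      then have z: "h x = 0" if "x \<in> {0..1}" for x using that by blast
      have "(\<lambda>x. \<tau> x *v h x + - (\<mu> *s f x)) \<approx> (\<lambda>_. 0)"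
        by (rule acder_deriv_zero[of h]) (use s z in \<open>auto simp: sys_def\<close>)
      then have "AE x in unit_int. \<tau> x *v h x + - (\<mu> *s f x) = 0" by (simp add: ae_eq_def)
      then have "f \<approx> (\<lambda>_. 0)"
        unfolding ae_eq_def by (rule AE_mp) (use \<mu> in \<open>auto intro!: AE_I2 simp: z vec_eq_iff\<close>)
      then show False using f(1) by simp
    qed
    with s h show "\<exists>y g. sys (*v) \<tau> \<mu> y g \<and> y 0 = 0 \<and> y 1 = 0 \<and> (\<exists>x\<in>{0..1}. y x \<noteq> 0)" by blast
  next
    assume "\<exists>y g. sys (*v) \<tau> \<mu> y g \<and> y 0 = 0 \<and> y 1 = 0 \<and> (\<exists>x\<in>{0..1}. y x \<noteq> 0)"
    then obtain y g x0 where s: "sys (*v) \<tau> \<mu> y g" and y: "y 0 = 0" "y 1 = 0" and x0: "x0 \<in> {0..1}" "y x0 \<noteq> 0"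
      by blast
    have W: "y \<in> W21" "g \<in> W21"
      and g1: "AE x in unit_int. g x = wderiv y x - \<tau> x *v y x"
      and g2: "AE x in unit_int. - (wderiv g x + \<tau> x *v g x) = mat \<mu> *v y x"
      using s unfolding sys_iff_W21[OF bb \<tau>] ae_eq_def by auto
    define f where "f = (\<lambda>x. (- (1 / \<mu>)) *s g x)"
    have gf: "g x = - (\<mu> *s f x)" for x using \<mu> by (simp add: f_def vec_eq_iff)
    have af: "acder f (\<lambda>x. (- (1 / \<mu>)) *s wderiv g x)"
      unfolding f_def by (rule acder_linear[OF W21D(2)[OF W(2)] lin])
    note f = W21I[OF af L2_linear[OF W21D(1)[OF W(2)] lin]]
    have h1: "y \<approx> (\<lambda>x. wderiv f x + \<tau> x *v f x)"
      unfolding ae_eq_def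
    proof (rule AE_mp[OF AE_conjI[OF g2 f(2)[unfolded ae_eq_def]]], intro AE_I2 impI, elim conjE)
      fix x assume a: "- (wderiv g x + \<tau> x *v g x) = mat \<mu> *v y x" "wderiv f x = (- (1 / \<mu>)) *s wderiv g x"
      have 1: "\<mu> *s y x = - (wderiv g x + \<tau> x *v g x)" using a(1) by (simp add: matv)
      have "y x = (1 / \<mu>) *s (\<mu> *s y x)" using \<mu> by (simp add: vec_eq_iff)
      also have "\<dots> = (1 / \<mu>) *s (- (wderiv g x + \<tau> x *v g x))" by (simp only: 1)
      also have "\<dots> = (- (1 / \<mu>)) *s wderiv g x + (- (1 / \<mu>)) *s (\<tau> x *v g x)"
        by (simp add: vec_eq_iff algebra_simps)
      also have "\<dots> = wderiv f x + \<tau> x *v f x"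
        unfolding a(2) by (simp only: f_def mv)
      finally show "y x = wderiv f x + \<tau> x *v f x" .
    qed
    have h2: "(\<lambda>x. \<mu> *s f x) \<approx> (\<lambda>x. - (wderiv y x - \<tau> x *v y x))"
      unfolding ae_eq_def
      by (rule AE_mp[OF g1], intro AE_I2 impI) (metis gf minus_minus)
    have "\<not> f \<approx> (\<lambda>_. 0)"
    proof
      assume z: "f \<approx> (\<lambda>_. 0)"
      have fz: "f x = 0" if "x \<in> {0..1}" for x
        by (rule continuous_ae_zero[OF acder_continuous[OF af] z that])
      have "wderiv f \<approx> (\<lambda>_. 0)"
        by (rule acder_deriv_zero[OF W21D(2)[OF f(1)]]) (simp add: fz)
      then have "AE x in unit_int. y x = wderiv f x + \<tau> x *v f x \<and> wderiv f x = 0"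
        using h1 unfolding ae_eq_def by (intro AE_conjI)
      then have "y \<approx> (\<lambda>_. 0)"
        unfolding ae_eq_def by (rule AE_mp) (auto intro!: AE_I2 simp: fz)
      then have "y x0 = 0"
        using s acder_continuous x0(1) continuous_ae_zero unfolding sys_def by blast
      then show False using x0(2) by simp
    qed
    moreover have "S_op \<tau> f (\<lambda>x. \<mu> *s f x)"
      unfolding S_op_def using f(1) W(1) y h1 h2 by (auto simp: W21_0_def)
    ultimately show "S_eigenvalue \<tau> \<mu>" unfolding S_eigenvalue_def by blast
  qed
qed

text \<open>
  The kernel of \<open>S\<^sub>\<tau>\<close> contains the functions \<open>H v\<close> with a constant vector \<open>v\<close>.
\<close>

lemma S_eigenvalue_zero:
  fixes \<tau> :: "real \<Rightarrow> complex^'n^'n"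
  assumes \<tau>: "\<tau> \<in> ReL2" shows "S_eigenvalue \<tau> 0"
proof -
  obtain E H where H: "acder H (\<lambda>x. - (\<tau> x ** H x))" "H 0 = mat 1"
    by (rule zero_energy[OF \<tau>]) blast
  define v :: "complex^'n" where "v = (\<chi> i. 1)"
  define f where "f = (\<lambda>x. H x *v v)"
  have af: "acder f (\<lambda>x. - (\<tau> x *v f x))"
    using acder_linear[OF H(1) bounded_bilinear.bounded_linear_left[OF bounded_bilinear_matrix_vector_mult, of v]]
    by (simp add: f_def matrix_vector_mul_assoc bounded_bilinear.minus_left[OF bounded_bilinear_matrix_vector_mult])
  have L: "(\<lambda>x. - (\<tau> x *v f x)) \<in> L2"
    by (rule L2_minus[OF L2_bilinear_continuous[OF bounded_bilinear_matrix_vector_mult _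
          acder_continuous[OF af]]]) (use \<tau> in \<open>simp add: ReL2_def\<close>)
  note f = W21I[OF af L]
  have nz: "\<not> f \<approx> (\<lambda>_. 0)"
  proof
    assume "f \<approx> (\<lambda>_. 0)"
    then have "f 0 = 0" using continuous_ae_zero[OF acder_continuous[OF af], of 0] by simp
    then show False by (simp add: f_def H v_def vec_eq_iff)
  qed
  have "(\<lambda>x. 0 :: complex^'n) \<in> L2" by (rule L2_continuous) simp
  note z = W21I[OF acder_const[of "0 :: complex^'n"] this]
  have "S_op \<tau> f (\<lambda>x. 0 *s f x)"
    unfolding S_op_def
  proof (intro conjI f bexI)
    show "(\<lambda>x. 0) \<approx> (\<lambda>x. wderiv f x + \<tau> x *v f x)"
      using f(2) unfolding ae_eq_def by (rule AE_mp) (auto intro!: AE_I2)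
    show "(\<lambda>x. 0 *s f x) \<approx> (\<lambda>x. - (wderiv (\<lambda>x. 0) x - \<tau> x *v 0))"
      using z(2) unfolding ae_eq_def by (rule AE_mp) (auto intro!: AE_I2)
    show "(\<lambda>x. 0 :: complex^'n) \<in> W21_0" using z(1) by (simp add: W21_0_def)
  qed
  then show ?thesis using nz unfolding S_eigenvalue_def by blast
qed

lemma eig_zero:
  assumes "\<tau> \<in> ReL2" shows "eig \<tau> 0 = 0"
proof -
  have "(LEAST l. l \<in> sqrt_eigenvalues \<tau>) = 0"
    by (rule Least_equality) (use S_eigenvalue_zero[OF assms] in \<open>auto simp: sqrt_eigenvalues_def\<close>)
  then show ?thesis by simp
qed

lemma sqrt_eigenvalues_gauge_subset:
  fixes \<tau> \<tau>' S :: "real \<Rightarrow> complex^'n^'n"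
  assumes "\<tau> \<in> ReL2" "\<tau>' \<in> ReL2" "gauge_rel \<tau> \<tau>' S"
  shows "sqrt_eigenvalues \<tau> \<subseteq> sqrt_eigenvalues \<tau>'"
proof
  fix l assume l: "l \<in> sqrt_eigenvalues \<tau>"
  show "l \<in> sqrt_eigenvalues \<tau>'"
  proof (cases "l = 0")
    case True
    then show ?thesis using S_eigenvalue_zero[OF assms(2)] by (simp add: sqrt_eigenvalues_def)
  next
    case False
    then have nz: "complex_of_real (l\<^sup>2) \<noteq> 0" by simp
    have L: "\<tau> \<in> L2" "\<tau>' \<in> L2" using assms by (auto simp: ReL2_def)
    from l obtain y g where "sys (*v) \<tau> (of_real (l\<^sup>2)) y g" "y 0 = 0" "y 1 = 0" "\<exists>x\<in>{0..1}. y x \<noteq> 0"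
      using S_eigenvalue_iff[OF L(1) nz] by (auto simp: sqrt_eigenvalues_def)
    then have "S_eigenvalue \<tau>' (of_real (l\<^sup>2))"
      using S_eigenvalue_iff[OF L(2) nz]
        sys_gauge[OF bounded_bilinear_matrix_vector_mult matrix_vector_mul_assoc[symmetric] assms(3)] by blast
    then show ?thesis using l by (simp add: sqrt_eigenvalues_def)
  qed
qed

lemma sqrt_eigenvalues_gauge:
  assumes "\<tau> \<in> ReL2" "\<tau>' \<in> ReL2" "gauge_rel \<tau> \<tau>' S"
  shows "sqrt_eigenvalues \<tau>' = sqrt_eigenvalues \<tau>"
  using sqrt_eigenvalues_gauge_subset[OF assms]
    sqrt_eigenvalues_gauge_subset[OF assms(2,1) gauge_sym[OF assms(3)]] by blast

lemma eig_gauge: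
  assumes "\<tau> \<in> ReL2" "\<tau>' \<in> ReL2" "gauge_rel \<tau> \<tau>' S"
  shows "eig \<tau>' j = eig \<tau> j"
  by (induction j) (simp_all add: sqrt_eigenvalues_gauge[OF assms])

lemma norming_gauge:
  assumes "\<tau> \<in> ReL2" "\<tau>' \<in> ReL2" "gauge_rel \<tau> \<tau>' S" "eig \<tau> (Suc j) \<noteq> 0"
  shows "norming \<tau>' (Suc j) = norming \<tau> (Suc j)"
  using assms by (simp add: norming_def eig_gauge[OF assms(1-3)] mat_residue_weyl_gauge[OF assms(1,3)] del: eig.simps)

lemma norming_zero_gauge:
  assumes "\<tau> \<in> ReL2" "gauge_rel \<tau> \<tau>' S"
  shows "norming \<tau>' 0 = norming \<tau> 0 + (1/2) *\<^sub>R S 0"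
  by (simp add: norming_def mat_residue_weyl_gauge[OF assms] algebra_simps)

section \<open>Equality of Miura images\<close>

lemma miura_entry:
  fixes u :: "real \<Rightarrow> complex^'n^'n" and f :: "real \<Rightarrow> complex"
  assumes u: "u \<in> L2" and f: "acder f g" "g \<in> L2" "f 0 = 0" "f 1 = 0"
  shows "miura u f $ i $ j =
    integral {0..1} (\<lambda>x. f x * (u x ** u x) $ i $ j) - integral {0..1} (\<lambda>x. g x * u x $ i $ j)"
    and "(\<lambda>x. f x * (u x ** u x) $ i $ j) absolutely_integrable_on {0..1}"
    and "(\<lambda>x. g x * u x $ i $ j) absolutely_integrable_on {0..1}"
proof -
  have W: "f \<in> W21" and wg: "wderiv f \<approx> g" using W21I[OF f(1,2)] by auto
  have lin: "bounded_linear (\<lambda>A :: complex^'n^'n. A $ i $ j)"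
    by (rule bounded_linear_compose[OF bounded_linear_vec_nth bounded_linear_vec_nth])
  have cm: "continuous_on {0..1} (\<lambda>x. mat (f x) :: complex^'n^'n)"
    by (rule bounded_linear.continuous_on[OF bounded_linear_mat acder_continuous[OF f(1)]])
  have 1: "(\<lambda>x. mat (f x) ** (u x ** u x)) absolutely_integrable_on {0..1}"
    by (rule absolutely_integrable_bilinear_continuous[OF bounded_bilinear_matrix_mult cm
          L2_mult_integrable[OF bounded_bilinear_matrix_mult u u]])
  have 2: "(\<lambda>x. mat (h x) ** u x) absolutely_integrable_on {0..1}" if "h \<in> L2" for h :: "real \<Rightarrow> complex"
    by (rule L2_mult_integrable[OF bounded_bilinear_matrix_mult L2_linear[OF that bounded_linear_mat] u])
  note 2 = 2[OF W21D(1)[OF W]] 2[OF f(2)]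
  have ent: "integral {0..1} F $ i $ j = integral {0..1} (\<lambda>x. F x $ i $ j)"
    if "F absolutely_integrable_on {0..1}" for F :: "real \<Rightarrow> complex^'n^'n"
    using integral_linear[OF _ lin, of F "{0..1}"] that by (simp add: o_def absolutely_integrable_on_def)
  have "integral {0..1} (\<lambda>x. wderiv f x * u x $ i $ j) = integral {0..1} (\<lambda>x. g x * u x $ i $ j)"
    by (rule integral_spike[OF wg[unfolded ae_eq_iff_negligible]]) auto
  then show "miura u f $ i $ j =
    integral {0..1} (\<lambda>x. f x * (u x ** u x) $ i $ j) - integral {0..1} (\<lambda>x. g x * u x $ i $ j)"
    using W f by (simp add: miura_def W21_0_def integral_unit_eq[OF 1] integral_unit_eq[OF 2(1)]
        ent[OF 1] ent[OF 2(1)])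
  show "(\<lambda>x. f x * (u x ** u x) $ i $ j) absolutely_integrable_on {0..1}"
    "(\<lambda>x. g x * u x $ i $ j) absolutely_integrable_on {0..1}"
    using absolutely_integrable_linear[OF 1 lin] absolutely_integrable_linear[OF 2(2) lin]
    by (simp_all add: o_def)
qed

text \<open>
  The lemma of du Bois-Reymond: \<open>\<rho>\<close> is tested against the conjugate of \<open>\<rho>\<close> minus its mean.
\<close>

lemma orthogonal_to_mean_zero_const:
  fixes \<rho> :: "real \<Rightarrow> complex"
  assumes \<rho>: "\<rho> \<in> L2"
    and orth: "\<And>g. g \<in> L2 \<Longrightarrow> integral {0..1} g = 0 \<Longrightarrow> integral {0..1} (\<lambda>x. g x * \<rho> x) = 0"
  shows "\<exists>c. \<rho> \<approx> (\<lambda>_. c)"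
proof -
  define c where "c = integral {0..1} \<rho>"
  define d where "d = (\<lambda>x. \<rho> x - c)"
  have d: "d \<in> L2" unfolding d_def
    by (rule L2_diff[OF \<rho> L2_continuous[OF continuous_on_const]])
  have i: "\<rho> integrable_on {0..1}"
    using L2_absolutely_integrable[OF \<rho>] by (simp add: absolutely_integrable_on_def)
  have id: "(d has_integral 0) {0..1}"
    using has_integral_diff[OF integrable_integral[OF i] has_integral_const_real[of c 0 1]]
    by (simp add: d_def c_def)
  have g: "(\<lambda>x. cnj (d x)) \<in> L2" by (rule L2_linear[OF d bounded_linear_cnj])
  have ig: "((\<lambda>x. cnj (d x)) has_integral 0) {0..1}"
    using has_integral_linear[OF id bounded_linear_cnj] by (simp add: o_def)
  have "(\<lambda>x. cnj (d x) * \<rho> x) integrable_on {0..1}"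
    using L2_mult_integrable[OF bounded_bilinear_mult g \<rho>] by (simp add: absolutely_integrable_on_def)
  then have "((\<lambda>x. cnj (d x) * \<rho> x) has_integral 0) {0..1}"
    using orth[OF g integral_unique[OF ig]] by (metis integrable_integral)
  from has_integral_diff[OF this has_integral_mult_left[OF ig, of c]]
  have "((\<lambda>x. cnj (d x) * d x) has_integral 0) {0..1}"
    by (simp add: d_def algebra_simps)
  from has_integral_linear[OF this bounded_linear_Re]
  have "((\<lambda>x. (norm (d x))\<^sup>2) has_integral 0) {0..1}"
    by (simp add: o_def cmod_power2) (simp add: power2_eq_square)
  moreover have a: "(\<lambda>x. (norm (d x))\<^sup>2) absolutely_integrable_on {0..1}"
    using L2D(2)[OF d] by (simp add: absolutely_integrable_unit_iff)
  ultimately have "(\<integral>x. (norm (d x))\<^sup>2 \<partial>unit_int) = 0"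
    by (simp add: integral_unit_eq integral_unique)
  then have "AE x in unit_int. (norm (d x))\<^sup>2 = 0"
    using integral_nonneg_eq_0_iff_AE[OF L2D(2)[OF d]] by simp
  then have "\<rho> \<approx> (\<lambda>_. c)"
    unfolding ae_eq_def by (rule AE_mp) (auto intro!: AE_I2 simp: d_def)
  then show ?thesis by blast
qed

lemma miura_eq_imp_gauge_rel:
  fixes \<tau> \<tau>' :: "real \<Rightarrow> complex^'n^'n"
  assumes \<tau>: "\<tau> \<in> L2" "\<tau>' \<in> L2" and eq: "miura \<tau> = miura \<tau>'"
  shows "\<exists>S. gauge_rel \<tau> \<tau>' S"
proof -
  define r where "r = (\<lambda>x. \<tau>' x ** \<tau>' x - \<tau> x ** \<tau> x)"
  have ir: "r absolutely_integrable_on {0..1}"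
    unfolding r_def by (intro set_integral_diff(1) L2_mult_integrable[OF bounded_bilinear_matrix_mult] \<tau>)
  define R where "R = (\<lambda>x. integral {0..x} r)"
  have aR: "acder R r" using acderI_integral[OF ir, of 0] by (simp add: R_def)
  define \<rho> where "\<rho> = (\<lambda>x. R x + (\<tau>' x - \<tau> x))"
  have \<rho>: "\<rho> \<in> L2" unfolding \<rho>_def
    by (intro L2_add L2_diff L2_continuous[OF acder_continuous[OF aR]] \<tau>)
  have "\<exists>c. (\<lambda>x. \<rho> x $ i $ j) \<approx> (\<lambda>_. c)" for i j
  proof (rule orthogonal_to_mean_zero_const)
    have lin: "bounded_linear (\<lambda>A :: complex^'n^'n. A $ i $ j)"
      by (rule bounded_linear_compose[OF bounded_linear_vec_nth bounded_linear_vec_nth])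
    show "(\<lambda>x. \<rho> x $ i $ j) \<in> L2" by (rule L2_linear[OF \<rho> lin])
    fix g :: "real \<Rightarrow> complex" assume g: "g \<in> L2" "integral {0..1} g = 0"
    define f where "f = (\<lambda>x. integral {0..x} g)"
    have f: "acder f g" using acderI_integral[OF L2_absolutely_integrable[OF g(1)], of 0] by (simp add: f_def)
    have f01: "f 0 = 0" "f 1 = 0" using g(2) by (auto simp: f_def)
    note m = miura_entry[OF \<tau>(1) f g(1) f01, of i j] and m' = miura_entry[OF \<tau>(2) f g(1) f01, of i j]
    let ?I = "\<lambda>F. integral {0..1} F :: complex"
    have ii: "(\<lambda>x. f x * (\<tau> x ** \<tau> x) $ i $ j) integrable_on {0..1}"
      "(\<lambda>x. f x * (\<tau>' x ** \<tau>' x) $ i $ j) integrable_on {0..1}"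
      "(\<lambda>x. g x * \<tau> x $ i $ j) integrable_on {0..1}" "(\<lambda>x. g x * \<tau>' x $ i $ j) integrable_on {0..1}"
      using m(2,3) m'(2,3) by (simp_all add: absolutely_integrable_on_def)
    have e: "?I (\<lambda>x. f x * (\<tau>' x ** \<tau>' x) $ i $ j) - ?I (\<lambda>x. g x * \<tau>' x $ i $ j)
      = ?I (\<lambda>x. f x * (\<tau> x ** \<tau> x) $ i $ j) - ?I (\<lambda>x. g x * \<tau> x $ i $ j)"
      using m(1) m'(1) eq by simp
    have h1: "((\<lambda>x. (g x * \<tau>' x $ i $ j - g x * \<tau> x $ i $ j) -
        (f x * (\<tau>' x ** \<tau>' x) $ i $ j - f x * (\<tau> x ** \<tau> x) $ i $ j)) has_integral 0) {0..1}"
      using has_integral_diff[OF has_integral_diff[OF integrable_integral[OF ii(4)] integrable_integral[OF ii(3)]]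
          has_integral_diff[OF integrable_integral[OF ii(2)] integrable_integral[OF ii(1)]]] e
      by (simp add: algebra_simps)
    have "acder (\<lambda>x. f x * R x $ i $ j) (\<lambda>x. g x * R x $ i $ j + f x * r x $ i $ j)"
      by (rule acder_bilinear[OF bounded_bilinear_mult f acder_linear[OF aR lin]])
    from acder_has_integral[OF this, of 0 1]
    have "((\<lambda>x. g x * R x $ i $ j + f x * r x $ i $ j) has_integral 0) {0..1}"
      by (simp add: f01)
    from has_integral_add[OF this h1]
    have "((\<lambda>x. g x * \<rho> x $ i $ j) has_integral 0) {0..1}"
      by (simp add: \<rho>_def r_def algebra_simps)
    then show "integral {0..1} (\<lambda>x. g x * \<rho> x $ i $ j) = 0" by (rule integral_unique)
  qed
  then obtain c where c: "\<And>i j. (\<lambda>x. \<rho> x $ i $ j) \<approx> (\<lambda>_. c i j)" by metis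
  define C :: "complex^'n^'n" where "C = (\<chi> i j. c i j)"
  have "AE x in unit_int. \<forall>i\<in>UNIV. \<forall>j\<in>UNIV. \<rho> x $ i $ j = c i j"
    using c unfolding ae_eq_def by (intro AE_finite_allI) auto
  then have "(\<lambda>x. C - R x) \<approx> (\<lambda>x. \<tau>' x - \<tau> x)"
    unfolding ae_eq_def
    by (rule AE_mp) (auto intro!: AE_I2 simp: C_def \<rho>_def vec_eq_iff algebra_simps)
  moreover have "acder (\<lambda>x. C - R x) (\<lambda>x. \<tau> x ** \<tau> x - \<tau>' x ** \<tau>' x)"
    using acder_diff[OF acder_const[of C] aR] by (simp add: r_def)
  ultimately have "gauge_rel \<tau> \<tau>' (\<lambda>x. C - R x)" using \<tau> by (simp add: gauge_rel_def)
  then show ?thesis by blast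
qed

section \<open>Solving the Riccati equation\<close>

lemma matrix_inv_continuous:
  fixes N :: "real \<Rightarrow> complex^'n^'n"
  assumes N: "continuous_on A N" and inv: "\<And>x. x \<in> A \<Longrightarrow> invertible (N x)"
  shows "continuous_on A (\<lambda>x. matrix_inv (N x))"
proof -
  have ent: "continuous_on A (\<lambda>x. N x $ i $ j)" for i j
    by (intro continuous_intros N)
  have det: "continuous_on A (\<lambda>x. det (M x))" if "\<And>i j. continuous_on A (\<lambda>x. M x $ i $ j)"
    for M :: "real \<Rightarrow> complex^'n^'n"
    unfolding det_def by (intro continuous_intros that)
  have nz: "det (N x) \<noteq> 0" if "x \<in> A" for x using inv[OF that] by (simp add: invertible_det_nz)
  have ei: "continuous_on A (\<lambda>x. matrix_inv (N x) $ i $ j)" for i j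
  proof -
    have "continuous_on A (\<lambda>x. det (\<chi> a c. if c = i then axis j 1 $ a else N x $ a $ c) / det (N x))"
    proof (intro continuous_on_divide det ent ballI nz)
      show "continuous_on A (\<lambda>x. (\<chi> a c. if c = i then axis j 1 $ a else N x $ a $ c) $ a $ c)" for a c
        by (cases "c = i") (simp_all add: ent)
    qed auto
    then show ?thesis by (rule continuous_on_eq) (simp add: matrix_inv_entry nz)
  qed
  have "continuous_on A (\<lambda>x. \<chi> i j. matrix_inv (N x) $ i $ j)"
    by (intro continuous_on_vec_lambda ei)
  then show ?thesis by simp
qed

text \<open>
  The inverse \<open>J\<close> of \<open>N\<close> is continuous; the solution \<open>L\<close> of the linear equation \<open>L' = - L N' J\<close> satisfies
  \<open>(L N)' = 0\<close>, so it equals \<open>J\<close>.  The assumption \<open>N 0 = 1\<close> fixes the initial value of \<open>L\<close>.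
\<close>

lemma matrix_inv_acder:
  fixes N N' :: "real \<Rightarrow> complex^'n^'n"
  assumes N: "acder N N'" "continuous_on {0..1} N'" and inv: "\<And>x. x \<in> {0..1} \<Longrightarrow> invertible (N x)"
    and N0: "N 0 = mat 1"
  shows "acder (\<lambda>x. matrix_inv (N x)) (\<lambda>x. - (matrix_inv (N x) ** N' x ** matrix_inv (N x)))"
proof -
  let ?J = "\<lambda>x. matrix_inv (N x)" and ?A = "\<lambda>x. N' x ** matrix_inv (N x)"
  note J = matrix_inv_continuous[OF acder_continuous[OF N(1)] inv]
  have A: "continuous_on {0..1} ?A"
    by (intro bounded_bilinear.continuous_on[OF bounded_bilinear_matrix_mult] N(2) J)
  then have "(\<lambda>x. mat_adj (?A x)) \<in> L2"
    by (intro L2_continuous bounded_linear.continuous_on[OF bounded_linear_mat_adj])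
  then obtain Y K where Y: "\<And>\<mu>. sys (**) (\<lambda>x. mat_adj (?A x)) \<mu> (Y \<mu>) (K \<mu>)" "\<And>\<mu>. K \<mu> 0 = mat 1"
    by (rule sys_solution[of _ 0 "mat 1"]) blast
  have "acder (K 0) (\<lambda>x. - (mat_adj (?A x) ** K 0 x))"
    using Y(1)[of 0] by (simp add: sys_def)
  from acder_linear[OF this bounded_linear_mat_adj]
  have L: "acder (\<lambda>x. mat_adj (K 0 x)) (\<lambda>x. - (mat_adj (K 0 x) ** ?A x))"
    by (simp add: mat_adj_minus mat_adj_mult matrix_mul_assoc)
  note LN = acder_mult[OF L N(1)]
  have JL: "mat_adj (K 0 x) = ?J x" if x: "x \<in> {0..1}" for x
  proof -
    have "mat_adj (K 0 x) ** N x = mat_adj (K 0 0) ** N 0"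
    proof (rule acder_zero_const[OF LN _ x], rule ae_eqI)
      fix s :: real assume s: "s \<in> {0<..<1}"
      have "?A s ** N s = N' s"
        using matrix_inv_mult_self(2)[OF inv[of s]] s by (simp add: matrix_mul_assoc[symmetric])
      then show "- (mat_adj (K 0 s) ** ?A s) ** N s + mat_adj (K 0 s) ** N' s = 0"
        by (simp add: matrix_mult_minus_left matrix_mul_assoc[symmetric])
    qed
    then have "mat_adj (K 0 x) ** N x = mat 1" by (simp add: Y N0)
    then show ?thesis by (simp add: matrix_mult_inv(2))
  qed
  show ?thesis
    by (rule acder_cong[OF L], simp add: JL, rule ae_eqI) (simp add: JL matrix_mul_assoc)
qed

text \<open>
  The Hermitian solution of \<open>S' = \<tau>\<^sup>2 - (\<tau> + S)\<^sup>2\<close>, \<open>S(0) = C\<close>, is \<open>S = H C J H\<^sup>*\<close> with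
  \<open>J = (1 + G C)\<^sup>-\<^sup>1\<close>, as \<open>J' = - J H\<^sup>* H C J\<close>.
\<close>

lemma gauge_rel_exists:
  fixes \<tau> E H :: "real \<Rightarrow> complex^'n^'n"
  assumes \<tau>: "\<tau> \<in> ReL2" and H: "acder H (\<lambda>x. - (\<tau> x ** H x))" "H 0 = mat 1"
    and C: "mat_adj C = C" and inv: "\<And>x. x \<in> {0..1} \<Longrightarrow> invertible (mat 1 + gram H x ** C)"
  obtains \<tau>' S where "\<tau>' \<in> ReL2" "gauge_rel \<tau> \<tau>' S" "S 0 = C"
proof -
  have L: "\<tau> \<in> L2" and adj: "AE x in unit_int. \<tau> x = mat_adj (\<tau> x)"
    using \<tau> by (auto simp: ReL2_def ae_eq_def)
  note cH = acder_continuous[OF H(1)]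
  define N where "N = (\<lambda>x. mat 1 + gram H x ** C)"
  define J where "J = (\<lambda>x. matrix_inv (N x))"
  define N' where "N' = (\<lambda>x. mat_adj (H x) ** H x ** C)"
  have aN: "acder N N'"
    using acder_add[OF acder_const[of "mat 1"] acder_linear[OF gram_acder[OF cH]
          bounded_bilinear.bounded_linear_left[OF bounded_bilinear_matrix_mult, of C]]]
    by (simp add: N_def N'_def)
  have cN': "continuous_on {0..1} N'" unfolding N'_def
    by (rule bounded_bilinear.continuous_on[OF bounded_bilinear_matrix_mult gram_continuous[OF cH] continuous_on_const])
  have N0: "N 0 = mat 1" by (simp add: N_def gram_0[OF cH])
  have invN: "invertible (N x)" if "x \<in> {0..1}" for x using inv[OF that] by (simp add: N_def)
  have aJ: "acder J (\<lambda>x. - (J x ** N' x ** J x))"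
    unfolding J_def by (rule matrix_inv_acder[OF aN cN' invN N0])
  define S where "S = (\<lambda>x. H x ** (C ** J x) ** mat_adj (H x))"
  have CJ: "mat_adj (C ** J x) = C ** J x" if x: "x \<in> {0..1}" for x
  proof -
    have NJ: "N x ** J x = mat 1" unfolding J_def by (rule matrix_inv_mult_self[OF invN[OF x]])
    have "C ** N x = mat_adj (N x) ** C"
      by (simp add: N_def mat_adj_add mat_adj_mult C gram_adj[OF cH x] matrix_add_ldistrib
          bounded_bilinear.add_left[OF bounded_bilinear_matrix_mult] matrix_mul_assoc)
    then have "mat_adj (J x) ** (C ** (N x ** J x)) = mat_adj (N x ** J x) ** (C ** J x)"
      by (simp add: mat_adj_mult matrix_mul_assoc[symmetric]) (simp add: matrix_mul_assoc)
    then show ?thesis by (simp add: NJ mat_adj_mult C)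
  qed
  have S_adj: "mat_adj (S x) = S x" if "x \<in> {0..1}" for x
    using CJ[OF that] by (simp add: S_def mat_adj_mult matrix_mul_assoc)
  have S0: "S 0 = C"
    using matrix_mult_inv(1)[of "mat 1 :: complex^'n^'n" "mat 1"] by (simp add: S_def J_def N0 H)
  note aCJ = acder_linear[OF aJ bounded_bilinear.bounded_linear_right[OF bounded_bilinear_matrix_mult, of C]]
  note aS = acder_mult[OF acder_mult[OF H(1) aCJ] acder_linear[OF H(1) bounded_linear_mat_adj]]
  define \<tau>' where "\<tau>' = (\<lambda>x. \<tau> x + S x)"
  have "acder S (\<lambda>x. \<tau> x ** \<tau> x - \<tau>' x ** \<tau>' x)"
  proof (rule acder_cong[OF aS], simp add: S_def, unfold ae_eq_def, rule AE_mp[OF adj], intro AE_I2 impI)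
    fix x assume t: "\<tau> x = mat_adj (\<tau> x)"
    have "C ** - (J x ** N' x ** J x) = - (C ** J x ** mat_adj (H x) ** (H x ** (C ** J x)))"
      by (simp add: N'_def matrix_mult_minus_right matrix_mul_assoc)
    moreover have "mat_adj (- (\<tau> x ** H x)) = - (mat_adj (H x) ** \<tau> x)"
      using t by (simp add: mat_adj_minus mat_adj_mult)
    ultimately show "(- (\<tau> x ** H x) ** (C ** J x) + H x ** (C ** - (J x ** N' x ** J x))) ** mat_adj (H x) +
         H x ** (C ** J x) ** mat_adj (- (\<tau> x ** H x)) = \<tau> x ** \<tau> x - \<tau>' x ** \<tau>' x"
      by (simp add: \<tau>'_def S_def matrix_mult_minus_left matrix_mult_minus_right matrix_add_ldistrib
          bounded_bilinear.add_left[OF bounded_bilinear_matrix_mult] matrix_mul_assoc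
          matrix_mult_diff_left)
  qed
  note aS' = this
  have L': "\<tau>' \<in> L2" unfolding \<tau>'_def
    by (rule L2_add[OF L L2_continuous[OF acder_continuous[OF aS']]])
  have "\<tau>' \<approx> (\<lambda>x. mat_adj (\<tau>' x))"
    unfolding ae_eq_def
    by (rule AE_mp[OF adj]) (auto intro!: AE_I2 simp: \<tau>'_def mat_adj_add S_adj)
  then have "\<tau>' \<in> ReL2" using L' by (simp add: ReL2_def)
  moreover have "gauge_rel \<tau> \<tau>' S"
    using L L' aS' by (simp add: gauge_rel_def) (simp add: \<tau>'_def)
  ultimately show ?thesis using that S0 by blast
qed

text \<open>
  Suppose \<open>(1 + G(x) C) v = 0\<close> and put \<open>w = C v\<close>, \<open>z = G(1)\<^sup>-\<^sup>1 G(x) w\<close>.  Positivity of \<open>G(1)\<^sup>-\<^sup>1 + C\<close> on \<open>v\<close> means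
  \<open>\<langle>w, G(x) w\<rangle> < \<langle>z, G(x) w\<rangle>\<close>, whereas \<open>0 \<le> G(x) \<le> G(1)\<close> yields the reverse inequality by expanding
  \<open>\<langle>G(x) (z - w), z - w\<rangle> \<ge> 0\<close>.
\<close>

lemma gram_perturbation_invertible:
  fixes H :: "real \<Rightarrow> complex^'n^'n"
  assumes H: "continuous_on {0..1} H" "H 0 = mat 1"
    and pos: "\<And>v. v \<noteq> 0 \<Longrightarrow> 0 < Re (cinner ((matrix_inv (gram H 1) + C) *v v) v)"
    and x: "x \<in> {0..1}"
  shows "invertible (mat 1 + gram H x ** C)"
proof (rule invertibleI_kernel, rule ccontr)
  fix v assume k: "(mat 1 + gram H x ** C) *v v = 0" and v: "v \<noteq> 0"
  let ?Gx = "gram H x" and ?G = "gram H 1"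
  define w z where "w = C *v v" and "z = matrix_inv ?G *v (?Gx *v w)"
  have sum: "A *v u + B *v u = (A + B) *v u" for A B :: "complex^'n^'n" and u
    by (simp add: bounded_bilinear.add_left[OF bounded_bilinear_matrix_vector_mult])
  have "v + ?Gx *v w = 0"
    using k by (simp add: sum[symmetric] w_def matrix_vector_mul_assoc)
  then have vw: "v = - (?Gx *v w)" by (simp add: eq_neg_iff_add_eq_0)
  have Gz: "?G *v z = ?Gx *v w"
    by (simp add: z_def matrix_vector_mul_assoc matrix_mul_assoc matrix_inv_mult_self[OF gram_invertible[OF H]])
  have Gv: "matrix_inv ?G *v v = - z"
    unfolding vw z_def by (simp add: bounded_bilinear.minus_right[OF bounded_bilinear_matrix_vector_mult])
  have "0 < Re (cinner (- z + w) v)"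
    using pos[OF v] by (simp add: sum[symmetric] Gv w_def)
  then have lt: "Re (cinner w (?Gx *v w)) < Re (cinner z (?Gx *v w))"
    by (subst (asm) vw) (simp add: cinner_diff_left cinner_minus_right)
  have sym: "cinner (?Gx *v a) b = cinner a (?Gx *v b)" for a b
    by (simp add: cinner_mat_adj gram_adj[OF H(1) x])
  have re: "Re (cinner a b) = Re (cinner b a)" for a b :: "complex^'n"
    by (subst cinner_commute) simp
  have "0 \<le> qform (z - w) ?Gx"
    using gram_mono[OF H(1), of 0 x "z - w"] x by (simp add: gram_0[OF H(1)] qform_def cinner_def)
  then have "2 * Re (cinner z (?Gx *v w)) \<le> qform z ?Gx + qform w ?Gx"
    unfolding qform_def
    by (simp add: bounded_bilinear.diff_right[OF bounded_bilinear_matrix_vector_mult] cinner_diff_left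
        cinner_diff_right sym re[of w "?Gx *v z"])
  also have "qform z ?Gx \<le> qform z ?G"
    using gram_mono[OF H(1), of x 1 z] x by simp
  also have "qform z ?G = Re (cinner z (?Gx *v w))"
    unfolding qform_def Gz by (rule re)
  finally have "Re (cinner z (?Gx *v w)) \<le> qform w ?Gx" by simp
  also have "\<dots> = Re (cinner w (?Gx *v w))"
    unfolding qform_def by (rule re)
  finally show False using lt by simp
qed

section \<open>Characterisation of the spectral data\<close>

theorem proposition1p3:
  fixes lam :: "nat \<Rightarrow> real" and \<alpha> :: "nat \<Rightarrow> complex^'r^'r"
  assumes "strict_mono lam"
    and "\<And>j. 0 \<le> lam j"
    and "\<And>j. \<alpha> j \<in> psd"
    and "\<And>j. \<alpha> j \<noteq> 0"
  shows "(\<lambda>j. (lam j, \<alpha> j)) \<in> frak_A \<longleftrightarrow>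
    (\<lambda>j. (lam (Suc j), \<alpha> (Suc j))) \<in> frak_B \<and> lam 0 = 0 \<and> pos_def (\<alpha> 0)"
proof -
  \<comment> \<open>The residue of the Weyl function at 0 depends on the choice of the potential, so the points with positive index must be nonzero.\<close>
  have lam_pos: "lam (Suc j) \<noteq> 0" for j
    using assms(1,2) by (metis lessI less_le_not_le strict_mono_less)
  show ?thesis
  proof
    assume "(\<lambda>j. (lam j, \<alpha> j)) \<in> frak_A"
    then obtain \<tau> where \<tau>: "\<tau> \<in> ReL2" and d: "(\<lambda>j. (lam j, \<alpha> j)) = data_a \<tau>"
      by (auto simp: frak_A_def)
    have lam: "lam j = eig \<tau> j" and al: "\<alpha> j = norming \<tau> j" for j
      using fun_cong[OF d, of j] by (simp_all add: data_a_def del: eig.simps)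
    obtain E H where EH: "acder E (\<lambda>x. \<tau> x ** E x)" "E 0 = mat 1"
      "acder H (\<lambda>x. - (\<tau> x ** H x))" "H 0 = mat 1"
      "\<And>x. x \<in> {0..1} \<Longrightarrow> mat_adj (H x) ** E x = mat 1"
      by (rule zero_energy[OF \<tau>]) blast
    have n0: "norming \<tau> 0 = (1/2) *\<^sub>R matrix_inv (gram H 1)"
      by (rule norming_zero[OF \<tau> EH])
    have pd: "pos_def (\<alpha> 0)"
      unfolding al n0 by (rule pos_def_inv_gram[OF acder_continuous[OF EH(3)] EH(4)])
    \<comment> \<open>The potential that represents the Miura image of \<open>\<tau>\<close> in the definition of \<open>data_b\<close>.\<close>
    define \<tau>' where "\<tau>' = (SOME u. u \<in> ReL2 \<and> miura u = miura \<tau>)"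
    have \<tau>': "\<tau>' \<in> ReL2" "miura \<tau>' = miura \<tau>"
      using someI[of "\<lambda>u. u \<in> ReL2 \<and> miura u = miura \<tau>" \<tau>] \<tau> by (auto simp: \<tau>'_def)
    obtain S where g: "gauge_rel \<tau> \<tau>' S"
      using miura_eq_imp_gauge_rel[of \<tau> \<tau>'] \<tau> \<tau>' by (auto simp: ReL2_def)
    have "(lam (Suc j), \<alpha> (Suc j)) = data_a \<tau>' (Suc j)" for j
      using norming_gauge[OF \<tau> \<tau>'(1) g, of j] lam_pos[of j] eig_gauge[OF \<tau> \<tau>'(1) g, of "Suc j"]
      by (simp add: data_a_def lam al del: eig.simps)
    then have "(\<lambda>j. (lam (Suc j), \<alpha> (Suc j))) = data_b (miura \<tau>)"
      unfolding data_b_def \<tau>'_def[symmetric] Let_def by (rule ext)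
    then show "(\<lambda>j. (lam (Suc j), \<alpha> (Suc j))) \<in> frak_B \<and> lam 0 = 0 \<and> pos_def (\<alpha> 0)"
      using \<tau> pd eig_zero[OF \<tau>] by (auto simp: frak_B_def ReM_def lam)
  next
    assume R: "(\<lambda>j. (lam (Suc j), \<alpha> (Suc j))) \<in> frak_B \<and> lam 0 = 0 \<and> pos_def (\<alpha> 0)"
    then obtain u where u: "u \<in> ReL2" and d: "(\<lambda>j. (lam (Suc j), \<alpha> (Suc j))) = data_b (miura u)"
      by (auto simp: frak_B_def ReM_def)
    define \<tau> where "\<tau> = (SOME \<tau>. \<tau> \<in> ReL2 \<and> miura \<tau> = miura u)"
    have \<tau>: "\<tau> \<in> ReL2"
      using someI[of "\<lambda>\<tau>. \<tau> \<in> ReL2 \<and> miura \<tau> = miura u" u] u by (auto simp: \<tau>_def)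
    have lam: "lam (Suc j) = eig \<tau> (Suc j)" and al: "\<alpha> (Suc j) = norming \<tau> (Suc j)" for j
      using fun_cong[OF d, of j]
      by (simp_all add: data_b_def \<tau>_def[symmetric] Let_def data_a_def del: eig.simps)
    obtain E H where EH: "acder E (\<lambda>x. \<tau> x ** E x)" "E 0 = mat 1"
      "acder H (\<lambda>x. - (\<tau> x ** H x))" "H 0 = mat 1"
      "\<And>x. x \<in> {0..1} \<Longrightarrow> mat_adj (H x) ** E x = mat 1"
      by (rule zero_energy[OF \<tau>]) blast
    note cH = acder_continuous[OF EH(3)]
    have n0: "norming \<tau> 0 = (1/2) *\<^sub>R matrix_inv (gram H 1)"
      by (rule norming_zero[OF \<tau> EH])
    \<comment> \<open>The value \<open>S 0\<close> that shifts the norming constant at 0 to \<open>\<alpha> 0\<close>.\<close>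
    define C where "C = 2 *\<^sub>R (\<alpha> 0 - norming \<tau> 0)"
    have pd: "pos_def (\<alpha> 0)" using R by simp
    have pd0: "pos_def (norming \<tau> 0)" unfolding n0 by (rule pos_def_inv_gram[OF cH EH(4)])
    have adjC: "mat_adj C = C"
      using pd pd0 by (simp add: C_def mat_adj_scaleR mat_adj_diff pos_def_def)
    have "matrix_inv (gram H 1) + C = 2 *\<^sub>R \<alpha> 0"
      by (simp add: C_def n0 algebra_simps)
    moreover have "Re (cinner ((2 *\<^sub>R \<alpha> 0) *v v) v) = 2 * Re (cinner (\<alpha> 0 *v v) v)" for v
      using linear_scale[OF bounded_linear.linear[OF bounded_linear_qform[of v]], of 2 "\<alpha> 0"]
      by (simp add: qform_def)
    ultimately have pos: "0 < Re (cinner ((matrix_inv (gram H 1) + C) *v v) v)" if "v \<noteq> 0" for v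
      using pd that by (simp add: pos_def_def)
    obtain \<tau>' S where g: "\<tau>' \<in> ReL2" "gauge_rel \<tau> \<tau>' S" "S 0 = C"
      by (rule gauge_rel_exists[OF \<tau> EH(3,4) adjC gram_perturbation_invertible[OF cH EH(4) pos]])
    have "(lam j, \<alpha> j) = data_a \<tau>' j" for j
    proof (cases j)
      case 0
      have "norming \<tau>' 0 = \<alpha> 0"
        using norming_zero_gauge[OF \<tau> g(2)] by (simp add: g(3) C_def)
      then show ?thesis using 0 R eig_zero[OF g(1)] by (simp add: data_a_def del: eig.simps)
    next
      case (Suc i)
      then show ?thesis
        using norming_gauge[OF \<tau> g(1,2), of i] lam_pos[of i] eig_gauge[OF \<tau> g(1,2), of "Suc i"]
        by (simp add: data_a_def lam al del: eig.simps)
    qed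
    then have "(\<lambda>j. (lam j, \<alpha> j)) = data_a \<tau>'" by (rule ext)
    then show "(\<lambda>j. (lam j, \<alpha> j)) \<in> frak_A" using g(1) by (auto simp: frak_A_def)
  qed
qed

end
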